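(* Let $\Omega_1,\Omega_2,\Gamma$, the space $V$, the discrete space $V_h$ (piecewise polynomials of degree $\le k$ on a mesh of size $h$, mapped by $F$) and the multiplier space $M_N$ (mapped trigonometric polynomials of degree $\le N$) be as in the context. Let $\pi_h : L^2(\Gamma)\to V_h|_{\Omega_1\cap\Gamma}$ denote the $L^2$-projection on $\Gamma$ onto the space $V_h|_{\Omega_1\cap\Gamma}$ of traces on $\Gamma$ of functions in $V_h|_{\Omega_1}$. Assume that there exists a linear operator $\Pi_h : V|_{\Omega_1}\to V_h|_{\Omega_1}$ such that $$\|\Pi_h v_1\|_{H^1(\Omega_1)}\le c_3\|v_1\|_{H^1(\Omega_1)},$$ $$\Pi_h v_1=\pi_h v_1\quad\text{on }\Gamma,$$ $$\|v-\pi_h v\|_{H^{-1/2}(\Gamma)}\le c_4\,\tfrac{h}{k}\,\|v\|_{H^{1/2}(\Gamma)},$$ for all $v_1\in V|_{\Omega_1}$ and all $v\in H^{1/2}(\Gamma)$. Then there exists a constant $0<\varepsilon<1$, depending only on $c_3$ and $c_4$, such that the discrete inf-sup condition $$\sup_{v_h\in V_h}\frac{\langle \mu_N,[v_h]\rangle_\Gamma}{\|v_h\|_{H^1(\Omega_1\cup\Omega_2)}}\ \ge\ \beta'\,\|\mu_N\|_{H^{-1/2}(\Gamma)}\qquad\text{for all }\mu_N\in M_N$$ holds with a constant $\beta'=\beta'(\varepsilon)>0$ whenever $N$ and $h$ are chosen such that $$N h/k\le 1-\varepsilon .$$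
   Context: **Geometry.** $\Omega_1,\Omega_2\subset\mathbb{R}^2$ are two bounded subdomains (stator and rotor of an electric machine) with interface $\Gamma=\partial\Omega_1\cap\partial\Omega_2$, and $\Sigma_\ell=\partial\Omega_\ell\setminus\Gamma$ for $\ell=1,2$ are the remaining parts of the boundaries. The boundary parts $\Sigma_\ell$ and $\Gamma$ are smooth and have non-zero measure. Using polar coordinates, the computational domain $\Omega=\Omega_1\cup\Omega_2$ is represented as the image of a rectangle $\widehat\Omega$ under a mapping $F:\widehat\Omega\to\Omega$, with $\widehat\Omega_1,\widehat\Omega_2$ the parts of $\widehat\Omega$ corresponding to $\Omega_1,\Omega_2$. **Function spaces.** $H^1(\Omega_1\cup\Omega_2)$ is the space of functions $v$ with restrictions $v_\ell=v|_{\Omega_\ell}\in H^1(\Omega_\ell)$, $\ell=1,2$ (no continuity across $\Gamma$ required), with its natural piecewise norm; $[v]=v_1-v_2$ is the jump across $\Gamma$. $V=\{v\in H^1(\Omega_1\cup\Omega_2): v|_{\Sigma_\ell}=0,\ \ell=1,2\}$, and $V|_{\Omega_1}$ is the space of restrictions of its elements to $\Omega_1$. $H^{-1/2}(\Gamma)$ is the dual of $H^{1/2}(\Gamma)$ and $\langle\cdot,\cdot\rangle_\Gamma$ is the corresponding duality product. **Mesh and approximation spaces.** $\widehat T_h$ is a shape-regular partition of $\widehat\Omega_1\cup\widehat\Omega_2$ into triangles and/or rectangles of size $h$; the meshes of the two subdomains are geometrically conforming, but may be non-matching across the interface. $P_k(\widehat T_h)$ is the space of piecewise polynomials over $\widehat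 T_h$ of degree $\le k$, and $F(P_k(\widehat T_h))$ is its transport to $\Omega$ by $F$. $V_h$ is a finite-dimensional subspace of $F(P_k(\widehat T_h))\cap V$ with the property (written $V_h=V_h|_{\Omega_1}\cup V_h|_{\Omega_2}$) that discrete functions, when restricted to one of the subdomains and extended by zero to the other, still belong to $V_h$. $V_h|_{\Omega_1}$ is the space of restrictions of elements of $V_h$ to $\Omega_1$. **Multiplier space.** $\widehat M_N=\operatorname{span}\{\sin(n\pi\xi),\cos(n\pi\xi):0\le n\le N\}$ is the space of trigonometric polynomials of degree $\le N$ in the reference coordinate $\xi$ along the interface, and $M_N=F(\widehat M_N)\subset H^{-1/2}(\Gamma)$ is its transport to $\Gamma$ by $F$.
   Formalization: The degree N is assumed to be at least 1: for N = 0 the condition Nh/k ≤ 1−ε is void and the claim fails (V_h with zero traces on Γ, π_h = Π_h = 0, c_4 = k/h, μ = 1). *)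

theory Defs
  imports "HOL-Analysis.Analysis"
begin

section \<open>Smooth functions, Sobolev space $H^1$ and traces\<close>

text \<open>\<open>Ck n S f\<close>: on the open set \<open>S\<close>, \<open>f\<close> has continuous iterated partial
  derivatives up to order \<open>n\<close>.\<close>

primrec Ck :: "nat \<Rightarrow> 'a::euclidean_space set \<Rightarrow> ('a \<Rightarrow> 'b::real_normed_vector) \<Rightarrow> bool" where
  "Ck 0 S f \<longleftrightarrow> continuous_on S f"
| "Ck (Suc n) S f \<longleftrightarrow>
     (\<forall>x\<in>S. f differentiable (at x)) \<and>
     (\<forall>b\<in>Basis. Ck n S (\<lambda>x. frechet_derivative f (at x) b))"

definition smooth_on :: "'a::euclidean_space set \<Rightarrow> ('a \<Rightarrow> 'b::real_normed_vector) \<Rightarrow> bool" where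
  "smooth_on S f \<longleftrightarrow> (\<forall>n. Ck n S f)"

definition test_function :: "'a::euclidean_space set \<Rightarrow> ('a \<Rightarrow> real) \<Rightarrow> bool" where
  "test_function U \<phi> \<longleftrightarrow>
     smooth_on UNIV \<phi> \<and> (\<exists>K. compact K \<and> K \<subseteq> U \<and> (\<forall>x. x \<notin> K \<longrightarrow> \<phi> x = 0))"

definition L2 :: "'a measure \<Rightarrow> ('a \<Rightarrow> real) set" where
  "L2 M = {f \<in> borel_measurable M. integrable M (\<lambda>x. (f x)\<^sup>2)}"

definition weak_pderiv ::
  "'a::euclidean_space set \<Rightarrow> 'a \<Rightarrow> ('a \<Rightarrow> real) \<Rightarrow> ('a \<Rightarrow> real) \<Rightarrow> bool" where
  "weak_pderiv U b u w \<longleftrightarrow>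
     (\<forall>\<phi>. test_function U \<phi> \<longrightarrow>
        (\<integral>x. u x * frechet_derivative \<phi> (at x) b \<partial>lebesgue_on U)
          = - (\<integral>x. w x * \<phi> x \<partial>lebesgue_on U))"

text \<open>Elements of $L^2$ and $H^1$ are represented by functions, not by classes modulo null
  sets; only the values on the underlying domain matter.\<close>

definition H1 :: "'a::euclidean_space set \<Rightarrow> ('a \<Rightarrow> real) set" where
  "H1 U = {u \<in> L2 (lebesgue_on U).
             \<forall>b\<in>Basis. \<exists>w\<in>L2 (lebesgue_on U). weak_pderiv U b u w}"

definition pd :: "'a::euclidean_space set \<Rightarrow> 'a \<Rightarrow> ('a \<Rightarrow> real) \<Rightarrow> 'a \<Rightarrow> real" where
  "pd U b u = (SOME w. w \<in> L2 (lebesgue_on U) \<and> weak_pderiv U b u w)"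

definition H1_norm :: "'a::euclidean_space set \<Rightarrow> ('a \<Rightarrow> real) \<Rightarrow> real" where
  "H1_norm U u =
     sqrt ((\<integral>x. (u x)\<^sup>2 \<partial>lebesgue_on U)
           + (\<Sum>b\<in>Basis. \<integral>x. (pd U b u x)\<^sup>2 \<partial>lebesgue_on U))"

text \<open>The trace operator is the continuous extension of the restriction of $C^1$ functions,
  as a map from $H^1(U)$ to $L^2$ of a boundary part carrying the measure \<open>M\<close>.\<close>

definition has_trace ::
  "'a::euclidean_space set \<Rightarrow> 'a measure \<Rightarrow> ('a \<Rightarrow> real) \<Rightarrow> ('a \<Rightarrow> real) \<Rightarrow> bool" where
  "has_trace U M v g \<longleftrightarrow>
     v \<in> H1 U \<and> g \<in> L2 M \<and>
     (\<exists>\<phi>. (\<forall>n. Ck 1 UNIV (\<phi> n)) \<and>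
          (\<lambda>n. H1_norm U (\<lambda>x. \<phi> n x - v x)) \<longlonglongrightarrow> 0 \<and>
          (\<lambda>n::nat. \<integral>x. (\<phi> n x - g x)\<^sup>2 \<partial>M) \<longlonglongrightarrow> 0)"

definition bd_trace ::
  "'a::euclidean_space set \<Rightarrow> 'a measure \<Rightarrow> ('a \<Rightarrow> real) \<Rightarrow> 'a \<Rightarrow> real" where
  "bd_trace U M v = (SOME g. has_trace U M v g)"


section \<open>$H^{1/2}$ and its dual on a curve\<close>

text \<open>Arc length measure of a closed curve, parametrised injectively over the period
  $[-1,1)$; the space of this measure is the curve itself.\<close>

definition arc_measure :: "(real \<Rightarrow> 'a::euclidean_space) \<Rightarrow> 'a measure" where
  "arc_measure \<gamma> =
     distr (density (lebesgue_on {-1..<1}) (\<lambda>t. ennreal (norm (vector_derivative \<gamma> (at t)))))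
           (restrict_space borel (\<gamma> ` {-1..<1})) \<gamma>"

text \<open>Sobolev-Slobodeckij (Gagliardo) definition; the exponent is $d + 2s$ with
  $d = 1$ and $s = 1/2$.\<close>

definition slobodeckij :: "'a::euclidean_space measure \<Rightarrow> ('a \<Rightarrow> real) \<Rightarrow> ennreal" where
  "slobodeckij M g =
     (\<integral>\<^sup>+x. \<integral>\<^sup>+y. ennreal ((g x - g y)\<^sup>2 / (dist x y)\<^sup>2) \<partial>M \<partial>M)"

definition Hhalf :: "'a::euclidean_space measure \<Rightarrow> ('a \<Rightarrow> real) set" where
  "Hhalf M = {g \<in> L2 M. slobodeckij M g < \<infinity>}"

definition Hhalf_norm :: "'a::euclidean_space measure \<Rightarrow> ('a \<Rightarrow> real) \<Rightarrow> real" where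
  "Hhalf_norm M g = sqrt ((\<integral>x. (g x)\<^sup>2 \<partial>M) + enn2real (slobodeckij M g))"

text \<open>Dual norm of a functional on $H^{1/2}$. Functions in $L^2$ are identified with
  functionals through the $L^2$ pairing, which is the duality product for them.\<close>

definition Hmhalf_norm ::
  "'a::euclidean_space measure \<Rightarrow> (('a \<Rightarrow> real) \<Rightarrow> real) \<Rightarrow> real" where
  "Hmhalf_norm M l = (SUP w\<in>{w \<in> Hhalf M. Hhalf_norm M w \<noteq> 0}. \<bar>l w\<bar> / Hhalf_norm M w)"

definition pairing :: "'a measure \<Rightarrow> ('a \<Rightarrow> real) \<Rightarrow> ('a \<Rightarrow> real) \<Rightarrow> real" where
  "pairing M \<mu> = (\<lambda>w. \<integral>x. \<mu> x * w x \<partial>M)"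


section \<open>Geometry\<close>

text \<open>The reference rectangle is $[-1,1) \times (a,b)$ in coordinates (angle/$\pi$, radius),
  cut along radius $c$; the reference parts of \<open>\<Omega>1\<close> and \<open>\<Omega>2\<close> are $c < \rho < b$ and
  $a < \rho < c$. The mapping \<open>F\<close> is smooth up to the boundary, regular, and periodic in the
  angular coordinate, like the polar coordinates
  $F(\xi,\rho) = (\rho\cos\pi\xi, \rho\sin\pi\xi)$ with $0 < a$.
  The interface is therefore a closed curve.\<close>

type_synonym plane = "real \<times> real"

definition machine_geometry ::
  "(plane \<Rightarrow> plane) \<Rightarrow> real \<Rightarrow> real \<Rightarrow> real
     \<Rightarrow> plane set \<Rightarrow> plane set \<Rightarrow> plane set \<Rightarrow> plane set \<Rightarrow> plane set \<Rightarrow> bool" where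
  "machine_geometry F a c b \<Omega>1 \<Omega>2 \<Gamma> \<Sigma>1 \<Sigma>2 \<longleftrightarrow>
     a < c \<and> c < b \<and>
     (\<exists>U. open U \<and> UNIV \<times> {a..b} \<subseteq> U \<and> smooth_on U F) \<and>
     (\<forall>\<xi>. \<forall>\<rho>\<in>{a..b}. F (\<xi> + 2, \<rho>) = F (\<xi>, \<rho>)) \<and>
     inj_on F ({-1..<1} \<times> {a..b}) \<and>
     (\<forall>x\<in>UNIV \<times> {a..b}. bij (frechet_derivative F (at x))) \<and>
     \<Omega>1 = F ` ({-1..<1} \<times> {c<..<b}) \<and>
     \<Omega>2 = F ` ({-1..<1} \<times> {a<..<c}) \<and>
     open \<Omega>1 \<and> connected \<Omega>1 \<and> bounded \<Omega>1 \<and>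
     open \<Omega>2 \<and> connected \<Omega>2 \<and> bounded \<Omega>2 \<and>
     \<Gamma> = frontier \<Omega>1 \<inter> frontier \<Omega>2 \<and>
     \<Sigma>1 = frontier \<Omega>1 - \<Gamma> \<and>
     \<Sigma>2 = frontier \<Omega>2 - \<Gamma> \<and>
     \<Gamma> = (\<lambda>\<xi>. F (\<xi>, c)) ` {-1..<1} \<and>
     \<Sigma>1 = (\<lambda>\<xi>. F (\<xi>, b)) ` {-1..<1} \<and>
     \<Sigma>2 = (\<lambda>\<xi>. F (\<xi>, a)) ` {-1..<1}"

definition curve_measure :: "(plane \<Rightarrow> plane) \<Rightarrow> real \<Rightarrow> plane measure" where
  "curve_measure F \<rho> = arc_measure (\<lambda>\<xi>. F (\<xi>, \<rho>))"


section \<open>Function spaces on the two subdomains\<close>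

definition H1_pw_norm :: "plane set \<Rightarrow> plane set \<Rightarrow> (plane \<Rightarrow> real) \<Rightarrow> real" where
  "H1_pw_norm \<Omega>1 \<Omega>2 v = sqrt ((H1_norm \<Omega>1 v)\<^sup>2 + (H1_norm \<Omega>2 v)\<^sup>2)"

definition V_space ::
  "plane set \<Rightarrow> plane set \<Rightarrow> plane measure \<Rightarrow> plane measure \<Rightarrow> (plane \<Rightarrow> real) set" where
  "V_space \<Omega>1 \<Omega>2 M\<Sigma>1 M\<Sigma>2 =
     {v. v \<in> H1 \<Omega>1 \<and> v \<in> H1 \<Omega>2 \<and>
         has_trace \<Omega>1 M\<Sigma>1 v (\<lambda>_. 0) \<and> has_trace \<Omega>2 M\<Sigma>2 v (\<lambda>_. 0)}"

definition jump ::
  "plane set \<Rightarrow> plane set \<Rightarrow> plane measure \<Rightarrow> (plane \<Rightarrow> real) \<Rightarrow> plane \<Rightarrow> real" where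
  "jump \<Omega>1 \<Omega>2 M v = (\<lambda>x. bd_trace \<Omega>1 M v x - bd_trace \<Omega>2 M v x)"

text \<open>A restriction to a subdomain is represented by its extension by zero.\<close>

definition restr :: "plane set \<Rightarrow> (plane \<Rightarrow> real) \<Rightarrow> plane \<Rightarrow> real" where
  "restr \<Omega> v = (\<lambda>x. if x \<in> \<Omega> then v x else 0)"

definition lin_subspace :: "('a \<Rightarrow> real) set \<Rightarrow> bool" where
  "lin_subspace W \<longleftrightarrow>
     (\<lambda>_. 0) \<in> W \<and>
     (\<forall>u\<in>W. \<forall>v\<in>W. (\<lambda>x. u x + v x) \<in> W) \<and>
     (\<forall>r. \<forall>v\<in>W. (\<lambda>x. r * v x) \<in> W)"

definition finite_dim :: "('a \<Rightarrow> real) set \<Rightarrow> bool" where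
  "finite_dim W \<longleftrightarrow>
     (\<exists>B. finite B \<and> B \<subseteq> W \<and> (\<forall>v\<in>W. \<exists>r. v = (\<lambda>x. \<Sum>u\<in>B. r u * u x)))"

definition lin_operator ::
  "('a \<Rightarrow> real) set \<Rightarrow> ('a \<Rightarrow> real) set \<Rightarrow> (('a \<Rightarrow> real) \<Rightarrow> ('a \<Rightarrow> real)) \<Rightarrow> bool" where
  "lin_operator A B P \<longleftrightarrow>
     (\<forall>v\<in>A. P v \<in> B) \<and>
     (\<forall>u\<in>A. \<forall>v\<in>A. P (\<lambda>x. u x + v x) = (\<lambda>x. P u x + P v x)) \<and>
     (\<forall>r. \<forall>v\<in>A. P (\<lambda>x. r * v x) = (\<lambda>x. r * P v x))"


section \<open>Mesh, discrete spaces and multipliers\<close>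

definition is_triangle :: "plane set \<Rightarrow> bool" where
  "is_triangle K \<longleftrightarrow> (\<exists>p q r. \<not> collinear {p, q, r} \<and> K = convex hull {p, q, r})"

definition is_rectangle :: "plane set \<Rightarrow> bool" where
  "is_rectangle K \<longleftrightarrow>
     (\<exists>p u w. u \<noteq> 0 \<and> w \<noteq> 0 \<and> u \<bullet> w = 0 \<and>
        K = {p + s *\<^sub>R u + t *\<^sub>R w | s t. s \<in> {0..1} \<and> t \<in> {0..1}})"

definition conforming_partition :: "plane set set \<Rightarrow> plane set \<Rightarrow> bool" where
  "conforming_partition T R \<longleftrightarrow>
     finite T \<and> \<Union>T = R \<and>
     (\<forall>K\<in>T. is_triangle K \<or> is_rectangle K) \<and>
     (\<forall>K\<in>T. \<forall>L\<in>T. (K \<inter> L) face_of K \<and> (K \<inter> L) face_of L)"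

text \<open>No matching condition is imposed along $\rho = c$.\<close>

definition is_mesh :: "real \<Rightarrow> real \<Rightarrow> real \<Rightarrow> plane set set \<Rightarrow> bool" where
  "is_mesh a c b T \<longleftrightarrow>
     (\<exists>T1 T2. T = T1 \<union> T2 \<and>
        conforming_partition T1 ({-1..1} \<times> {c..b}) \<and>
        conforming_partition T2 ({-1..1} \<times> {a..c}))"

definition shape_regular :: "real \<Rightarrow> plane set set \<Rightarrow> bool" where
  "shape_regular \<sigma> T \<longleftrightarrow> (\<forall>K\<in>T. \<exists>x r. 0 < r \<and> ball x r \<subseteq> K \<and> diameter K \<le> \<sigma> * r)"

definition mesh_size :: "plane set set \<Rightarrow> real" where
  "mesh_size T = Max (diameter ` T)"

text \<open>Transported piecewise polynomials of total degree at most \<open>k\<close>. Values on the mesh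
  skeleton (a null set) are irrelevant and left free.\<close>

definition mapped_poly :: "(plane \<Rightarrow> plane) \<Rightarrow> plane set set \<Rightarrow> nat \<Rightarrow> (plane \<Rightarrow> real) set" where
  "mapped_poly F T k =
     {v. \<forall>K\<in>T. \<exists>r :: nat \<Rightarrow> nat \<Rightarrow> real. \<forall>(x, y)\<in>interior K.
           v (F (x, y)) = (\<Sum>i\<le>k. \<Sum>j\<le>k - i. r i j * x ^ i * y ^ j)}"

definition discrete_space ::
  "(plane \<Rightarrow> plane) \<Rightarrow> plane set \<Rightarrow> plane set \<Rightarrow> (plane \<Rightarrow> real) set \<Rightarrow> plane set set \<Rightarrow> nat
     \<Rightarrow> (plane \<Rightarrow> real) set \<Rightarrow> bool" where
  "discrete_space F \<Omega>1 \<Omega>2 V T k Vh \<longleftrightarrow>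
     lin_subspace Vh \<and> finite_dim Vh \<and> Vh \<subseteq> mapped_poly F T k \<inter> V \<and>
     (\<forall>v\<in>Vh. restr \<Omega>1 v \<in> Vh \<and> restr \<Omega>2 v \<in> Vh)"

definition trace_space ::
  "plane set \<Rightarrow> plane measure \<Rightarrow> (plane \<Rightarrow> real) set \<Rightarrow> (plane \<Rightarrow> real) set" where
  "trace_space U M W = {g. \<exists>v\<in>W. has_trace U M v g}"

text \<open>Orthogonal projection onto \<open>W\<close>; determined up to null sets.\<close>

definition L2_proj :: "'a measure \<Rightarrow> ('a \<Rightarrow> real) set \<Rightarrow> ('a \<Rightarrow> real) \<Rightarrow> 'a \<Rightarrow> real" where
  "L2_proj M W g = (SOME p. p \<in> W \<and> (\<forall>w\<in>W. (\<integral>x. (g x - p x) * w x \<partial>M) = 0))"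

definition trig_poly :: "nat \<Rightarrow> (real \<Rightarrow> real) set" where
  "trig_poly N =
     {m. \<exists>r s :: nat \<Rightarrow> real. m = (\<lambda>\<xi>. \<Sum>n\<le>N. r n * sin (n * pi * \<xi>) + s n * cos (n * pi * \<xi>))}"

definition multiplier_space ::
  "(plane \<Rightarrow> plane) \<Rightarrow> real \<Rightarrow> nat \<Rightarrow> (plane \<Rightarrow> real) set" where
  "multiplier_space F c N = {\<mu>. \<exists>m\<in>trig_poly N. \<forall>\<xi>. \<mu> (F (\<xi>, c)) = m \<xi>}"

end

theory Submission
  imports Defs
begin

text \<open>In the reference coordinate a multiplier is a trigonometric polynomial
  \<open>m = \<Sum>n\<le>N. m\<^sub>n\<close> with \<open>m\<^sub>n\<close> of frequency \<open>n\<close>. Put \<open>A = \<Sum>n\<le>N. \<parallel>m\<^sub>n\<parallel>\<^sup>2 / (1 + n)\<close> and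
  \<open>t = \<Sum>n\<le>N. m\<^sub>n / (1 + n)\<close>, and let \<open>J\<close> be the speed of the parametrisation of the interface.
  Then \<open>w = t / J\<close> satisfies \<open>\<langle>\<mu>, w\<rangle> = A\<close>, while the $H^{-1/2}$ norm of \<open>\<mu>\<close>, the
  $H^{1/2}$ norm of \<open>w\<close> and the $H^1$ norm of an explicit $C^1$ lifting \<open>v\<close> of \<open>w\<close> are all bounded by
  a multiple of \<open>sqrt A\<close>, and the $H^{1/2}$ norm of \<open>\<mu>\<close> by a multiple of \<open>N * sqrt A\<close>.
  The bounds for fractional norms follow by integrating, against \<open>h\<^sup>-\<^sup>2 dh\<close>, the Fourier expansion of
  differences with step \<open>h\<close>, on which frequency \<open>n\<close> acts by the factor \<open>2 - 2 * cos (n * pi * h)\<close>.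
  The extension by zero of \<open>\<Pi>h v\<close> has jump \<open>\<pi>h w\<close>, and
  \<open>\<langle>\<mu>, \<pi>h w\<rangle> = A - \<langle>\<mu>, w - \<pi>h w\<rangle> \<ge> A - const * c4 * (N * h / k) * A\<close>, which is at least \<open>A / 2\<close>
  once \<open>N * h / k\<close> is small.\<close>

section \<open>Smooth functions and bump functions\<close>

text \<open>Three obstacles shape the development. The objects \<open>pd\<close> and
  \<open>bd_trace\<close> are arbitrary choices, so no norm or jump can be evaluated before weak
  derivatives and traces are known to be unique almost everywhere; hence the smooth bumps, the
  fundamental lemma of the calculus of variations and the trace inequality. The weight
  \<open>J\<close> of arc length couples the frequencies; the division by \<open>J\<close> in
  \<open>w\<close> removes it from the pairing, and elsewhere it is treated as a Lipschitz
  multiplier. The coefficients of a multiplier are absorbed into a family \<open>e n\<close> that is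
  tied to its frequency by \<open>e n (x + h) + e n (x - h) = 2 * cos (n * pi * h) * e n x\<close>;
  energies may therefore vanish. The factor \<open>N\<close> comes from comparing the weights
  \<open>1 + n\<close> and \<open>1 / (1 + n)\<close>, an inverse estimate for trigonometric
  polynomials. The statement fixes \<open>\<beta>'\<close> before \<open>c3\<close> and
  \<open>c4\<close>, with the geometry given. The stability constant \<open>c3\<close> can enter
  only through \<open>\<epsilon>\<close>, so \<open>1 - \<epsilon>\<close> is taken at most
  \<open>1 / c3\<close> and \<open>\<beta>' \<epsilon>\<close> proportional to
  \<open>1 - \<epsilon>\<close>.\<close>

lemma Ck_UNIV_Suc_I:
  assumes "\<And>x. (f has_derivative f' x) (at x)"
    and "\<And>b. b \<in> Basis \<Longrightarrow> Ck n UNIV (\<lambda>x. f' x b)"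
  shows "Ck (Suc n) UNIV f"
proof -
  have "frechet_derivative f (at x) = f' x" for x
    using frechet_derivative_at[OF assms(1)] by simp
  then show ?thesis using assms by (auto simp: differentiable_def)
qed

lemma Ck_mono_Suc: "Ck (Suc n) S f \<Longrightarrow> Ck n S f"
proof (induction n arbitrary: f)
  case 0
  then show ?case
    by (meson Ck.simps differentiable_at_withinI differentiable_imp_continuous_on
        differentiable_on_def)
next
  case (Suc n)
  then show ?case using Ck.simps(2) by blast
qed

lemma Ck_UNIV_Suc_D:
  assumes "Ck (Suc n) UNIV f"
  shows "(f has_derivative frechet_derivative f (at x)) (at x)"
    and "b \<in> Basis \<Longrightarrow> Ck n UNIV (\<lambda>x. frechet_derivative f (at x) b)"
  using assms by (auto simp: frechet_derivative_works)

lemma Ck_const: "Ck n UNIV (\<lambda>x. c)"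
  by (induction n arbitrary: c) (auto intro!: Ck_UNIV_Suc_I[where f' = "\<lambda>_ _. 0"])

lemma Ck_add: "Ck n UNIV f \<Longrightarrow> Ck n UNIV g \<Longrightarrow> Ck n UNIV (\<lambda>x. f x + g x)"
proof (induction n arbitrary: f g)
  case 0
  then show ?case by (auto intro!: continuous_intros)
next
  case (Suc n)
  show ?case
    by (rule Ck_UNIV_Suc_I[OF has_derivative_add[OF Ck_UNIV_Suc_D(1)[OF Suc.prems(1)]
          Ck_UNIV_Suc_D(1)[OF Suc.prems(2)]]])
      (intro Suc.IH Ck_UNIV_Suc_D(2)[OF Suc.prems(1)] Ck_UNIV_Suc_D(2)[OF Suc.prems(2)])
qed

lemma Ck_mult:
  fixes f g :: "'a::euclidean_space \<Rightarrow> real"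
  shows "Ck n UNIV f \<Longrightarrow> Ck n UNIV g \<Longrightarrow> Ck n UNIV (\<lambda>x. f x * g x)"
proof (induction n arbitrary: f g)
  case 0
  then show ?case by (auto intro!: continuous_intros)
next
  case (Suc n)
  show ?case
    by (rule Ck_UNIV_Suc_I[OF has_derivative_mult[OF Ck_UNIV_Suc_D(1)[OF Suc.prems(1)]
          Ck_UNIV_Suc_D(1)[OF Suc.prems(2)]]])
      (intro Suc.IH Ck_add Ck_UNIV_Suc_D(2)[OF Suc.prems(1)] Ck_UNIV_Suc_D(2)[OF Suc.prems(2)]
        Ck_mono_Suc[OF Suc.prems(1)] Ck_mono_Suc[OF Suc.prems(2)])
qed

lemma Ck_prod:
  fixes f :: "'i \<Rightarrow> 'a::euclidean_space \<Rightarrow> real"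
  assumes "\<And>i. i \<in> I \<Longrightarrow> Ck n UNIV (f i)"
  shows "Ck n UNIV (\<lambda>x. \<Prod>i\<in>I. f i x)"
  using assms
  by (induction I rule: infinite_finite_induct) (auto intro!: Ck_const Ck_mult)

text \<open>The family \<open>exp (-1/x) / x ^ k\<close> is closed under differentiation up to linear
  combinations, which yields smoothness of \<open>bump_pow 0\<close>.\<close>

definition bump_pow :: "nat \<Rightarrow> real \<Rightarrow> real" where
  "bump_pow k x = (if 0 < x then exp (- 1 / x) / x ^ k else 0)"

lemma power_div_fact_le_exp:
  fixes x :: real
  assumes "0 \<le> x"
  shows "x ^ n / fact n \<le> exp x"
proof -
  have "(\<Sum>i\<in>{n}. x ^ i /\<^sub>R fact i) \<le> (\<Sum>i. x ^ i /\<^sub>R fact i)"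
    by (rule sum_le_suminf) (use assms summable_exp_generic[of x] in auto)
  then show ?thesis by (simp add: exp_def divide_inverse mult.commute)
qed

text \<open>The term of order \<open>k + 2\<close> in the series of \<open>exp (1 / x)\<close> beats
  the division by \<open>x ^ k\<close> and leaves \<open>x\<^sup>2\<close>. A quadratic bound for
  every \<open>k\<close> makes all difference quotients at 0 tend to 0.\<close>

lemma bump_pow_le: "\<bar>bump_pow k x\<bar> \<le> fact (k + 2) * x\<^sup>2"
proof (cases "0 < x")
  case True
  have "(1/x) ^ (k+2) / fact (k+2) \<le> exp (1/x)"
    using True by (intro power_div_fact_le_exp) auto
  then have "(1/x) ^ (k+2) \<le> exp (1/x) * fact (k+2)"
    by (simp only: pos_divide_le_eq fact_gt_zero)
  then have *: "1 \<le> exp (1/x) * fact (k+2) * x ^ (k+2)"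
    using True by (simp only: power_divide pos_divide_le_eq zero_less_power power_one)
  have "exp (- 1 / x) \<le> exp (-1/x) * (exp (1/x) * fact (k+2) * x ^ (k+2))"
    using mult_left_mono[OF *, of "exp (-1/x)"] by simp
  also have "\<dots> = (exp (-1/x) * exp (1/x)) * fact (k+2) * x ^ (k+2)"
    by (simp only: mult.assoc)
  also have "exp (-1/x) * exp (1/x) = 1"
    by (simp flip: exp_add)
  finally have "exp (- 1 / x) \<le> fact (k+2) * x ^ (k+2)" by simp
  then have "exp (- 1 / x) / x ^ k \<le> fact (k+2) * x ^ (k+2) / x ^ k"
    using True by (intro divide_right_mono) auto
  also have "\<dots> = fact (k+2) * x\<^sup>2"
    using True by (simp add: power_add power2_eq_square)
  finally show ?thesis using True by (simp add: bump_pow_def)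
qed (simp add: bump_pow_def)

lemma DERIV_bump_pow:
  "(bump_pow k has_real_derivative (bump_pow (k + 2) x - real k * bump_pow (k + 1) x)) (at x)"
proof (cases x "0 :: real" rule: linorder_cases)
  case greater
  have "((\<lambda>x. exp (- 1 / x) / x ^ k) has_real_derivative
      (bump_pow (k + 2) x - real k * bump_pow (k + 1) x)) (at x)"
  proof (cases k)
    case 0
    then show ?thesis using greater
      by (auto intro!: derivative_eq_intros
        simp: bump_pow_def divide_simps power2_eq_square algebra_simps)
  next
    case (Suc m)
    have "((\<lambda>x. exp (- 1 / x) / x ^ Suc m) has_real_derivative
        (exp (-1/x) * (1 / x\<^sup>2) * x ^ Suc m - exp (-1/x) * (real (Suc m) * x ^ m)) / (x ^ Suc m * x ^ Suc m)) (at x)"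
      using greater by (intro DERIV_divide)
        (auto intro!: derivative_eq_intros simp: power2_eq_square simp del: power_Suc of_nat_Suc)
    moreover have "(exp (-1/x) * (1 / x\<^sup>2) * x ^ Suc m - exp (-1/x) * (real (Suc m) * x ^ m)) / (x ^ Suc m * x ^ Suc m)
        = bump_pow (k + 2) x - real k * bump_pow (k + 1) x"
      using greater unfolding Suc
      by (simp add: bump_pow_def power2_eq_square divide_simps) (simp add: left_diff_distrib)
    ultimately show ?thesis unfolding Suc by simp
  qed
  moreover have "\<forall>\<^sub>F y in nhds x. 0 < y"
    using greater by (intro eventually_nhds_in_open[of "{0<..}", simplified]) auto
  then have "\<forall>\<^sub>F y in nhds x. bump_pow k y = exp (- 1 / y) / y ^ k"
    by eventually_elim (simp add: bump_pow_def)
  ultimately show ?thesis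
    by (simp only: DERIV_cong_ev[OF refl _ refl])
next
  case less
  have "\<forall>\<^sub>F y in nhds x. y < 0"
    using less by (intro eventually_nhds_in_open[of "{..<0}", simplified]) auto
  then have "\<forall>\<^sub>F y in nhds x. bump_pow k y = 0"
    by eventually_elim (simp add: bump_pow_def)
  moreover have "((\<lambda>_. 0) has_real_derivative (bump_pow (k + 2) x - real k * bump_pow (k + 1) x)) (at x)"
    using less by (simp add: bump_pow_def)
  ultimately show ?thesis
    by (simp only: DERIV_cong_ev[OF refl _ refl])
next
  \<comment> \<open>At 0 the asserted derivative is 0, and \<open>bump_pow_le\<close> bounds the
    difference quotient by a multiple of \<open>\<bar>h\<bar>\<close>.\<close>
  case equal
  have "((\<lambda>h. (bump_pow k (0 + h) - bump_pow k 0) / h) \<longlongrightarrow> 0) (at 0)"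
  proof (rule Lim_null_comparison)
    show "((\<lambda>h. fact (k + 2) * \<bar>h\<bar>) \<longlongrightarrow> (0::real)) (at 0)"
      by (auto intro!: tendsto_eq_intros)
    have "norm ((bump_pow k (0 + h) - bump_pow k 0) / h) \<le> fact (k + 2) * \<bar>h\<bar>" if "h \<noteq> 0" for h
      using bump_pow_le[of k h] bump_pow_le[of k 0] that
      by (simp add: divide_simps power2_eq_square mult.assoc flip: abs_mult)
    then show "\<forall>\<^sub>F h in at 0. norm ((bump_pow k (0 + h) - bump_pow k 0) / h) \<le> fact (k + 2) * \<bar>h\<bar>"
      by (auto simp: eventually_at intro: exI[of _ 1])
  qed
  then show ?thesis using equal by (simp add: DERIV_def bump_pow_def)
qed

text \<open>Differentiation sends index \<open>k\<close> to \<open>k + 2\<close> and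
  \<open>k + 1\<close>, so the induction on the order of smoothness has to be for all
  \<open>k\<close> at once. An affine argument is carried along because \<open>box_bump\<close>
  scales and reflects the coordinates.\<close>

lemma Ck_bump_pow_affine:
  fixes b :: "'a::euclidean_space"
  shows "Ck n UNIV (\<lambda>x. bump_pow k (s * (x \<bullet> b) + t))"
proof (induction n arbitrary: k)
  case 0
  have "continuous_on UNIV (bump_pow k)"
    by (rule DERIV_continuous_on[OF DERIV_subset[OF DERIV_bump_pow subset_UNIV]])
  then have "continuous_on UNIV (bump_pow k \<circ> (\<lambda>x::'a. s * (x \<bullet> b) + t))"
    by (intro continuous_on_compose continuous_intros) (rule continuous_on_subset[OF _ subset_UNIV])
  then show ?case by (simp add: o_def)
next
  case (Suc n)
  let ?d = "\<lambda>x. bump_pow (k + 2) (s * (x \<bullet> b) + t) + (- real k) * bump_pow (k + 1) (s * (x \<bullet> b) + t)"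
  have "((\<lambda>x. bump_pow k (s * (x \<bullet> b) + t)) has_derivative (\<lambda>v. ?d x * (s * (v \<bullet> b)))) (at x)" for x
  proof -
    have "((\<lambda>x. s * (x \<bullet> b) + t) has_derivative (\<lambda>v. s * (v \<bullet> b))) (at x)"
      by (auto intro!: derivative_eq_intros)
    from DERIV_compose_FDERIV[OF DERIV_bump_pow this] show ?thesis
      by (simp add: mult_ac)
  qed
  then show ?case
    by (rule Ck_UNIV_Suc_I) (intro Ck_mult Ck_add Ck_const Suc.IH)
qed

lemma bump_pow_0: "0 \<le> bump_pow 0 x" "bump_pow 0 x \<le> 1" "x \<le> 0 \<Longrightarrow> bump_pow 0 x = 0"
  by (auto simp: bump_pow_def)

lemma bump_pow_0_tendsto:
  "(\<lambda>n. bump_pow 0 (real (Suc n) * x)) \<longlonglongrightarrow> (if 0 < x then 1 else 0)"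
proof (cases "0 < x")
  case True
  have "(\<lambda>n. exp (- ((1 / x) * inverse (real (Suc n))))) \<longlonglongrightarrow> exp (- ((1 / x) * 0))"
    by (intro tendsto_intros LIMSEQ_inverse_real_of_nat)
  moreover have "bump_pow 0 (real (Suc n) * x) = exp (- ((1 / x) * inverse (real (Suc n))))" for n
    using True by (simp add: bump_pow_def zero_less_mult_iff divide_inverse mult.commute)
  ultimately show ?thesis using True by simp
qed (simp add: bump_pow_def zero_less_mult_iff)

text \<open>Inside the box every factor is \<open>exp (- 1 / ((n + 1) * s))\<close> with
  \<open>s\<close> the distance to a face, so it tends to 1, while the support stays in the closed
  box for all \<open>n\<close>: a smooth approximation of the indicator from inside. The affine form
  of the arguments is the one of \<open>Ck_bump_pow_affine\<close>.\<close>

definition box_bump :: "'a::euclidean_space \<Rightarrow> 'a \<Rightarrow> nat \<Rightarrow> 'a \<Rightarrow> real" where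
  "box_bump p q n x = (\<Prod>b\<in>Basis. bump_pow 0 (real (Suc n) * (x \<bullet> b) + - real (Suc n) * (p \<bullet> b))
      * bump_pow 0 (- real (Suc n) * (x \<bullet> b) + real (Suc n) * (q \<bullet> b)))"

lemma box_bump_alt: "box_bump p q n x = (\<Prod>b\<in>Basis. bump_pow 0 (real (Suc n) * (x \<bullet> b - p \<bullet> b))
      * bump_pow 0 (real (Suc n) * (q \<bullet> b - x \<bullet> b)))"
  unfolding box_bump_def by (simp add: algebra_simps)

lemma box_bump_outside:
  assumes "x \<notin> box p q"
  shows "box_bump p q n x = 0"
proof -
  obtain b where b: "b \<in> Basis" "x \<bullet> b - p \<bullet> b \<le> 0 \<or> q \<bullet> b - x \<bullet> b \<le> 0"
    using assms by (auto simp: mem_box not_less)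
  then have "bump_pow 0 (real (Suc n) * (x \<bullet> b - p \<bullet> b)) = 0
      \<or> bump_pow 0 (real (Suc n) * (q \<bullet> b - x \<bullet> b)) = 0"
    by (meson bump_pow_0(3) mult_nonneg_nonpos of_nat_0_le_iff)
  then show ?thesis
    unfolding box_bump_alt using b(1) by (intro prod_zero bexI[of _ b]) auto
qed

lemma box_bump_bounds: "0 \<le> box_bump p q n x" "box_bump p q n x \<le> 1"
  unfolding box_bump_alt
  by (intro prod_nonneg prod_le_1 mult_nonneg_nonneg mult_le_one bump_pow_0 conjI ballI)+

lemma test_function_box_bump:
  assumes "cbox p q \<subseteq> U"
  shows "test_function U (box_bump p q n)"
proof -
  have "Ck k UNIV (box_bump p q n)" for k
    unfolding box_bump_def by (intro Ck_prod Ck_mult Ck_bump_pow_affine)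
  then show ?thesis
    unfolding test_function_def smooth_on_def using assms box_bump_outside box_subset_cbox
    by (metis compact_cbox subset_iff)
qed

lemma box_bump_tendsto: "(\<lambda>n. box_bump p q n x) \<longlonglongrightarrow> indicator (box p q) x"
proof -
  have "(\<lambda>n. box_bump p q n x) \<longlonglongrightarrow> (\<Prod>b\<in>Basis. (if 0 < x \<bullet> b - p \<bullet> b then 1 else 0)
      * (if 0 < q \<bullet> b - x \<bullet> b then 1 else 0))"
    unfolding box_bump_alt by (intro tendsto_prod tendsto_mult bump_pow_0_tendsto)
  also have "(\<Prod>b\<in>Basis. (if 0 < x \<bullet> b - p \<bullet> b then 1 else 0)
      * (if 0 < q \<bullet> b - x \<bullet> b then 1 else (0::real))) = indicator (box p q) x"
  proof (cases "x \<in> box p q")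
    case True
    then show ?thesis by (auto simp: mem_box intro!: prod.neutral)
  next
    case False
    then obtain b where "b \<in> Basis" "\<not> (p \<bullet> b < x \<bullet> b \<and> x \<bullet> b < q \<bullet> b)"
      by (auto simp: mem_box)
    then show ?thesis using False by (subst prod_zero) (auto intro!: bexI[of _ b])
  qed
  finally show ?thesis .
qed

text \<open>Open boxes form an intersection-stable generator of the Borel sets, so a Dynkin argument
  carries the vanishing integrals to every Borel set; the sets where a Borel version
  \<open>g\<close> of \<open>f\<close> is positive or negative then finish.\<close>

lemma AE_zero_of_box_integrals_zero:
  fixes f :: "'a::euclidean_space \<Rightarrow> real"
  assumes f: "integrable lebesgue f"
    and zero: "\<And>p q. (\<integral>x. indicator (box p q) x * f x \<partial>lebesgue) = 0"
  shows "AE x in lebesgue. f x = 0"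
proof -
  have [measurable]: "f \<in> borel_measurable lebesgue" using f by auto
  have int: "integrable lebesgue (\<lambda>x. indicator A x * f x)" if "A \<in> sets borel" for A
    using integrable_real_mult_indicator[of A lebesgue f] that f by (simp add: mult.commute)
  \<comment> \<open>The complement step of the Dynkin argument needs the integral over the whole
    space, which is the limit of the integrals over growing boxes.\<close>
  have tot: "(\<integral>x. f x \<partial>lebesgue) = 0"
  proof -
    have "(\<lambda>n. \<integral>x. indicator (box (- real n *\<^sub>R One) (real n *\<^sub>R One)) x * f x \<partial>lebesgue)
        \<longlonglongrightarrow> (\<integral>x. f x \<partial>lebesgue)"
    proof (rule integral_dominated_convergence[where w = "\<lambda>x. \<bar>f x\<bar>"])
      show "(\<lambda>x. indicator (box (- real n *\<^sub>R One) (real n *\<^sub>R One)) x * f x) \<in> borel_measurable lebesgue" for n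
        using int[of "box (- real n *\<^sub>R One) (real n *\<^sub>R One)"] by auto
      show "AE x in lebesgue. (\<lambda>n. indicator (box (- real n *\<^sub>R One) (real n *\<^sub>R One)) x * f x) \<longlonglongrightarrow> f x"
      proof (rule AE_I2)
        fix x :: 'a
        obtain m where m: "norm x < real m" using reals_Archimedean2 by blast
        have "x \<in> box (- real n *\<^sub>R One) (real n *\<^sub>R One)" if "m \<le> n" for n
        proof -
          have "\<bar>x \<bullet> b\<bar> < real n" if "b \<in> Basis" for b
            using Basis_le_norm[OF that, of x] m \<open>m \<le> n\<close> by linarith
          then show ?thesis by (fastforce simp: mem_box abs_less_iff)
        qed
        then have "\<forall>\<^sub>F n in sequentially. indicator (box (- real n *\<^sub>R One) (real n *\<^sub>R One)) x * f x = f x"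
          by (auto simp: eventually_sequentially indicator_def)
        then show "(\<lambda>n. indicator (box (- real n *\<^sub>R One) (real n *\<^sub>R One)) x * f x) \<longlonglongrightarrow> f x"
          by (rule tendsto_eventually)
      qed
    qed (use f int in \<open>auto simp: indicator_def\<close>)
    then show ?thesis using zero by (simp add: LIMSEQ_const_iff)
  qed
  have borel_zero: "(\<integral>x. indicator A x * f x \<partial>lebesgue) = 0" if "A \<in> sets borel" for A
  proof -
    have A: "A \<in> sigma_sets UNIV (range (\<lambda>(a, b). box a b :: 'a set))"
      using that unfolding borel_eq_box by simp
    have "Int_stable (range (\<lambda>(a, b). box a b :: 'a set))"
      by (auto simp: Int_stable_def box_Int_box)
    moreover have "range (\<lambda>(a, b). box a b :: 'a set) \<subseteq> Pow UNIV" by simp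
    ultimately show ?thesis using A
    proof (induction rule: sigma_sets_induct_disjoint)
      case (basic A)
      then show ?case using zero by auto
    next
      case (compl A)
      have A: "A \<in> sets borel" using compl(1) unfolding borel_eq_box by simp
      have "(\<integral>x. indicator (UNIV - A) x * f x \<partial>lebesgue)
          = (\<integral>x. f x - indicator A x * f x \<partial>lebesgue)"
        by (intro Bochner_Integration.integral_cong) (auto simp: indicator_def)
      then show ?case using compl tot int[OF A] f by simp
    next
      case (union A)
      have A: "A i \<in> sets borel" for i using union(2) unfolding borel_eq_box by auto
      have "set_lebesgue_integral lebesgue (\<Union>i. A i) f = (\<Sum>i. set_lebesgue_integral lebesgue (A i) f)"
        using A int[of "\<Union>i. A i"] union(1)
        by (intro lebesgue_integral_countable_add)
          (auto simp: set_integrable_def disjoint_family_on_def)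
      also have "\<dots> = 0" using union(3) by (simp add: set_lebesgue_integral_def)
      finally show ?case by (simp add: set_lebesgue_integral_def)
    qed auto
  qed
  obtain g where g: "g \<in> borel_measurable borel" "AE x in lborel. f x = g x"
    using completion_ex_borel_measurable_real[of f lborel] by auto
  have ae: "AE x in lebesgue. f x = g x" using g(2) by (rule AE_completion)
  \<comment> \<open>\<open>s = 1\<close> and \<open>s = - 1\<close> treat the sets where
    \<open>g\<close> is positive and negative by one argument.\<close>
  have pos: "AE x in lebesgue. s * (indicator {x. 0 < s * g x} x * f x) = 0" for s :: real
  proof -
    have B: "{x. 0 < s * g x} \<in> sets borel" using g(1) by measurable
    have "AE x in lebesgue. 0 \<le> s * (indicator {x. 0 < s * g x} x * f x)"
      using ae by eventually_elim (auto simp: indicator_def)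
    moreover have "integrable lebesgue (\<lambda>x. s * (indicator {x. 0 < s * g x} x * f x))"
      by (intro integrable_mult_right int B)
    ultimately show ?thesis
      using integral_nonneg_eq_0_iff_AE[of lebesgue "\<lambda>x. s * (indicator {x. 0 < s * g x} x * f x)"]
        borel_zero[OF B] by simp
  qed
  have "AE x in lebesgue. indicator {x. 0 < g x} x * f x = 0"
    using pos[of 1] by simp
  moreover have "AE x in lebesgue. indicator {x. g x < 0} x * f x = 0"
    using pos[of "-1"] by simp
  ultimately show ?thesis using ae
    by eventually_elim (auto simp: indicator_def split: if_splits)
qed

section \<open>Weak derivatives and the space $H^1$\<close>

lemma test_functionD:
  assumes "test_function U \<phi>"
  shows "Ck n UNIV \<phi>" "continuous_on UNIV \<phi>" "(\<phi> has_derivative frechet_derivative \<phi> (at x)) (at x)"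
  using assms Ck_UNIV_Suc_D(1)[of 0 \<phi>]
  by (auto simp: test_function_def smooth_on_def dest: spec[of _ 0] spec[of _ "Suc 0"])

lemma test_function_pderiv:
  assumes "test_function U \<phi>" "b \<in> Basis"
  shows "test_function U (\<lambda>x. frechet_derivative \<phi> (at x) b)"
proof -
  obtain K where K: "compact K" "K \<subseteq> U" "\<And>x. x \<notin> K \<Longrightarrow> \<phi> x = 0"
    using assms(1) by (auto simp: test_function_def)
  have "frechet_derivative \<phi> (at x) b = 0" if "x \<notin> K" for x
  proof -
    have "open (- K)" using K(1) compact_imp_closed by blast
    then have "(\<phi> has_derivative (\<lambda>_. 0)) (at x)"
      by (rule has_derivative_transform_within_open[OF has_derivative_const]) (use that K(3) in auto)
    then show ?thesis by (metis frechet_derivative_at)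
  qed
  moreover have "Ck n UNIV (\<lambda>x. frechet_derivative \<phi> (at x) b)" for n
    using Ck_UNIV_Suc_D(2)[OF test_functionD(1)[OF assms(1)] assms(2)] by blast
  ultimately show ?thesis
    using K by (auto simp: test_function_def smooth_on_def)
qed

text \<open>The fundamental lemma of the calculus of variations. Testing with
  \<open>box_bump\<close> and passing to the limit gives vanishing integrals over all boxes whose
  closed version lies in \<open>U\<close>, and countably many of these cover \<open>U\<close>.
  Integrability is asked on closed boxes, since each dominated convergence stays within one of
  them.\<close>

lemma AE_zero_of_test_integrals_zero:
  fixes f :: "'a::euclidean_space \<Rightarrow> real"
  assumes "open U"
    and loc: "\<And>p q. cbox p q \<subseteq> U \<Longrightarrow> integrable lebesgue (\<lambda>x. indicator (cbox p q) x * f x)"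
    and zero: "\<And>\<phi>. test_function U \<phi> \<Longrightarrow> (\<integral>x. f x * \<phi> x \<partial>lebesgue_on U) = 0"
  shows "AE x in lebesgue_on U. f x = 0"
proof -
  have U[measurable]: "U \<in> sets lebesgue" using \<open>open U\<close> by auto
  have box_zero: "(\<integral>x. indicator (box p q) x * f x \<partial>lebesgue) = 0" if "cbox p q \<subseteq> U" for p q
  proof -
    have [measurable]: "(\<lambda>x. indicator (cbox p q) x * f x) \<in> borel_measurable lebesgue"
      using loc[OF that] by auto
    have cont: "continuous_on UNIV (box_bump p q n)" for n
      using test_functionD(2)[OF test_function_box_bump[OF that]] .
    have [measurable]: "box_bump p q n \<in> borel_measurable lebesgue" for n
      using borel_measurable_continuous_onI[OF cont] by (simp add: measurable_completion)
    have eq: "box_bump p q n x * f x = box_bump p q n x * (indicator (cbox p q) x * f x)" for n x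
      using box_bump_outside[of x p q n] box_subset_cbox[of p q] by (auto simp: indicator_def)
    have "(\<lambda>n. \<integral>x. box_bump p q n x * f x \<partial>lebesgue) \<longlonglongrightarrow> (\<integral>x. indicator (box p q) x * f x \<partial>lebesgue)"
    proof (rule integral_dominated_convergence[where w = "\<lambda>x. \<bar>indicator (cbox p q) x * f x\<bar>"])
      have "indicator (box p q) x * f x = indicator (box p q) x * (indicator (cbox p q) x * f x)" for x
        using box_subset_cbox[of p q] by (auto simp: indicator_def)
      then have "(\<lambda>x. indicator (box p q) x * f x) = (\<lambda>x. indicator (box p q) x * (indicator (cbox p q) x * f x))"
        by blast
      then show "(\<lambda>x. indicator (box p q) x * f x) \<in> borel_measurable lebesgue"
        by (rule ssubst) (intro borel_measurable_times[where g = "\<lambda>x. indicator (cbox p q) x * f x"] borel_measurable_indicator, auto)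
      show "(\<lambda>x. box_bump p q n x * f x) \<in> borel_measurable lebesgue" for n
        unfolding eq by measurable
      show "AE x in lebesgue. (\<lambda>n. box_bump p q n x * f x) \<longlonglongrightarrow> indicator (box p q) x * f x"
        by (intro AE_I2 tendsto_intros box_bump_tendsto)
      show "AE x in lebesgue. norm (box_bump p q n x * f x) \<le> \<bar>indicator (cbox p q) x * f x\<bar>" for n
        unfolding eq
        by (intro AE_I2) (use box_bump_bounds[of p q n] in \<open>auto simp: abs_mult intro!: mult_left_le_one_le\<close>)
      show "integrable lebesgue (\<lambda>x. \<bar>indicator (cbox p q) x * f x\<bar>)"
        by (rule integrable_abs[OF loc[OF that]])
    qed
    moreover have "(\<integral>x. box_bump p q n x * f x \<partial>lebesgue) = 0" for n
    proof -
      have "(\<integral>x. box_bump p q n x * f x \<partial>lebesgue) = (\<integral>x. indicator U x *\<^sub>R (f x * box_bump p q n x) \<partial>lebesgue)"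
        using box_bump_outside[of _ p q n] box_subset_cbox[of p q] that
        by (intro Bochner_Integration.integral_cong) (auto simp: indicator_def)
      also have "\<dots> = (\<integral>x. f x * box_bump p q n x \<partial>lebesgue_on U)"
        by (simp add: integral_restrict_space)
      finally show ?thesis using zero[OF test_function_box_bump[OF that]] by simp
    qed
    ultimately show ?thesis by (simp add: LIMSEQ_const_iff)
  qed
  have local: "AE x in lebesgue. x \<in> box p q \<longrightarrow> f x = 0" if pq: "cbox p q \<subseteq> U" for p q
  proof -
    have "AE x in lebesgue. indicator (box p q) x * f x = 0"
    proof (rule AE_zero_of_box_integrals_zero)
      have "integrable lebesgue (\<lambda>x. indicator (box p q) x *\<^sub>R (indicator (cbox p q) x * f x))"
        by (rule integrable_mult_indicator[OF _ loc[OF pq]]) auto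
      also have "(\<lambda>x. indicator (box p q) x *\<^sub>R (indicator (cbox p q) x * f x)) = (\<lambda>x. indicator (box p q) x * f x)"
        using box_subset_cbox[of p q] by (intro ext) (auto simp: indicator_def)
      finally show "integrable lebesgue (\<lambda>x. indicator (box p q) x * f x)" .
      fix p' q' :: 'a
      let ?a = "\<Sum>i\<in>Basis. max (p' \<bullet> i) (p \<bullet> i) *\<^sub>R i" and ?b = "\<Sum>i\<in>Basis. min (q' \<bullet> i) (q \<bullet> i) *\<^sub>R i"
      \<comment> \<open>The intersection with a closed box in \<open>U\<close> stays in
        \<open>U\<close>, so \<open>box_zero\<close> also serves arbitrary \<open>p'\<close> and
        \<open>q'\<close> once \<open>f\<close> is cut off to \<open>box p q\<close>.\<close>
      have "cbox ?a ?b = cbox p' q' \<inter> cbox p q" by (rule Int_interval[symmetric])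
      then have "cbox ?a ?b \<subseteq> U" using pq by (simp only: le_infI2)
      from box_zero[OF this] have "(\<integral>x. indicator (box p' q' \<inter> box p q) x * f x \<partial>lebesgue) = 0"
        by (simp only: box_Int_box)
      then show "(\<integral>x. indicator (box p' q') x * (indicator (box p q) x * f x) \<partial>lebesgue) = 0"
        by (simp only: indicator_inter_arith mult.assoc)
    qed
    then show ?thesis by eventually_elim (auto simp: indicator_def)
  qed
  define C where "C = {(p, q). cbox p q \<subseteq> U}"
  have "open S" if "S \<in> (\<lambda>(p, q). box p q) ` C" for S :: "'a set"
    using that by (auto simp: open_box)
  then obtain D where D: "D \<subseteq> (\<lambda>(p, q). box p q) ` C" "countable D" "\<Union>D = \<Union>((\<lambda>(p, q). box p q) ` C)"
    by (rule Lindelof)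
  have "U \<subseteq> \<Union>D"
  proof
    fix x assume "x \<in> U"
    then obtain p q where "cbox p q \<subseteq> U" "x \<in> box p q"
      by (rule open_contains_cbox[OF \<open>open U\<close>])
    then have "(p, q) \<in> C" by (simp add: C_def)
    then show "x \<in> \<Union>D" unfolding D(3) using \<open>x \<in> box p q\<close> by force
  qed
  have "AE x in lebesgue. x \<in> B \<longrightarrow> f x = 0" if "B \<in> D" for B
  proof -
    from that D(1) have "B \<in> (\<lambda>(p, q). box p q) ` C" by (rule subsetD[rotated])
    then obtain p q where "cbox p q \<subseteq> U" "B = box p q" unfolding C_def by force
    then show ?thesis using local by simp
  qed
  then have "AE x in lebesgue. \<forall>B\<in>D. x \<in> B \<longrightarrow> f x = 0"
    by (intro AE_ball_countable[OF D(2), THEN iffD2] ballI)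
  then have "AE x in lebesgue. x \<in> U \<longrightarrow> f x = 0"
  proof (rule eventually_mono)
    fix x assume *: "\<forall>B\<in>D. x \<in> B \<longrightarrow> f x = 0"
    show "x \<in> U \<longrightarrow> f x = 0"
    proof
      assume "x \<in> U"
      then obtain B where "B \<in> D" "x \<in> B" using \<open>U \<subseteq> \<Union>D\<close> by (meson UnionE subsetD)
      then show "f x = 0" using * by blast
    qed
  qed
  then show ?thesis using U by (subst AE_restrict_space_iff) simp_all
qed

section \<open>Square-integrable functions on a measure space and on bounded domains\<close>

lemma L2_D: "f \<in> L2 M \<Longrightarrow> f \<in> borel_measurable M" "f \<in> L2 M \<Longrightarrow> integrable M (\<lambda>x. (f x)\<^sup>2)"
  by (auto simp: L2_def)

lemma L2_mult_integrable:
  assumes "f \<in> L2 M" "g \<in> L2 M"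
  shows "integrable M (\<lambda>x. f x * g x)"
proof (rule Bochner_Integration.integrable_bound[where f = "\<lambda>x. (f x)\<^sup>2 + (g x)\<^sup>2"])
  have "\<bar>a * b\<bar> \<le> a\<^sup>2 + b\<^sup>2" for a b :: real
  proof -
    have "0 \<le> (\<bar>a\<bar> - \<bar>b\<bar>)\<^sup>2" by simp
    then have "2 * (\<bar>a\<bar> * \<bar>b\<bar>) \<le> a\<^sup>2 + b\<^sup>2" by (simp add: power2_diff)
    moreover have "0 \<le> \<bar>a\<bar> * \<bar>b\<bar>" by simp
    ultimately show ?thesis unfolding abs_mult by linarith
  qed
  then show "AE x in M. norm (f x * g x) \<le> norm ((f x)\<^sup>2 + (g x)\<^sup>2)"
    by auto
qed (use assms in \<open>auto simp: L2_def\<close>)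

lemma L2_add: assumes "f \<in> L2 M" "g \<in> L2 M" shows "(\<lambda>x. f x + g x) \<in> L2 M"
  using assms L2_mult_integrable[OF assms] by (auto simp: L2_def power2_sum mult.assoc)

lemma L2_cmult: "f \<in> L2 M \<Longrightarrow> (\<lambda>x. r * f x) \<in> L2 M"
  by (auto simp: L2_def power_mult_distrib)

lemma L2_diff: "f \<in> L2 M \<Longrightarrow> g \<in> L2 M \<Longrightarrow> (\<lambda>x. f x - g x) \<in> L2 M"
  using L2_add[of f M "\<lambda>x. (-1) * g x"] L2_cmult[of g M "-1"] by simp

lemma L2_zero: "(\<lambda>_. 0) \<in> L2 M"
  by (auto simp: L2_def)

lemma integral_power2_diff_le:
  assumes "f \<in> L2 M" "g \<in> L2 M"
  shows "(\<integral>x. (f x - g x)\<^sup>2 \<partial>M) \<le> 2 * (\<integral>x. (f x)\<^sup>2 \<partial>M) + 2 * (\<integral>x. (g x)\<^sup>2 \<partial>M)"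
proof -
  have "(a - b)\<^sup>2 \<le> 2 * a\<^sup>2 + 2 * b\<^sup>2" for a b :: real
    using zero_le_power2[of "a + b"] by (simp add: power2_sum power2_diff)
  then have "(\<integral>x. (f x - g x)\<^sup>2 \<partial>M) \<le> (\<integral>x. 2 * (f x)\<^sup>2 + 2 * (g x)\<^sup>2 \<partial>M)"
    using assms L2_diff[OF assms] by (intro integral_mono) (auto simp: L2_def)
  also have "\<dots> = 2 * (\<integral>x. (f x)\<^sup>2 \<partial>M) + 2 * (\<integral>x. (g x)\<^sup>2 \<partial>M)"
    using assms by (simp add: L2_def)
  finally show ?thesis .
qed

lemma L2_continuous_compact_support:
  fixes f :: "'a::euclidean_space \<Rightarrow> real"
  assumes "continuous_on UNIV f" "compact K" "\<And>x. x \<notin> K \<Longrightarrow> f x = 0" "U \<in> sets lebesgue"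
  shows "f \<in> L2 (lebesgue_on U)"
proof -
  have m: "f \<in> borel_measurable lebesgue"
    using borel_measurable_continuous_onI[OF assms(1)] by (simp add: measurable_completion)
  have "integrable lborel (\<lambda>x. indicator K x *\<^sub>R (f x)\<^sup>2)"
    by (intro borel_integrable_compact assms(2) continuous_intros continuous_on_subset[OF assms(1)]) auto
  also have "(\<lambda>x. indicator K x *\<^sub>R (f x)\<^sup>2) = (\<lambda>x. (f x)\<^sup>2)"
    using assms(3) by (intro ext) (auto simp: indicator_def)
  finally have "integrable lebesgue (\<lambda>x. (f x)\<^sup>2)"
    using borel_measurable_continuous_onI[OF assms(1)] by (subst integrable_completion) auto
  then show ?thesis
    using m assms(4) integrable_mult_indicator[of U lebesgue "\<lambda>x. (f x)\<^sup>2"]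
    by (auto simp: L2_def integrable_restrict_space intro!: measurable_restrict_space1)
qed

lemma L2_continuous_bounded_domain:
  fixes f :: "'a::euclidean_space \<Rightarrow> real"
  assumes "continuous_on UNIV f" "bounded U" "U \<in> sets lebesgue"
  shows "f \<in> L2 (lebesgue_on U)"
proof -
  have m: "f \<in> borel_measurable lebesgue"
    using borel_measurable_continuous_onI[OF assms(1)] by (simp add: measurable_completion)
  have "integrable lborel (\<lambda>x. indicator (closure U) x *\<^sub>R (f x)\<^sup>2)"
    using assms(2) by (intro borel_integrable_compact continuous_intros continuous_on_subset[OF assms(1)])
      (auto simp: compact_closure)
  then have "integrable lebesgue (\<lambda>x. indicator (closure U) x *\<^sub>R (f x)\<^sup>2)"
    using borel_measurable_continuous_onI[OF assms(1)]
    by (subst integrable_completion) auto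
  then have "integrable lebesgue (\<lambda>x. indicator U x *\<^sub>R indicator (closure U) x *\<^sub>R (f x)\<^sup>2)"
    by (rule integrable_mult_indicator[OF assms(3)])
  also have "(\<lambda>x. indicator U x *\<^sub>R indicator (closure U) x *\<^sub>R (f x)\<^sup>2) = (\<lambda>x. indicator U x *\<^sub>R (f x)\<^sup>2)"
    using closure_subset[of U] by (intro ext) (auto simp: indicator_def)
  finally show ?thesis
    using m assms(3) by (auto simp: L2_def integrable_restrict_space intro!: measurable_restrict_space1)
qed

lemma test_function_L2:
  fixes \<phi> :: "'a::euclidean_space \<Rightarrow> real"
  assumes "test_function U \<phi>" "open U"
  shows "\<phi> \<in> L2 (lebesgue_on U)"
proof -
  obtain K where "compact K" "\<And>x. x \<notin> K \<Longrightarrow> \<phi> x = 0"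
    using assms(1) by (auto simp: test_function_def)
  then show ?thesis
    using L2_continuous_compact_support[OF test_functionD(2)[OF assms(1)]] \<open>open U\<close> by auto
qed

section \<open>Uniqueness of weak derivatives and evaluation of the H^1 norm\<close>

lemma weak_pderiv_lin:
  assumes "open U" "b \<in> Basis"
    "u \<in> L2 (lebesgue_on U)" "w \<in> L2 (lebesgue_on U)" "weak_pderiv U b u w"
    "u' \<in> L2 (lebesgue_on U)" "w' \<in> L2 (lebesgue_on U)" "weak_pderiv U b u' w'"
  shows "weak_pderiv U b (\<lambda>x. u x - u' x) (\<lambda>x. w x - w' x)"
  unfolding weak_pderiv_def
proof (intro allI impI)
  fix \<phi> assume \<phi>: "test_function U \<phi>"
  note L = test_function_L2[OF test_function_pderiv[OF \<phi> assms(2)] assms(1)]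
    and L' = test_function_L2[OF \<phi> assms(1)]
  show "(\<integral>x. (u x - u' x) * frechet_derivative \<phi> (at x) b \<partial>lebesgue_on U) =
         - (\<integral>x. (w x - w' x) * \<phi> x \<partial>lebesgue_on U)"
    using assms(5,8) \<phi>
      L2_mult_integrable[OF assms(3) L] L2_mult_integrable[OF assms(6) L]
      L2_mult_integrable[OF assms(4) L'] L2_mult_integrable[OF assms(7) L']
    by (simp add: left_diff_distrib weak_pderiv_def)
qed

text \<open>The difference of two candidates is orthogonal to all test functions. Since
  \<open>pd\<close> is a weak derivative selected by choice, its values can be compared with known
  derivatives only through this uniqueness.\<close>

lemma weak_pderiv_unique:
  assumes "open U" "w \<in> L2 (lebesgue_on U)" "weak_pderiv U b u w"
    "w' \<in> L2 (lebesgue_on U)" "weak_pderiv U b u w'"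
  shows "AE x in lebesgue_on U. w x = w' x"
proof -
  have U: "U \<in> sets lebesgue" using assms(1) by auto
  have d: "(\<lambda>x. w x - w' x) \<in> L2 (lebesgue_on U)" using assms by (intro L2_diff)
  have "AE x in lebesgue_on U. w x - w' x = 0"
  proof (rule AE_zero_of_test_integrals_zero[OF assms(1)])
    fix \<phi> assume \<phi>: "test_function U \<phi>"
    note L = test_function_L2[OF \<phi> assms(1)]
    show "(\<integral>x. (w x - w' x) * \<phi> x \<partial>lebesgue_on U) = 0"
      using assms(3,5) \<phi> L2_mult_integrable[OF assms(2) L] L2_mult_integrable[OF assms(4) L]
      by (auto simp: left_diff_distrib weak_pderiv_def)
  next
    fix p q :: 'a assume pq: "cbox p q \<subseteq> U"
    have "integrable (lebesgue_on U) (\<lambda>x. indicator (cbox p q) x * (w x - w' x))"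
    proof (rule L2_mult_integrable[OF _ d])
      have "integrable lebesgue (\<lambda>x. indicator (cbox p q) x :: real)"
        by (intro integrable_real_indicator) (auto simp: emeasure_lborel_cbox_eq)
      then have "integrable lebesgue (\<lambda>x. indicator U x *\<^sub>R (indicator (cbox p q) x)\<^sup>2 :: real)"
        by (intro integrable_mult_indicator U) (simp add: indicator_def power2_eq_square flip: of_bool_conj)
      then show "indicator (cbox p q) \<in> L2 (lebesgue_on U)"
        using U by (auto simp: L2_def integrable_restrict_space
          intro!: measurable_restrict_space1 measurable_completion)
    qed
    then have "integrable lebesgue (\<lambda>x. indicator U x *\<^sub>R (indicator (cbox p q) x * (w x - w' x)))"
      using U by (simp add: integrable_restrict_space)
    also have "(\<lambda>x. indicator U x *\<^sub>R (indicator (cbox p q) x * (w x - w' x)))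
        = (\<lambda>x. indicator (cbox p q) x * (w x - w' x))"
      using pq by (intro ext) (auto simp: indicator_def)
    finally show "integrable lebesgue (\<lambda>x. indicator (cbox p q) x * (w x - w' x))" .
  qed
  then show ?thesis by simp
qed

lemma pd_D:
  assumes "u \<in> H1 U" "b \<in> Basis"
  shows "pd U b u \<in> L2 (lebesgue_on U)" "weak_pderiv U b u (pd U b u)"
  using someI_ex[of "\<lambda>w. w \<in> L2 (lebesgue_on U) \<and> weak_pderiv U b u w"] assms
  by (auto simp: pd_def H1_def)

text \<open>Any family \<open>w\<close> of weak derivatives may replace the selected
  \<open>pd\<close> in the norm; the later computations of \<open>H1_norm\<close> go through
  this.\<close>

lemma H1_norm_power2:
  assumes "open U" "u \<in> L2 (lebesgue_on U)"
    "\<And>b. b \<in> Basis \<Longrightarrow> w b \<in> L2 (lebesgue_on U)" "\<And>b. b \<in> Basis \<Longrightarrow> weak_pderiv U b u (w b)"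
  shows "u \<in> H1 U" "(H1_norm U u)\<^sup>2 = (\<integral>x. (u x)\<^sup>2 \<partial>lebesgue_on U)
      + (\<Sum>b\<in>Basis. \<integral>x. (w b x)\<^sup>2 \<partial>lebesgue_on U)"
proof -
  show u: "u \<in> H1 U" using assms by (auto simp: H1_def)
  have "(\<integral>x. (pd U b u x)\<^sup>2 \<partial>lebesgue_on U) = (\<integral>x. (w b x)\<^sup>2 \<partial>lebesgue_on U)" if "b \<in> Basis" for b
  proof (rule integral_cong_AE)
    show "AE x in lebesgue_on U. (pd U b u x)\<^sup>2 = (w b x)\<^sup>2"
      using weak_pderiv_unique[OF assms(1) pd_D[OF u that] assms(3,4)[OF that]]
      by eventually_elim simp
  qed (use pd_D[OF u that] assms(3)[OF that] in \<open>auto simp: L2_def\<close>)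
  then show "(H1_norm U u)\<^sup>2 = (\<integral>x. (u x)\<^sup>2 \<partial>lebesgue_on U)
      + (\<Sum>b\<in>Basis. \<integral>x. (w b x)\<^sup>2 \<partial>lebesgue_on U)"
    unfolding H1_norm_def
    by (subst real_sqrt_pow2) (auto intro!: add_nonneg_nonneg sum_nonneg)
qed

lemma H1_norm_nonneg: "0 \<le> H1_norm U u"
  unfolding H1_norm_def by (auto intro!: add_nonneg_nonneg sum_nonneg)

text \<open>The selected derivative of a difference need not be the pointwise difference of the
  selected derivatives; \<open>H1_norm_power2\<close> circumvents this. The inequality between
  squares is enough for comparing limits.\<close>

lemma H1_diff:
  assumes "open U" "u \<in> H1 U" "v \<in> H1 U"
  shows "(\<lambda>x. u x - v x) \<in> H1 U"
    and "(H1_norm U (\<lambda>x. u x - v x))\<^sup>2 \<le> 2 * (H1_norm U u)\<^sup>2 + 2 * (H1_norm U v)\<^sup>2"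
proof -
  have L: "u \<in> L2 (lebesgue_on U)" "v \<in> L2 (lebesgue_on U)" using assms by (auto simp: H1_def)
  have W: "(\<lambda>x. pd U b u x - pd U b v x) \<in> L2 (lebesgue_on U)"
    "weak_pderiv U b (\<lambda>x. u x - v x) (\<lambda>x. pd U b u x - pd U b v x)" if "b \<in> Basis" for b
    using pd_D[OF assms(2) that] pd_D[OF assms(3) that] L assms(1) that
    by (auto intro!: L2_diff weak_pderiv_lin)
  note * = H1_norm_power2[where w = "\<lambda>b x. pd U b u x - pd U b v x", OF assms(1) L2_diff[OF L] W]
  show "(\<lambda>x. u x - v x) \<in> H1 U" using *(1) by blast
  have "(H1_norm U (\<lambda>x. u x - v x))\<^sup>2 = (\<integral>x. (u x - v x)\<^sup>2 \<partial>lebesgue_on U)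
      + (\<Sum>b\<in>Basis. \<integral>x. (pd U b u x - pd U b v x)\<^sup>2 \<partial>lebesgue_on U)"
    using *(2) by blast
  also have "\<dots> \<le> (2 * (\<integral>x. (u x)\<^sup>2 \<partial>lebesgue_on U) + 2 * (\<integral>x. (v x)\<^sup>2 \<partial>lebesgue_on U))
      + (\<Sum>b\<in>Basis. 2 * (\<integral>x. (pd U b u x)\<^sup>2 \<partial>lebesgue_on U) + 2 * (\<integral>x. (pd U b v x)\<^sup>2 \<partial>lebesgue_on U))"
    by (intro add_mono sum_mono integral_power2_diff_le L pd_D assms)
  also have "\<dots> = 2 * (H1_norm U u)\<^sup>2 + 2 * (H1_norm U v)\<^sup>2"
    using H1_norm_power2(2)[OF assms(1) L(1) pd_D[OF assms(2)]]
      H1_norm_power2(2)[OF assms(1) L(2) pd_D[OF assms(3)]]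
    by (simp add: sum.distrib sum_distrib_left)
  finally show "(H1_norm U (\<lambda>x. u x - v x))\<^sup>2 \<le> 2 * (H1_norm U u)\<^sup>2 + 2 * (H1_norm U v)\<^sup>2" .
qed

text \<open>By translation invariance of Lebesgue measure every difference quotient in direction
  \<open>b\<close> has integral 0, and dominated convergence moves this to the derivative. Applied
  to the product of a C^1 function and a test function it becomes integration by parts.\<close>

lemma integral_pderiv_compact_support:
  fixes g :: "'a::euclidean_space \<Rightarrow> real"
  assumes der: "\<And>x. (g has_derivative g' x) (at x)" and cont: "continuous_on UNIV (\<lambda>x. g' x b)"
    and K: "compact K" "\<And>x. x \<notin> K \<Longrightarrow> g x = 0"
  shows "(\<integral>x. g' x b \<partial>lborel) = 0"
proof -
  have contg: "continuous_on UNIV g"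
    using der by (intro continuous_at_imp_continuous_on) (auto intro: has_derivative_continuous)
  have mg: "g \<in> borel_measurable borel" by (rule borel_measurable_continuous_onI[OF contg])
  have off: "g' x b = 0" if "x \<notin> K" for x
  proof -
    have "open (- K)" using K(1) compact_imp_closed by blast
    then have "(g has_derivative (\<lambda>_. 0)) (at x)"
      by (rule has_derivative_transform_within_open[OF has_derivative_const]) (use that K(2) in auto)
    then show ?thesis using der[of x] has_derivative_unique by metis
  qed
  have "bounded ((\<lambda>x. g' x b) ` K)"
    by (intro compact_imp_bounded compact_continuous_image K continuous_on_subset[OF cont]) auto
  then obtain B where B: "0 < B" "\<And>x. x \<in> K \<Longrightarrow> \<bar>g' x b\<bar> \<le> B"
    by (auto simp: bounded_pos)
  then have B': "\<bar>g' x b\<bar> \<le> B" for x using off[of x] by (cases "x \<in> K") auto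
  let ?s = "\<lambda>n x. (g ((1 / real (Suc n)) *\<^sub>R b + x) - g x) * real (Suc n)"
  \<comment> \<open>\<open>K'\<close> collects the points from which a step
    \<open>t *\<^sub>R b\<close> with \<open>t\<close> in [0, 1] can reach \<open>K\<close>. Outside
    \<open>K'\<close> both \<open>x\<close> and the shifted point lie outside \<open>K\<close>, so
    all quotients vanish off one compact set.\<close>
  define K' where "K' = {y - z | y z. y \<in> K \<and> z \<in> (\<lambda>t. t *\<^sub>R b) ` {0..1}}"
  have K': "compact K'"
    unfolding K'_def by (intro compact_differences K compact_continuous_image continuous_intros) auto
  have intg: "integrable lborel g"
  proof -
    have "integrable lborel (\<lambda>x. indicator K x *\<^sub>R g x)"
      by (intro borel_integrable_compact K continuous_on_subset[OF contg]) auto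
    also have "(\<lambda>x. indicator K x *\<^sub>R g x) = g" using K(2) by (intro ext) (auto simp: indicator_def)
    finally show ?thesis .
  qed
  have trans: "integrable lborel (\<lambda>x. g (c + x))" "(\<integral>x. g (c + x) \<partial>lborel) = (\<integral>x. g x \<partial>lborel)" for c
  proof -
    have *: "distr lborel borel ((+) c) = lborel" by (rule lborel_distr_plus)
    show "integrable lborel (\<lambda>x. g (c + x))"
      using intg by (subst (asm) *[symmetric]) (auto simp: integrable_distr_eq mg)
    show "(\<integral>x. g (c + x) \<partial>lborel) = (\<integral>x. g x \<partial>lborel)"
      by (subst (2) *[symmetric]) (auto simp: integral_distr mg)
  qed
  have "(\<lambda>n. \<integral>x. ?s n x \<partial>lborel) \<longlonglongrightarrow> (\<integral>x. g' x b \<partial>lborel)"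
  proof (rule integral_dominated_convergence[where w = "\<lambda>x. indicator K' x *\<^sub>R B"])
    show "(\<lambda>x. g' x b) \<in> borel_measurable lborel"
      using borel_measurable_continuous_onI[OF cont] by simp
    show "?s n \<in> borel_measurable lborel" for n
      using mg by measurable
    show "integrable lborel (\<lambda>x. indicator K' x *\<^sub>R B)"
      by (intro borel_integrable_compact K') auto
    show "AE x in lborel. (\<lambda>n. ?s n x) \<longlonglongrightarrow> g' x b"
    proof (rule AE_I2)
      fix x
      have "((\<lambda>t. g (x + t *\<^sub>R b)) has_real_derivative g' x b) (at 0)"
        unfolding has_field_derivative_def
      proof (rule has_derivative_eq_rhs)
        show "((\<lambda>t. g (x + t *\<^sub>R b)) has_derivative (\<lambda>h. g' x (h *\<^sub>R b))) (at 0)"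
          by (rule has_derivative_compose[where f = "\<lambda>t. x + t *\<^sub>R b" and g = g and g' = "g' x"])
            (auto intro!: derivative_eq_intros simp: der)
        show "(\<lambda>h. g' x (h *\<^sub>R b)) = (*) (g' x b)"
          using linear_cmul[OF has_derivative_linear[OF der[of x]]] by auto
      qed
      then have "((\<lambda>h. (g (x + h *\<^sub>R b) - g x) / h) \<longlongrightarrow> g' x b) (at 0)"
        by (simp add: DERIV_def)
      moreover have "filterlim (\<lambda>n. 1 / real (Suc n)) (at 0) sequentially"
        using LIMSEQ_inverse_real_of_nat by (auto simp: filterlim_at inverse_eq_divide simp del: of_nat_Suc)
      ultimately have "(\<lambda>n. (g (x + (1 / real (Suc n)) *\<^sub>R b) - g x) / (1 / real (Suc n))) \<longlonglongrightarrow> g' x b"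
        by (rule filterlim_compose)
      then show "(\<lambda>n. ?s n x) \<longlonglongrightarrow> g' x b" by (simp add: add.commute)
    qed
    show "AE x in lborel. norm (?s n x) \<le> indicator K' x *\<^sub>R B" for n
    proof (rule AE_I2)
      fix x
      let ?e = "1 / real (Suc n)"
      have mvt: "\<exists>z. 0 < z \<and> z < ?e \<and> g (x + ?e *\<^sub>R b) - g (x + 0 *\<^sub>R b) = (?e - 0) * g' (x + z *\<^sub>R b) b"
      proof (rule MVT2)
        fix t
        show "((\<lambda>t. g (x + t *\<^sub>R b)) has_real_derivative g' (x + t *\<^sub>R b) b) (at t)"
          unfolding has_field_derivative_def
        proof (rule has_derivative_eq_rhs)
          show "((\<lambda>t. g (x + t *\<^sub>R b)) has_derivative (\<lambda>h. g' (x + t *\<^sub>R b) (h *\<^sub>R b))) (at t)"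
            by (rule has_derivative_compose[where f = "\<lambda>t. x + t *\<^sub>R b" and g = g and g' = "g' (x + t *\<^sub>R b)"])
              (auto intro!: derivative_eq_intros simp: der)
          show "(\<lambda>h. g' (x + t *\<^sub>R b) (h *\<^sub>R b)) = (*) (g' (x + t *\<^sub>R b) b)"
            using linear_cmul[OF has_derivative_linear[OF der[of "x + t *\<^sub>R b"]]] by auto
        qed
      qed simp
      then obtain z where z: "?s n x = g' (x + z *\<^sub>R b) b"
        by (auto simp: add.commute simp del: of_nat_Suc)
      show "norm (?s n x) \<le> indicator K' x *\<^sub>R B"
      proof (cases "x \<in> K'")
        case True
        then show ?thesis using B' by (simp only: z) simp
      next
        case False
        have "x \<notin> K"
        proof
          assume "x \<in> K"
          then have "x = x - 0 *\<^sub>R b \<and> x \<in> K \<and> 0 *\<^sub>R b \<in> (\<lambda>t. t *\<^sub>R b) ` {0..1}" by auto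
          then show False using False unfolding K'_def by blast
        qed
        moreover have "?e *\<^sub>R b + x \<notin> K"
        proof
          assume "?e *\<^sub>R b + x \<in> K"
          then have "x = (?e *\<^sub>R b + x) - ?e *\<^sub>R b \<and> ?e *\<^sub>R b + x \<in> K \<and> ?e *\<^sub>R b \<in> (\<lambda>t. t *\<^sub>R b) ` {0..1}" by auto
          then show False using False unfolding K'_def by blast
        qed
        ultimately show ?thesis using K(2) False by (simp del: of_nat_Suc)
      qed
    qed
  qed
  moreover have "(\<integral>x. ?s n x \<partial>lborel) = 0" for n
    using trans[of "(1 / real (Suc n)) *\<^sub>R b"] intg by simp
  ultimately show ?thesis by (simp add: LIMSEQ_const_iff)
qed

lemma integrable_continuous_compact_support:
  fixes f :: "'a::euclidean_space \<Rightarrow> real"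
  assumes "continuous_on UNIV f" "compact K" "\<And>x. x \<notin> K \<Longrightarrow> f x = 0"
  shows "integrable lborel f"
proof -
  have "integrable lborel (\<lambda>x. indicator K x *\<^sub>R f x)"
    by (intro borel_integrable_compact assms continuous_on_subset[OF assms(1)]) auto
  also have "(\<lambda>x. indicator K x *\<^sub>R f x) = f" using assms(3) by (intro ext) (auto simp: indicator_def)
  finally show ?thesis .
qed

lemma C1_D:
  assumes "Ck 1 UNIV v"
  shows "(v has_derivative frechet_derivative v (at x)) (at x)" "continuous_on UNIV v"
    and "b \<in> Basis \<Longrightarrow> continuous_on UNIV (\<lambda>x. frechet_derivative v (at x) b)"
  using assms Ck_UNIV_Suc_D[of 0 v] Ck_mono_Suc[of 0 UNIV v] by auto

text \<open>The product of \<open>v\<close> with a test function has compact support, so the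
  integral of its derivative vanishes; the product rule splits it into the two sides.\<close>

lemma C1_weak_pderiv:
  fixes v :: "'a::euclidean_space \<Rightarrow> real"
  assumes "Ck 1 UNIV v" "open U" "b \<in> Basis"
  shows "weak_pderiv U b v (\<lambda>x. frechet_derivative v (at x) b)"
  unfolding weak_pderiv_def
proof (intro allI impI)
  fix \<phi> assume \<phi>: "test_function U \<phi>"
  let ?dv = "\<lambda>x. frechet_derivative v (at x) b" and ?d\<phi> = "\<lambda>x. frechet_derivative \<phi> (at x) b"
  obtain K where K: "compact K" "K \<subseteq> U" "\<And>x. x \<notin> K \<Longrightarrow> \<phi> x = 0"
    using \<phi> by (auto simp: test_function_def)
  obtain L where L: "compact L" "L \<subseteq> U" "\<And>x. x \<notin> L \<Longrightarrow> ?d\<phi> x = 0"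
    using test_function_pderiv[OF \<phi> assms(3)] by (auto simp: test_function_def)
  note cont = C1_D(2)[OF assms(1)] C1_D(3)[OF assms(1,3)] test_functionD(2)[OF \<phi>]
    test_functionD(2)[OF test_function_pderiv[OF \<phi> assms(3)]]
  have int: "integrable lborel (\<lambda>x. v x * ?d\<phi> x)" "integrable lborel (\<lambda>x. ?dv x * \<phi> x)"
    by (rule integrable_continuous_compact_support[OF _ L(1)] integrable_continuous_compact_support[OF _ K(1)],
        use cont K L in \<open>auto intro!: continuous_intros\<close>)+
  have on_U: "(\<integral>x. h x \<partial>lebesgue_on U) = (\<integral>x. h x \<partial>lborel)"
    if "integrable lborel h" "\<And>x. x \<notin> U \<Longrightarrow> h x = 0" for h :: "'a \<Rightarrow> real"
  proof -
    have "(\<integral>x. h x \<partial>lebesgue_on U) = (\<integral>x. indicator U x *\<^sub>R h x \<partial>lebesgue)"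
      using \<open>open U\<close> by (intro integral_restrict_space) auto
    also have "(\<lambda>x. indicator U x *\<^sub>R h x) = h" using that(2) by (intro ext) (auto simp: indicator_def)
    finally show ?thesis using that(1) by (simp add: integral_completion)
  qed
  have "(\<integral>x. v x * ?d\<phi> x + ?dv x * \<phi> x \<partial>lborel) = 0"
    using K(3) cont
    by (intro integral_pderiv_compact_support[OF has_derivative_mult[OF C1_D(1)[OF assms(1)] test_functionD(3)[OF \<phi>]] _ K(1)])
      (auto intro!: continuous_intros)
  then have "(\<integral>x. v x * ?d\<phi> x \<partial>lborel) = - (\<integral>x. ?dv x * \<phi> x \<partial>lborel)"
    using int by simp
  then show "(\<integral>x. v x * ?d\<phi> x \<partial>lebesgue_on U) = - (\<integral>x. ?dv x * \<phi> x \<partial>lebesgue_on U)"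
    using int K L by (subst (1 2) on_U) auto
qed

lemma C1_H1:
  fixes v :: "'a::euclidean_space \<Rightarrow> real"
  assumes "Ck 1 UNIV v" "open U" "bounded U"
  shows "v \<in> H1 U" "(H1_norm U v)\<^sup>2 = (\<integral>x. (v x)\<^sup>2 \<partial>lebesgue_on U)
      + (\<Sum>b\<in>Basis. \<integral>x. (frechet_derivative v (at x) b)\<^sup>2 \<partial>lebesgue_on U)"
  using H1_norm_power2[where w = "\<lambda>b x. frechet_derivative v (at x) b" and u = v and U = U] assms
    L2_continuous_bounded_domain[OF C1_D(2)[OF assms(1)] assms(3)]
    L2_continuous_bounded_domain[OF C1_D(3)[OF assms(1)] assms(3)] C1_weak_pderiv[OF assms(1,2)]
  by auto

lemma H1_norm_zero: "open U \<Longrightarrow> H1_norm U (\<lambda>_. 0) = 0"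
  using H1_norm_power2(2)[of U "\<lambda>_. 0" "\<lambda>_ _. 0"] L2_zero[of "lebesgue_on U"]
  by (simp add: weak_pderiv_def)

lemma space_lebesgue_on: "space (lebesgue_on U) = U"
  by (simp add: space_restrict_space)

lemma L2_cong: "(\<And>x. x \<in> space M \<Longrightarrow> u x = v x) \<Longrightarrow> u \<in> L2 M \<longleftrightarrow> v \<in> L2 M"
  unfolding L2_def
  by (auto cong: measurable_cong Bochner_Integration.integrable_cong)

lemma weak_pderiv_cong:
  assumes "\<And>x. x \<in> U \<Longrightarrow> u x = v x"
  shows "weak_pderiv U b u w \<longleftrightarrow> weak_pderiv U b v w"
  unfolding weak_pderiv_def
  by (intro all_cong arg_cong2[where f = "(=)"] Bochner_Integration.integral_cong)
    (auto simp: space_lebesgue_on assms)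

lemma H1_cong:
  assumes "\<And>x. x \<in> U \<Longrightarrow> u x = v x"
  shows "u \<in> H1 U \<longleftrightarrow> v \<in> H1 U" "H1_norm U u = H1_norm U v"
proof -
  show "u \<in> H1 U \<longleftrightarrow> v \<in> H1 U"
    using L2_cong[of "lebesgue_on U" u v] assms weak_pderiv_cong[of U u v]
    by (auto simp: H1_def space_lebesgue_on)
  have "(\<integral>x. (u x)\<^sup>2 \<partial>lebesgue_on U) = (\<integral>x. (v x)\<^sup>2 \<partial>lebesgue_on U)"
    by (intro Bochner_Integration.integral_cong) (auto simp: space_lebesgue_on assms)
  moreover have "weak_pderiv U b u = weak_pderiv U b v" for b
    using weak_pderiv_cong[of U u v] assms by blast
  ultimately show "H1_norm U u = H1_norm U v"
    unfolding H1_norm_def pd_def by simp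
qed

lemma has_trace_cong:
  assumes "\<And>x. x \<in> U \<Longrightarrow> u x = v x"
  shows "has_trace U M u g \<longleftrightarrow> has_trace U M v g"
proof -
  have "H1_norm U (\<lambda>x. \<phi> x - u x) = H1_norm U (\<lambda>x. \<phi> x - v x)" for \<phi>
    by (rule H1_cong(2)) (simp add: assms)
  then show ?thesis unfolding has_trace_def using H1_cong(1)[of U u v] assms by simp
qed

text \<open>The constant sequence \<open>v\<close> serves as the approximating sequence in the
  definition of the trace.\<close>

lemma C1_has_trace:
  fixes v :: "'a::euclidean_space \<Rightarrow> real"
  assumes "Ck 1 UNIV v" "open U" "bounded U" "g \<in> L2 M" "\<And>x. x \<in> space M \<Longrightarrow> v x = g x"
  shows "has_trace U M v g"
proof -
  have "(\<integral>x. (v x - g x)\<^sup>2 \<partial>M) = (\<integral>x. 0 \<partial>M)"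
    by (intro Bochner_Integration.integral_cong) (auto simp: assms)
  then show ?thesis
    unfolding has_trace_def using assms C1_H1(1)[OF assms(1-3)] H1_norm_zero[OF assms(2)]
    by (auto intro!: exI[of _ "\<lambda>_. v"])
qed

section \<open>Change of variables in the plane\<close>

text \<open>The library states the change of variables theorem for \<open>real ^ n\<close> only.\<close>

definition plane_of_vec :: "real ^ 2 \<Rightarrow> plane" where
  "plane_of_vec v = (v $ 1, v $ 2)"

definition vec_of_plane :: "plane \<Rightarrow> real ^ 2" where
  "vec_of_plane x = vector [fst x, snd x]"

lemma plane_vec_inverse [simp]:
  "plane_of_vec (vec_of_plane x) = x" "vec_of_plane (plane_of_vec v) = v"
  by (auto simp: plane_of_vec_def vec_of_plane_def vec_eq_iff forall_2)

lemma linear_plane_of_vec: "bounded_linear plane_of_vec"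
  unfolding plane_of_vec_def by (intro bounded_linear_Pair bounded_linear_vec_nth)

lemma linear_vec_of_plane: "bounded_linear vec_of_plane"
  by (rule linear_conv_bounded_linear[THEN iffD1], rule linearI)
    (auto simp: vec_of_plane_def vec_eq_iff forall_2)

lemma cbox_real2: "cbox u v = {x :: real ^ 2. u $ 1 \<le> x $ 1 \<and> x $ 1 \<le> v $ 1 \<and> u $ 2 \<le> x $ 2 \<and> x $ 2 \<le> v $ 2}"
  by (auto simp: mem_box_cart forall_2)

lemma image_plane_of_vec_cbox: "plane_of_vec ` cbox u v = cbox (plane_of_vec u) (plane_of_vec v)"
proof -
  have "x \<in> plane_of_vec ` cbox u v \<longleftrightarrow> vec_of_plane x \<in> cbox u v" for x
    by (metis image_iff plane_vec_inverse)
  then show ?thesis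
    by (auto simp: cbox_real2 vec_of_plane_def plane_of_vec_def cbox_Pair_eq)
qed

lemma image_vec_of_plane_cbox: "vec_of_plane ` cbox u v = cbox (vec_of_plane u) (vec_of_plane v)"
proof -
  have "vec_of_plane ` cbox u v = vec_of_plane ` plane_of_vec ` cbox (vec_of_plane u) (vec_of_plane v)"
    by (simp add: image_plane_of_vec_cbox)
  then show ?thesis by (simp add: image_image)
qed

lemma content_plane_of_vec: "measure lborel (plane_of_vec ` cbox u v) = measure lborel (cbox u v)"
proof (cases "u $ 1 \<le> v $ 1 \<and> u $ 2 \<le> v $ 2")
  case True
  then have "cbox u v \<noteq> {}" by (auto simp: cbox_real2 intro!: exI[of _ u])
  then have "measure lborel (cbox u v) = (v $ 1 - u $ 1) * (v $ 2 - u $ 2)"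
    by (simp add: content_cbox_cart UNIV_2 prod.insert)
  then show ?thesis
    using True unfolding image_plane_of_vec_cbox by (simp add: plane_of_vec_def content_Pair)
next
  case False
  then have "cbox u v = {}" by (auto simp: cbox_real2)
  then show ?thesis by simp
qed

text \<open>The transfer of integrals along \<open>plane_of_vec\<close> works on boxes, so
  \<open>f\<close> is first extended by zero to a box around the bounded set
  \<open>S\<close>.\<close>

lemma has_integral_plane_of_vec:
  fixes f :: "plane \<Rightarrow> real"
  assumes "(f has_integral i) S" "bounded S"
  shows "((\<lambda>v. f (plane_of_vec v)) has_integral i) (vec_of_plane ` S)"
proof -
  let ?f = "\<lambda>x. if x \<in> S then f x else 0"
  obtain r where "S \<subseteq> cbox (- r) r"
    by (rule bounded_subset_cbox_symmetric[OF assms(2)])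
  then have ab: "S \<subseteq> cbox (- r) r" .
  have "(?f has_integral i) (cbox (- r) r)"
    by (rule has_integral_restrict[OF ab, THEN iffD2, OF assms(1)])
  then have "((\<lambda>v. ?f (plane_of_vec v)) has_integral (1 / 1) *\<^sub>R i) (vec_of_plane ` cbox (- r) r)"
  proof (rule has_integral_twiddle[rotated 7])
    show "\<exists>w z. plane_of_vec ` cbox u v = cbox w z" for u v
      unfolding image_plane_of_vec_cbox by blast
    show "\<exists>w z. vec_of_plane ` cbox u v = cbox w z" for u v
      unfolding image_vec_of_plane_cbox by blast
    show "measure lborel (plane_of_vec ` cbox u v) = 1 * measure lborel (cbox u v)" for u v
      by (simp only: content_plane_of_vec mult_1)
    show "continuous (at x) plane_of_vec" for x
      by (rule linear_continuous_at[OF linear_plane_of_vec])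
  qed simp_all
  moreover have "plane_of_vec v \<in> S \<longleftrightarrow> v \<in> vec_of_plane ` S" for v
    by (metis image_iff plane_vec_inverse)
  ultimately have "((\<lambda>v. if v \<in> vec_of_plane ` S then f (plane_of_vec v) else 0) has_integral i) (vec_of_plane ` cbox (- r) r)"
    by simp
  then show ?thesis
    by (rule has_integral_restrict[OF image_mono[OF ab], THEN iffD1])
qed

lemma has_integral_vec_of_plane:
  fixes f :: "real ^ 2 \<Rightarrow> real"
  assumes "(f has_integral i) S" "bounded S"
  shows "((\<lambda>v. f (vec_of_plane v)) has_integral i) (plane_of_vec ` S)"
proof -
  let ?f = "\<lambda>x. if x \<in> S then f x else 0"
  obtain r where "S \<subseteq> cbox (- r) r"
    by (rule bounded_subset_cbox_symmetric[OF assms(2)])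
  then have ab: "S \<subseteq> cbox (- r) r" .
  have "(?f has_integral i) (cbox (- r) r)"
    by (rule has_integral_restrict[OF ab, THEN iffD2, OF assms(1)])
  then have "((\<lambda>v. ?f (vec_of_plane v)) has_integral (1 / 1) *\<^sub>R i) (plane_of_vec ` cbox (- r) r)"
  proof (rule has_integral_twiddle[rotated 7])
    show "\<exists>w z. vec_of_plane ` cbox u v = cbox w z" for u v
      unfolding image_vec_of_plane_cbox by blast
    show "\<exists>w z. plane_of_vec ` cbox u v = cbox w z" for u v
      unfolding image_plane_of_vec_cbox by blast
    show "measure lborel (vec_of_plane ` cbox u v) = 1 * measure lborel (cbox u v)" for u v
      using content_plane_of_vec[of "vec_of_plane u" "vec_of_plane v"]
      by (simp only: image_plane_of_vec_cbox image_vec_of_plane_cbox plane_vec_inverse mult_1)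
    show "continuous (at x) vec_of_plane" for x
      by (rule linear_continuous_at[OF linear_vec_of_plane])
  qed simp_all
  moreover have "vec_of_plane v \<in> S \<longleftrightarrow> v \<in> plane_of_vec ` S" for v
    by (metis image_iff plane_vec_inverse)
  ultimately have "((\<lambda>v. if v \<in> plane_of_vec ` S then f (vec_of_plane v) else 0) has_integral i) (plane_of_vec ` cbox (- r) r)"
    by simp
  then show ?thesis
    by (rule has_integral_restrict[OF image_mono[OF ab], THEN iffD1])
qed

definition det_plane :: "(plane \<Rightarrow> plane) \<Rightarrow> real" where
  "det_plane L = fst (L (1, 0)) * snd (L (0, 1)) - fst (L (0, 1)) * snd (L (1, 0))"

lemma det_plane_matrix: "det (matrix (vec_of_plane \<circ> L \<circ> plane_of_vec)) = det_plane L"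
  by (simp add: det_2 matrix_def det_plane_def vec_of_plane_def plane_of_vec_def axis_def)

text \<open>Conjugation with \<open>vec_of_plane\<close> reduces the claim to
  \<open>real ^ 2\<close>, and values are read in \<open>real ^ 1\<close> to fit a theorem on
  vector-valued functions. Non-negativity of \<open>f\<close> turns integrability into absolute
  integrability.\<close>

lemma change_of_variables_plane:
  fixes f :: "plane \<Rightarrow> real"
  assumes S: "S \<in> sets borel" "bounded S" "bounded (g ` S)"
    and der: "\<And>x. x \<in> S \<Longrightarrow> (g has_derivative g' x) (at x within S)"
    and inj: "inj_on g S"
    and f: "\<And>x. 0 \<le> f x" "f integrable_on g ` S"
  shows "((\<lambda>x. \<bar>det_plane (g' x)\<bar> * f (g x)) has_integral integral (g ` S) f) S"
proof -
  define S' where "S' = vec_of_plane ` S"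
  define G where "G = vec_of_plane \<circ> g \<circ> plane_of_vec"
  define G' where "G' v = vec_of_plane \<circ> g' (plane_of_vec v) \<circ> plane_of_vec" for v
  have cont: "continuous_on A plane_of_vec" "continuous_on B vec_of_plane" for A B
    using linear_plane_of_vec linear_vec_of_plane
    by (auto intro: linear_continuous_on)
  have img: "plane_of_vec ` S' = S" by (simp add: S'_def image_image)
  have S'v: "S' = plane_of_vec -` S"
  proof (intro set_eqI)
    show "v \<in> S' \<longleftrightarrow> v \<in> plane_of_vec -` S" for v
      unfolding S'_def vimage_eq by (metis image_iff plane_vec_inverse)
  qed
  have "plane_of_vec \<in> borel_measurable borel"
    by (rule borel_measurable_continuous_onI[OF cont(1)])
  then have "S' \<in> sets borel"
    using S(1) measurable_sets[of plane_of_vec borel borel S] by (simp add: S'v)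
  then have S'm: "S' \<in> sets lebesgue" by simp
  have bS': "bounded S'"
    unfolding S'_def by (rule bounded_linear_image[OF S(2) linear_vec_of_plane])
  have GS: "G ` S' = vec_of_plane ` g ` S"
    by (auto simp: G_def S'_def image_image)
  have derG: "(G has_derivative G' v) (at v within S')" if "v \<in> S'" for v
  proof -
    have "plane_of_vec v \<in> S" using that img by blast
    have 1: "(plane_of_vec has_derivative plane_of_vec) (at v within S')"
      by (rule bounded_linear_imp_has_derivative[OF linear_plane_of_vec])
    have 2: "(g has_derivative g' (plane_of_vec v)) (at (plane_of_vec v) within plane_of_vec ` S')"
      unfolding img by (rule der) fact
    have 3: "(vec_of_plane has_derivative vec_of_plane) (at y)" for y
      by (rule bounded_linear_imp_has_derivative[OF linear_vec_of_plane])
    show ?thesis unfolding G_def G'_def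
      using diff_chain_within[OF diff_chain_within[OF 1 2] has_derivative_at_withinI[OF 3]]
      by (simp add: o_assoc o_def)
  qed
  have injG: "inj_on G S'"
  proof (rule inj_onI)
    fix x y assume "x \<in> S'" "y \<in> S'" "G x = G y"
    then have "g (plane_of_vec x) = g (plane_of_vec y)"
      unfolding G_def o_def by (metis plane_vec_inverse(1))
    then have "plane_of_vec x = plane_of_vec y"
      using \<open>x \<in> S'\<close> \<open>y \<in> S'\<close> img inj by (metis imageI inj_on_eq_iff)
    then show "x = y" by (metis plane_vec_inverse(2))
  qed
  let ?f = "\<lambda>v. f (plane_of_vec v)"
  have fi: "(?f has_integral integral (g ` S) f) (G ` S')"
    unfolding GS using f(2) S(3) by (intro has_integral_plane_of_vec) (auto simp: has_integral_integral)
  let ?F = "\<lambda>v. vec (?f v) :: real ^ 1"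
  have lin_vec: "bounded_linear (vec :: real \<Rightarrow> real ^ 1)"
    by (rule linear_conv_bounded_linear[THEN iffD1], rule linearI) (auto simp: vec_eq_iff)
  have FI: "(?F has_integral vec (integral (g ` S) f)) (G ` S')"
    using has_integral_linear[OF fi lin_vec] by (simp add: o_def)
  have "?F absolutely_integrable_on (G ` S')"
  proof (rule nonnegative_absolutely_integrable)
    show "?F integrable_on G ` S'" using FI by blast
  qed (use f(1) in \<open>auto simp: Basis_vec_def inner_axis\<close>)
  then have *: "(\<lambda>v. \<bar>det (matrix (G' v))\<bar> *\<^sub>R ?F (G v)) absolutely_integrable_on S'
      \<and> integral S' (\<lambda>v. \<bar>det (matrix (G' v))\<bar> *\<^sub>R ?F (G v)) = vec (integral (g ` S) f)"
    by (intro has_absolute_integral_change_of_variables[OF S'm derG injG, THEN iffD2] conjI integral_unique[OF FI])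
  then have "((\<lambda>v. \<bar>det (matrix (G' v))\<bar> *\<^sub>R ?F (G v)) has_integral vec (integral (g ` S) f)) S'"
    by (intro has_integral_iff[THEN iffD2] conjI set_lebesgue_integral_eq_integral(1)) simp_all
  from has_integral_linear[OF this bounded_linear_vec_nth[of 1]]
  have "((\<lambda>v. \<bar>det_plane (g' (plane_of_vec v))\<bar> * f (g (plane_of_vec v))) has_integral integral (g ` S) f) S'"
    by (simp add: o_def G'_def G_def det_plane_matrix[unfolded o_def])
  from has_integral_vec_of_plane[OF this bS'] show ?thesis
    by (simp add: img)
qed

section \<open>Geometry of the machine and the trace inequality\<close>

lemma integrable_continuous_bounded_domain:
  fixes f :: "'a::euclidean_space \<Rightarrow> real"
  assumes "continuous_on UNIV f" "bounded U" "U \<in> sets lebesgue"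
  shows "integrable (lebesgue_on U) f"
  using L2_mult_integrable[OF L2_continuous_bounded_domain[OF assms]
      L2_continuous_bounded_domain[OF continuous_on_const assms(2,3), of 1]] by simp

text \<open>The derivative of \<open>q t * (f t)\<^sup>2\<close> is integrated, where the linear
  weight \<open>q\<close> vanishes at the endpoint \<open>e'\<close> opposite to \<open>e\<close>.
  Only the boundary term at \<open>e\<close> survives, with factor \<open>hi - lo\<close>, and
  Young's inequality bounds the mixed term.\<close>

lemma trace_inequality_interval:
  fixes f f' :: "real \<Rightarrow> real"
  assumes "lo < hi" "e = lo \<or> e = hi"
    and der: "\<And>t. t \<in> {lo..hi} \<Longrightarrow> (f has_real_derivative f' t) (at t within {lo..hi})"
    and cont: "continuous_on {lo..hi} f'"
  shows "(f e)\<^sup>2 \<le> (1 + 1 / (hi - lo)) * integral {lo..hi} (\<lambda>t. (f t)\<^sup>2 + (f' t)\<^sup>2)"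
proof -
  define e' where "e' = lo + hi - e"
  define q where "q t = t - e'" for t
  have contf: "continuous_on {lo..hi} f" by (rule DERIV_continuous_on[OF der])
  have "((\<lambda>t. (f t)\<^sup>2 + q t * (2 * f t * f' t)) has_integral (q hi * (f hi)\<^sup>2 - q lo * (f lo)\<^sup>2)) {lo..hi}"
  proof (rule fundamental_theorem_of_calculus)
    show "((\<lambda>t. q t * (f t)\<^sup>2) has_vector_derivative ((f t)\<^sup>2 + q t * (2 * f t * f' t))) (at t within {lo..hi})"
      if "t \<in> {lo..hi}" for t
      unfolding has_real_derivative_iff_has_vector_derivative[symmetric] q_def
      by (auto intro!: derivative_eq_intros der that)
  qed (use assms in auto)
  moreover have "q hi * (f hi)\<^sup>2 - q lo * (f lo)\<^sup>2 = (hi - lo) * (f e)\<^sup>2"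
    using assms(2) by (auto simp: q_def e'_def algebra_simps)
  ultimately have "(hi - lo) * (f e)\<^sup>2 = integral {lo..hi} (\<lambda>t. (f t)\<^sup>2 + q t * (2 * f t * f' t))"
    by (simp add: integral_unique)
  also have "\<dots> \<le> integral {lo..hi} (\<lambda>t. (1 + (hi - lo)) * ((f t)\<^sup>2 + (f' t)\<^sup>2))"
  proof (rule integral_le)
    show "(\<lambda>t. (f t)\<^sup>2 + q t * (2 * f t * f' t)) integrable_on {lo..hi}"
      unfolding q_def by (intro integrable_continuous_real continuous_intros contf cont)
    show "(\<lambda>t. (1 + (hi - lo)) * ((f t)\<^sup>2 + (f' t)\<^sup>2)) integrable_on {lo..hi}"
      by (intro integrable_continuous_real continuous_intros contf cont)
    fix t assume t: "t \<in> {lo..hi}"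
    have "\<bar>q t\<bar> \<le> hi - lo" using t assms(2) by (auto simp: q_def e'_def)
    moreover have "\<bar>2 * f t * f' t\<bar> \<le> (f t)\<^sup>2 + (f' t)\<^sup>2"
      using zero_le_power2[of "f t + f' t"] zero_le_power2[of "f t - f' t"]
      unfolding power2_sum power2_diff by (auto simp: abs_le_iff)
    ultimately have "\<bar>q t\<bar> * \<bar>2 * f t * f' t\<bar> \<le> (hi - lo) * ((f t)\<^sup>2 + (f' t)\<^sup>2)"
      using assms(1) by (intro mult_mono) auto
    then have "q t * (2 * f t * f' t) \<le> (hi - lo) * ((f t)\<^sup>2 + (f' t)\<^sup>2)"
      unfolding abs_mult[symmetric] by linarith
    then show "(f t)\<^sup>2 + q t * (2 * f t * f' t) \<le> (1 + (hi - lo)) * ((f t)\<^sup>2 + (f' t)\<^sup>2)"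
      unfolding distrib_right[of 1] mult_1 using zero_le_power2[of "f' t"] by linarith
  qed
  also have "\<dots> = (1 + (hi - lo)) * integral {lo..hi} (\<lambda>t. (f t)\<^sup>2 + (f' t)\<^sup>2)"
    by simp
  finally show ?thesis using assms(1) by (simp add: field_simps)
qed

lemma plane_derivative_components:
  fixes L :: "plane \<Rightarrow> real"
  assumes "linear L"
  shows "L (p, q) = p * L (1, 0) + q * L (0, 1)"
proof -
  have "L (p *\<^sub>R (1, 0) + q *\<^sub>R (0, 1)) = p * L (1, 0) + q * L (0, 1)"
    by (simp only: linear_add[OF assms] linear_cmul[OF assms] real_scaleR_def)
  then show ?thesis by simp
qed

lemma Basis_plane: "(1, 0) \<in> (Basis :: plane set)" "(0, 1) \<in> (Basis :: plane set)"
  "(Basis :: plane set) = {(1, 0), (0, 1)}"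
  by (auto simp: Basis_prod_def)

lemma H1_norm_C1_plane:
  fixes \<phi> :: "plane \<Rightarrow> real"
  assumes "Ck 1 UNIV \<phi>" "open \<Omega>" "bounded \<Omega>"
  shows "(H1_norm \<Omega> \<phi>)\<^sup>2 = (\<integral>x. (\<phi> x)\<^sup>2 + ((frechet_derivative \<phi> (at x) (1, 0))\<^sup>2
    + (frechet_derivative \<phi> (at x) (0, 1))\<^sup>2) \<partial>lebesgue_on \<Omega>)"
proof -
  have sets: "\<Omega> \<in> sets lebesgue" using assms by auto
  note c = C1_D(2)[OF assms(1)] C1_D(3)[OF assms(1) Basis_plane(1)] C1_D(3)[OF assms(1) Basis_plane(2)]
  show ?thesis
    unfolding C1_H1(2)[OF assms] Basis_plane(3)
    using integrable_continuous_bounded_domain[OF continuous_on_power[OF c(1)] assms(3) sets]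
      integrable_continuous_bounded_domain[OF continuous_on_power[OF c(2)] assms(3) sets]
      integrable_continuous_bounded_domain[OF continuous_on_power[OF c(3)] assms(3) sets]
    by simp
qed

locale machine =
  fixes F :: "plane \<Rightarrow> plane" and a c b :: real and \<Omega>1 \<Omega>2 \<Gamma> \<Sigma>1 \<Sigma>2 :: "plane set"
  assumes geometry: "machine_geometry F a c b \<Omega>1 \<Omega>2 \<Gamma> \<Sigma>1 \<Sigma>2"
begin

abbreviation "D \<equiv> \<lambda>x. frechet_derivative F (at x)"

definition \<gamma> :: "real \<Rightarrow> plane" where "\<gamma> \<xi> = F (\<xi>, c)"

definition J :: "real \<Rightarrow> real" where "J \<xi> = norm (D (\<xi>, c) (1, 0))"

definition M :: "plane measure" where "M = curve_measure F c"

lemma ac: "a < c" and cb: "c < b" using geometry by (auto simp: machine_geometry_def)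

lemma F_periodic: "\<rho> \<in> {a..b} \<Longrightarrow> F (\<xi> + 2, \<rho>) = F (\<xi>, \<rho>)"
  using geometry by (auto simp: machine_geometry_def)

lemma F_inj: "inj_on F ({-1..<1} \<times> {a..b})"
  using geometry by (auto simp: machine_geometry_def)

lemma F_derivs:
  assumes "x \<in> UNIV \<times> {a..b}"
  shows "(F has_derivative D x) (at x)"
    and "e \<in> Basis \<Longrightarrow> ((\<lambda>x. D x e) has_derivative frechet_derivative (\<lambda>x. D x e) (at x)) (at x)"
    and "linear (D x)"
proof -
  obtain U where U: "UNIV \<times> {a..b} \<subseteq> U" "smooth_on U F"
    using geometry by (auto simp: machine_geometry_def)
  then have C: "Ck (Suc (Suc 0)) U F" "x \<in> U" using assms by (auto simp: smooth_on_def simp del: Ck.simps)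
  then have "F differentiable (at x)" by simp
  then show 1: "(F has_derivative D x) (at x)" by (simp add: frechet_derivative_works)
  show "((\<lambda>x. D x e) has_derivative frechet_derivative (\<lambda>x. D x e) (at x)) (at x)" if "e \<in> Basis"
    using C that by (auto simp: frechet_derivative_works[symmetric])
  show "linear (D x)" using 1 has_derivative_linear by blast
qed

lemma D2_cont:
  assumes "e \<in> Basis" "e' \<in> Basis"
  shows "continuous_on (UNIV \<times> {a..b}) (\<lambda>x. frechet_derivative (\<lambda>x. D x e) (at x) e')"
proof -
  obtain U where U: "UNIV \<times> {a..b} \<subseteq> U" "smooth_on U F"
    using geometry by (auto simp: machine_geometry_def)
  then have "Ck (Suc (Suc 0)) U F" by (auto simp: smooth_on_def simp del: Ck.simps)
  then have "continuous_on U (\<lambda>x. frechet_derivative (\<lambda>x. D x e) (at x) e')" using assms by simp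
  then show ?thesis using U(1) continuous_on_subset by blast
qed

lemma F_cont: "continuous_on (UNIV \<times> {a..b}) F"
  by (intro continuous_at_imp_continuous_on ballI has_derivative_continuous[OF F_derivs(1)])

lemma D_cont: "e \<in> Basis \<Longrightarrow> continuous_on (UNIV \<times> {a..b}) (\<lambda>x. D x e)"
  by (intro continuous_at_imp_continuous_on ballI has_derivative_continuous[OF F_derivs(2)])

lemma det_cont: "continuous_on (UNIV \<times> {a..b}) (\<lambda>x. det_plane (D x))"
  unfolding det_plane_def by (intro continuous_intros D_cont Basis_plane)

lemma det_nonzero:
  assumes "x \<in> UNIV \<times> {a..b}"
  shows "det_plane (D x) \<noteq> 0"
proof
  assume 0: "det_plane (D x) = 0"
  have "inj (D x)" using geometry assms by (auto simp: machine_geometry_def bij_def)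
  then have inj: "v = 0" if "D x v = 0" for v
    using that linear_injective_0[OF F_derivs(3)[OF assms]] by blast
  have D: "D x (p, q) = p *\<^sub>R D x (1, 0) + q *\<^sub>R D x (0, 1)" for p q
  proof -
    have "D x (p *\<^sub>R (1, 0) + q *\<^sub>R (0, 1)) = p *\<^sub>R D x (1, 0) + q *\<^sub>R D x (0, 1)"
      by (simp only: linear_add[OF F_derivs(3)[OF assms]] linear_cmul[OF F_derivs(3)[OF assms]])
    then show ?thesis by simp
  qed
  \<comment> \<open>When the determinant vanishes, these two vectors, formed from the rows of the
    Jacobian matrix, lie in the kernel of \<open>D x\<close>; injectivity then makes all four
    entries zero.\<close>
  have "D x (fst (D x (0, 1)), - fst (D x (1, 0))) = 0" "D x (snd (D x (0, 1)), - snd (D x (1, 0))) = 0"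
    using 0 by (subst D; simp add: prod_eq_iff det_plane_def mult.commute)+
  from inj[OF this(1)] inj[OF this(2)] have "D x (1, 0) = 0"
    by (simp add: prod_eq_iff)
  from inj[OF this] show False by (simp add: zero_prod_def)
qed

lemma D_bounds:
  obtains C d :: real where "0 < C" "0 < d"
    "\<And>x. x \<in> {-1..1} \<times> {a..b} \<Longrightarrow> \<bar>det_plane (D x)\<bar> \<le> C"
    "\<And>x. x \<in> {-1..1} \<times> {a..b} \<Longrightarrow> d \<le> \<bar>det_plane (D x)\<bar>"
    "\<And>x. x \<in> {-1..1} \<times> {a..b} \<Longrightarrow> norm (D x (1, 0)) \<le> C"
    "\<And>x. x \<in> {-1..1} \<times> {a..b} \<Longrightarrow> norm (D x (0, 1)) \<le> C"
proof -
  let ?R = "{-1..1} \<times> {a..b} :: plane set"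
  have cpt: "compact ?R" by (intro compact_Times) auto
  have sub: "?R \<subseteq> UNIV \<times> {a..b}" by auto
  have ne: "?R \<noteq> {}" using ac cb by auto
  note cs = continuous_on_subset[OF det_cont sub] continuous_on_subset[OF D_cont[OF Basis_plane(1)] sub]
    continuous_on_subset[OF D_cont[OF Basis_plane(2)] sub]
  have "\<exists>C. \<forall>x\<in>?R. f x \<le> C" if "continuous_on ?R f" for f :: "plane \<Rightarrow> real"
    using continuous_attains_sup[OF cpt ne that] by blast
  from this[OF continuous_on_rabs[OF cs(1)]] this[OF continuous_on_norm[OF cs(2)]] this[OF continuous_on_norm[OF cs(3)]]
  obtain C1 C2 C3 where "\<forall>x\<in>?R. \<bar>det_plane (D x)\<bar> \<le> C1" "\<forall>x\<in>?R. norm (D x (1, 0)) \<le> C2"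
    "\<forall>x\<in>?R. norm (D x (0, 1)) \<le> C3"
    by (elim exE)
  note C = this[THEN bspec]
  obtain x0 where x0: "x0 \<in> ?R" "\<And>x. x \<in> ?R \<Longrightarrow> \<bar>det_plane (D x0)\<bar> \<le> \<bar>det_plane (D x)\<bar>"
    using continuous_attains_inf[OF cpt ne continuous_on_rabs[OF cs(1)]] by blast
  show ?thesis
  proof (rule that[of "max 1 (max C1 (max C2 C3))" "\<bar>det_plane (D x0)\<bar>"])
    show "0 < \<bar>det_plane (D x0)\<bar>" using det_nonzero x0(1) by auto
  qed (use C x0 in \<open>auto simp: le_max_iff_disj\<close>)
qed

text \<open>\<open>F\<close> is injective on the half-open period, as the change of variables
  requires, while Fubini and continuity arguments prefer the closed box; the two differ by a null
  set.\<close>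

lemma integral_F_region:
  assumes "a \<le> lo" "lo < hi" "hi \<le> b" and \<Omega>: "\<Omega> = F ` ({-1..<1} \<times> {lo<..<hi})" "open \<Omega>" "bounded \<Omega>"
    and \<psi>: "continuous_on UNIV \<psi>" "\<And>x. 0 \<le> \<psi> x"
  shows "(\<integral>x. \<psi> x \<partial>lebesgue_on \<Omega>) = integral (cbox (-1, lo) (1, hi)) (\<lambda>x. \<bar>det_plane (D x)\<bar> * \<psi> (F x))"
proof -
  let ?S = "{-1..<1} \<times> {lo<..<hi} :: plane set"
  have sub: "?S \<subseteq> UNIV \<times> {a..b}" "?S \<subseteq> {-1..<1} \<times> {a..b}" using assms by auto
  have sets: "\<Omega> \<in> sets lebesgue" using assms(5) by auto
  have int: "integrable (lebesgue_on \<Omega>) \<psi>"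
    by (rule integrable_continuous_bounded_domain[OF \<psi>(1) assms(6) sets])
  have S: "?S \<in> sets borel" by (intro borel_Times) auto
  have "bounded ?S" by (intro bounded_Times) auto
  have "((\<lambda>x. \<bar>det_plane (D x)\<bar> * \<psi> (F x)) has_integral integral (F ` ?S) \<psi>) ?S"
  proof (rule change_of_variables_plane[OF S \<open>bounded ?S\<close>])
    show "bounded (F ` ?S)" using assms by simp
    show "inj_on F ?S" using F_inj sub(2) inj_on_subset by blast
    show "\<psi> integrable_on F ` ?S"
      using integrable_on_lebesgue_on[OF int sets] by (simp add: \<Omega>)
  qed (use sub \<psi> in \<open>auto intro!: has_derivative_at_withinI F_derivs\<close>)
  then have "integral ?S (\<lambda>x. \<bar>det_plane (D x)\<bar> * \<psi> (F x)) = integral \<Omega> \<psi>"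
    by (simp add: integral_unique \<Omega>)
  also have "\<dots> = (\<integral>x. \<psi> x \<partial>lebesgue_on \<Omega>)"
    by (rule lebesgue_integral_eq_integral[OF int sets, symmetric])
  also have "integral ?S (\<lambda>x. \<bar>det_plane (D x)\<bar> * \<psi> (F x))
      = integral (cbox (-1, lo) (1, hi)) (\<lambda>x. \<bar>det_plane (D x)\<bar> * \<psi> (F x))"
  proof (rule integral_subset_negligible)
    show "?S \<subseteq> cbox (-1, lo) (1, hi)" by (auto simp: cbox_Pair_eq)
    have "cbox (-1, lo) (1, hi) - ?S \<subseteq> cbox (-1, lo) (1, hi) - box (-1, lo) (1, hi)"
      by (auto simp: box_prod)
    then show "negligible (cbox (-1, lo) (1, hi) - ?S)"
      using negligible_frontier_interval negligible_subset by blast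
  qed
  finally show ?thesis ..
qed

text \<open>The constants bound the Jacobian determinant from above and below on the whole closed
  rectangle. They are obtained before the region, so one pair serves both subdomains.\<close>

lemma integral_F_region_bounds:
  obtains C d :: real where "0 < C" "0 < d"
    "\<And>lo hi \<Omega> \<psi>. \<lbrakk>a \<le> lo; lo < hi; hi \<le> b; \<Omega> = F ` ({-1..<1} \<times> {lo<..<hi}); open \<Omega>; bounded \<Omega>;
      continuous_on UNIV \<psi>; \<And>x. 0 \<le> \<psi> x\<rbrakk> \<Longrightarrow>
      (\<integral>x. \<psi> x \<partial>lebesgue_on \<Omega>) \<le> C * integral (cbox (-1, lo) (1, hi)) (\<lambda>x. \<psi> (F x)) \<and>
      d * integral (cbox (-1, lo) (1, hi)) (\<lambda>x. \<psi> (F x)) \<le> (\<integral>x. \<psi> x \<partial>lebesgue_on \<Omega>)"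
proof -
  obtain C d where Cd: "0 < C" "0 < d"
    "\<And>x. x \<in> {-1..1} \<times> {a..b} \<Longrightarrow> \<bar>det_plane (D x)\<bar> \<le> C"
    "\<And>x. x \<in> {-1..1} \<times> {a..b} \<Longrightarrow> d \<le> \<bar>det_plane (D x)\<bar>"
    by (rule D_bounds) blast
  show ?thesis
  proof (rule that[OF Cd(1,2)])
    fix lo hi \<Omega> and \<psi> :: "plane \<Rightarrow> real"
    assume A: "a \<le> lo" "lo < hi" "hi \<le> b" "\<Omega> = F ` ({-1..<1} \<times> {lo<..<hi})" "open \<Omega>" "bounded \<Omega>"
      and \<psi>: "continuous_on UNIV \<psi>" "\<And>x. 0 \<le> \<psi> x"
    let ?R = "cbox (-1, lo) (1, hi) :: plane set"
    have R: "?R \<subseteq> UNIV \<times> {a..b}" "?R \<subseteq> {-1..1} \<times> {a..b}" using A by (auto simp: cbox_Pair_eq)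
    have c\<psi>: "continuous_on ?R (\<lambda>x. \<psi> (F x))"
      using continuous_on_compose[OF continuous_on_subset[OF F_cont R(1)] continuous_on_subset[OF \<psi>(1)]]
      by (simp add: o_def)
    have i: "(\<lambda>x. r * \<psi> (F x)) integrable_on ?R" for r
      by (intro integrable_continuous continuous_intros c\<psi>)
    have i2: "(\<lambda>x. \<bar>det_plane (D x)\<bar> * \<psi> (F x)) integrable_on ?R"
      by (intro integrable_continuous continuous_intros c\<psi> continuous_on_subset[OF det_cont R(1)])
    have "integral ?R (\<lambda>x. \<bar>det_plane (D x)\<bar> * \<psi> (F x)) \<le> integral ?R (\<lambda>x. C * \<psi> (F x))"
      using Cd(3) R(2) \<psi>(2) by (intro integral_le i i2 mult_right_mono) auto
    moreover have "integral ?R (\<lambda>x. d * \<psi> (F x)) \<le> integral ?R (\<lambda>x. \<bar>det_plane (D x)\<bar> * \<psi> (F x))"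
      using Cd(4) R(2) \<psi>(2) by (intro integral_le i i2 mult_right_mono) auto
    ultimately show "(\<integral>x. \<psi> x \<partial>lebesgue_on \<Omega>) \<le> C * integral ?R (\<lambda>x. \<psi> (F x)) \<and>
      d * integral ?R (\<lambda>x. \<psi> (F x)) \<le> (\<integral>x. \<psi> x \<partial>lebesgue_on \<Omega>)"
      unfolding integral_F_region[OF A \<psi>] by simp
  qed
qed

section \<open>The interface as a parametrised curve and integration against arc length\<close>

lemma \<gamma>_derivative: "(\<gamma> has_vector_derivative D (\<xi>, c) (1, 0)) (at \<xi>)"
  unfolding has_vector_derivative_def
proof (rule has_derivative_eq_rhs)
  have x: "(\<xi>, c) \<in> UNIV \<times> {a..b}" using ac cb by auto
  have "((\<lambda>\<xi>. F (\<xi>, c)) has_derivative (\<lambda>h. D (\<xi>, c) (h, 0))) (at \<xi>)"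
    by (rule has_derivative_compose[where f = "\<lambda>\<xi>. (\<xi>, c)" and g = F, OF _ F_derivs(1)[OF x]])
      (auto intro!: derivative_eq_intros)
  then show "(\<gamma> has_derivative (\<lambda>h. D (\<xi>, c) (h, 0))) (at \<xi>)"
    by (simp add: \<gamma>_def[abs_def])
  have "D (\<xi>, c) (h, 0) = h *\<^sub>R D (\<xi>, c) (1, 0)" for h
    using linear_cmul[OF F_derivs(3)[OF x], of h "(1, 0)"] by simp
  then show "(\<lambda>h. D (\<xi>, c) (h, 0)) = (\<lambda>h. h *\<^sub>R D (\<xi>, c) (1, 0))"
    by (intro ext)
qed

lemma J_eq: "J \<xi> = norm (vector_derivative \<gamma> (at \<xi>))"
  unfolding J_def by (simp add: vector_derivative_at[OF \<gamma>_derivative])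

lemma \<gamma>_cont: "continuous_on S \<gamma>"
  by (intro continuous_at_imp_continuous_on ballI has_vector_derivative_continuous[OF \<gamma>_derivative])

lemma \<gamma>_periodic: "\<gamma> (\<xi> + 2) = \<gamma> \<xi>"
  unfolding \<gamma>_def using F_periodic ac cb by auto

lemma \<gamma>_inj: "inj_on \<gamma> {-1..<1}"
proof (rule inj_onI)
  fix x y assume "x \<in> {-1..<1}" "y \<in> {-1..<1}" "\<gamma> x = \<gamma> y"
  then show "x = y" using inj_onD[OF F_inj, of "(x, c)" "(y, c)"] ac cb by (simp add: \<gamma>_def)
qed

lemma J_cont: "continuous_on S J"
proof -
  have "continuous_on UNIV ((\<lambda>x. norm (D x (1, 0))) \<circ> (\<lambda>\<xi>. (\<xi>, c)))"
    using ac cb by (intro continuous_on_compose continuous_intros continuous_on_subset[OF D_cont] Basis_plane) auto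
  then have "continuous_on UNIV J" by (simp add: J_def[abs_def] o_def)
  then show ?thesis by (rule continuous_on_subset) simp
qed

lemma J_pos: "0 < J \<xi>"
proof -
  have x: "(\<xi>, c) \<in> UNIV \<times> {a..b}" using ac cb by auto
  have "D (\<xi>, c) (1, 0) \<noteq> 0" using det_nonzero[OF x] by (auto simp: det_plane_def)
  then show ?thesis by (simp add: J_def)
qed

lemma \<Gamma>_eq: "\<Gamma> = \<gamma> ` {-1..<1}"
  using geometry by (auto simp: machine_geometry_def \<gamma>_def)

lemma M_eq: "M = distr (density (lebesgue_on {-1..<1}) (\<lambda>t. ennreal (J t))) (restrict_space borel \<Gamma>) \<gamma>"
  unfolding M_def curve_measure_def arc_measure_def \<Gamma>_eq J_eq by (simp add: \<gamma>_def[abs_def])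

lemma space_M: "space M = \<Gamma>"
  by (simp add: M_eq space_restrict_space)

lemma sets_M: "sets M = sets (restrict_space borel \<Gamma>)"
  by (simp add: M_eq)

lemma J_measurable: "J \<in> borel_measurable (lebesgue_on {-1..<1})"
  using borel_measurable_continuous_onI[OF J_cont]
  by (intro measurable_restrict_space1 measurable_completion) simp

lemma \<gamma>_measurable: "\<gamma> \<in> lebesgue_on {-1..<1} \<rightarrow>\<^sub>M restrict_space borel \<Gamma>"
proof (rule measurable_restrict_space2)
  show "\<gamma> \<in> lebesgue_on {-1..<1} \<rightarrow>\<^sub>M borel"
    using borel_measurable_continuous_onI[OF \<gamma>_cont]
    by (intro measurable_restrict_space1 measurable_completion) simp
qed (auto simp: \<Gamma>_eq space_restrict_space)

lemma borel_measurable_M_iff: "g \<in> borel_measurable M \<longleftrightarrow> g \<in> borel_measurable (restrict_space borel \<Gamma>)"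
  by (rule measurable_cong_sets[OF sets_M refl, THEN arg_cong2[where f = "(\<in>)", OF refl]])

lemma M_integral:
  fixes g :: "plane \<Rightarrow> real"
  assumes "g \<in> borel_measurable M"
  shows "integrable M g \<longleftrightarrow> integrable (lebesgue_on {-1..<1}) (\<lambda>t. J t * g (\<gamma> t))"
    and "(\<integral>x. g x \<partial>M) = (\<integral>t. J t * g (\<gamma> t) \<partial>lebesgue_on {-1..<1})"
proof -
  have m: "\<gamma> \<in> density (lebesgue_on {-1..<1}) (\<lambda>t. ennreal (J t)) \<rightarrow>\<^sub>M restrict_space borel \<Gamma>"
    using \<gamma>_measurable by (simp add: measurable_cong_sets[OF sets_density refl])
  have g: "g \<in> borel_measurable (restrict_space borel \<Gamma>)" using assms by (simp add: borel_measurable_M_iff)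
  have g\<gamma>: "(\<lambda>t. g (\<gamma> t)) \<in> borel_measurable (lebesgue_on {-1..<1})"
    using measurable_compose[OF \<gamma>_measurable g] .
  show "integrable M g \<longleftrightarrow> integrable (lebesgue_on {-1..<1}) (\<lambda>t. J t * g (\<gamma> t))"
    unfolding M_eq integrable_distr_eq[OF m g] using J_measurable g\<gamma> J_pos
    by (subst integrable_density) (auto intro!: AE_I2 less_imp_le)
  show "(\<integral>x. g x \<partial>M) = (\<integral>t. J t * g (\<gamma> t) \<partial>lebesgue_on {-1..<1})"
    unfolding M_eq integral_distr[OF m g] using J_measurable g\<gamma> J_pos
    by (subst integral_density) (auto intro!: AE_I2 less_imp_le)
qed

lemma M_nn_integral:
  assumes "g \<in> borel_measurable M"
  shows "(\<integral>\<^sup>+x. g x \<partial>M) = (\<integral>\<^sup>+t. ennreal (J t) * g (\<gamma> t) \<partial>lebesgue_on {-1..<1})"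
proof -
  have m: "\<gamma> \<in> density (lebesgue_on {-1..<1}) (\<lambda>t. ennreal (J t)) \<rightarrow>\<^sub>M restrict_space borel \<Gamma>"
    using \<gamma>_measurable by (simp add: measurable_cong_sets[OF sets_density refl])
  have g: "g \<in> borel_measurable (restrict_space borel \<Gamma>)" using assms by (simp add: borel_measurable_M_iff)
  have g\<gamma>: "(\<lambda>t. g (\<gamma> t)) \<in> borel_measurable (lebesgue_on {-1..<1})"
    using measurable_compose[OF \<gamma>_measurable g] .
  have g': "g \<in> borel_measurable (distr (density (lebesgue_on {-1..<1}) (\<lambda>t. ennreal (J t))) (restrict_space borel \<Gamma>) \<gamma>)"
    using assms by (simp add: M_eq)
  show ?thesis
    unfolding M_eq nn_integral_distr[OF m g'] using J_measurable g\<gamma>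
    by (subst nn_integral_density) auto
qed

lemma lebesgue_on_period_eq_integral:
  assumes "continuous_on {-1..1} f"
  shows "integrable (lebesgue_on {-1..<1}) f" "(\<integral>t. f t \<partial>lebesgue_on {-1..<1}) = integral {-1..1} (f :: real \<Rightarrow> real)"
proof -
  have "f absolutely_integrable_on {-1..1}"
    using assms by (rule absolutely_integrable_continuous_real)
  then have "f absolutely_integrable_on {-1..<1}"
    by (rule set_integrable_subset) auto
  then show *: "integrable (lebesgue_on {-1..<1}) f"
    by (subst integrable_restrict_space) (auto simp: set_integrable_def)
  have "(\<integral>t. f t \<partial>lebesgue_on {-1..<1}) = integral {-1..<1} f"
    by (rule lebesgue_integral_eq_integral[OF *]) auto
  also have "\<dots> = integral {-1..1} f"
  proof (rule integral_subset_negligible)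
    have "{-1..1} - {-1..<1} = {1::real}" by auto
    then show "negligible ({-1..1} - {-1..<1::real})" by simp
  qed auto
  finally show "(\<integral>t. f t \<partial>lebesgue_on {-1..<1}) = integral {-1..1} f" .
qed

text \<open>At fixed angle \<open>trace_inequality_interval\<close> is applied along the radial
  segment that starts on the interface; integration over the angle and the change of variables give
  the area integral. One constant serves both subdomains.\<close>

lemma trace_inequality:
  obtains C where "0 < C"
    "\<And>lo hi \<Omega> \<phi>. \<lbrakk>(lo, hi) = (c, b) \<or> (lo, hi) = (a, c); \<Omega> = F ` ({-1..<1} \<times> {lo<..<hi}); open \<Omega>; bounded \<Omega>;
      Ck 1 UNIV \<phi>\<rbrakk> \<Longrightarrow> (\<integral>x. (\<phi> x)\<^sup>2 \<partial>M) \<le> C * (H1_norm \<Omega> \<phi>)\<^sup>2"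
proof -
  obtain B where B: "0 < B" "\<And>x. x \<in> {-1..1} \<times> {a..b} \<Longrightarrow> norm (D x (1, 0)) \<le> B"
    "\<And>x. x \<in> {-1..1} \<times> {a..b} \<Longrightarrow> norm (D x (0, 1)) \<le> B"
    by (rule D_bounds) blast
  obtain C0 d :: real where d: "0 < d"
    "\<And>lo hi \<Omega> \<psi>. \<lbrakk>a \<le> lo; lo < hi; hi \<le> b; \<Omega> = F ` ({-1..<1} \<times> {lo<..<hi}); open \<Omega>; bounded \<Omega>;
      continuous_on UNIV \<psi>; \<And>x. 0 \<le> \<psi> x\<rbrakk> \<Longrightarrow>
      (\<integral>x. \<psi> x \<partial>lebesgue_on \<Omega>) \<le> C0 * integral (cbox (-1, lo) (1, hi)) (\<lambda>x. \<psi> (F x)) \<and>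
      d * integral (cbox (-1, lo) (1, hi)) (\<lambda>x. \<psi> (F x)) \<le> (\<integral>x. \<psi> x \<partial>lebesgue_on \<Omega>)"
    by (rule integral_F_region_bounds) blast
  \<comment> \<open>\<open>K\<close> dominates \<open>1 + 1 / (hi - lo)\<close> for both subdomains.
    In \<open>C\<close> the factor \<open>B\<close> bounds the speed of the interface,
    \<open>1 + 2 * B\<^sup>2\<close> pays for the chain rule in the radial direction and
    \<open>1 / d\<close> for the Jacobian determinant.\<close>
  define K where "K = 2 + 1 / (b - c) + 1 / (c - a)"
  define C where "C = B * (K * (1 + 2 * B\<^sup>2)) / d"
  have K: "0 < K" using ac cb by (auto simp: K_def intro!: add_pos_pos)
  show ?thesis
  proof (rule that[of C])
    show "0 < C" using B(1) d(1) K by (auto simp: C_def intro!: divide_pos_pos mult_pos_pos add_pos_nonneg)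
    fix lo hi \<Omega> and \<phi> :: "plane \<Rightarrow> real"
    assume lohi: "(lo, hi) = (c, b) \<or> (lo, hi) = (a, c)" and \<Omega>: "\<Omega> = F ` ({-1..<1} \<times> {lo<..<hi})" "open \<Omega>" "bounded \<Omega>"
      and \<phi>: "Ck 1 UNIV \<phi>"
    have lh: "a \<le> lo" "lo < hi" "hi \<le> b" "c = lo \<or> c = hi" using lohi ac cb by auto
    define \<psi> where "\<psi> x = (\<phi> x)\<^sup>2 + ((frechet_derivative \<phi> (at x) (1, 0))\<^sup>2 + (frechet_derivative \<phi> (at x) (0, 1))\<^sup>2)" for x
    note \<phi>c = C1_D(2)[OF \<phi>] C1_D(3)[OF \<phi> Basis_plane(1)] C1_D(3)[OF \<phi> Basis_plane(2)]
    have \<psi>: "continuous_on UNIV \<psi>" "\<And>x. 0 \<le> \<psi> x"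
      unfolding \<psi>_def by (intro continuous_intros \<phi>c) auto
    have H: "(\<integral>x. \<psi> x \<partial>lebesgue_on \<Omega>) = (H1_norm \<Omega> \<phi>)\<^sup>2"
      unfolding \<psi>_def by (rule H1_norm_C1_plane[OF \<phi> \<Omega>(2,3), symmetric])
    let ?R = "cbox (-1, lo) (1, hi) :: plane set"
    have R: "?R \<subseteq> UNIV \<times> {a..b}" using lh by (auto simp: cbox_Pair_eq)
    have c\<psi>: "continuous_on ?R (\<lambda>x. \<psi> (F x))"
      using continuous_on_compose[OF continuous_on_subset[OF F_cont R] continuous_on_subset[OF \<psi>(1)]]
      by (simp add: o_def)
    have line: "(\<phi> (\<gamma> \<xi>))\<^sup>2 \<le> K * (1 + 2 * B\<^sup>2) * integral {lo..hi} (\<lambda>\<rho>. \<psi> (F (\<xi>, \<rho>)))" if \<xi>: "\<xi> \<in> {-1..1}" for \<xi>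
    proof -
      define f where "f \<rho> = \<phi> (F (\<xi>, \<rho>))" for \<rho>
      define f' where "f' \<rho> = frechet_derivative \<phi> (at (F (\<xi>, \<rho>))) (D (\<xi>, \<rho>) (0, 1))" for \<rho>
      have in_dom: "(\<xi>, \<rho>) \<in> UNIV \<times> {a..b}" "(\<xi>, \<rho>) \<in> {-1..1} \<times> {a..b}" if "\<rho> \<in> {lo..hi}" for \<rho>
        using that lh \<xi> by auto
      have der: "(f has_real_derivative f' \<rho>) (at \<rho> within {lo..hi})" if "\<rho> \<in> {lo..hi}" for \<rho>
      proof -
        have "((\<lambda>\<rho>. F (\<xi>, \<rho>)) has_derivative (\<lambda>h. D (\<xi>, \<rho>) (0, h))) (at \<rho> within {lo..hi})"
          by (rule has_derivative_compose[where f = "\<lambda>\<rho>. (\<xi>, \<rho>)" and g = F, OF _ F_derivs(1)[OF in_dom(1)[OF that]]])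
            (auto intro!: derivative_eq_intros)
        from has_derivative_compose[OF this C1_D(1)[OF \<phi>]]
        have "(f has_derivative (\<lambda>h. frechet_derivative \<phi> (at (F (\<xi>, \<rho>))) (D (\<xi>, \<rho>) (0, h)))) (at \<rho> within {lo..hi})"
          by (simp add: f_def[abs_def])
        moreover have "frechet_derivative \<phi> (at (F (\<xi>, \<rho>))) (D (\<xi>, \<rho>) (h *\<^sub>R (0, 1))) = h *\<^sub>R f' \<rho>" for h
          unfolding f'_def linear_cmul[OF F_derivs(3)[OF in_dom(1)[OF that]]]
          by (rule linear_cmul[OF has_derivative_linear[OF C1_D(1)[OF \<phi>]]])
        ultimately show ?thesis by (simp add: has_field_derivative_def mult.commute[of _ "f' \<rho>"])
      qed
      have f'_eq: "f' \<rho> = fst (D (\<xi>, \<rho>) (0, 1)) * frechet_derivative \<phi> (at (F (\<xi>, \<rho>))) (1, 0)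
          + snd (D (\<xi>, \<rho>) (0, 1)) * frechet_derivative \<phi> (at (F (\<xi>, \<rho>))) (0, 1)" for \<rho>
        using plane_derivative_components[OF has_derivative_linear[OF C1_D(1)[OF \<phi>]], of _ "fst (D (\<xi>, \<rho>) (0, 1))" "snd (D (\<xi>, \<rho>) (0, 1))"]
        by (simp add: f'_def)
      have cF: "continuous_on {lo..hi} (\<lambda>\<rho>. F (\<xi>, \<rho>))" "continuous_on {lo..hi} (\<lambda>\<rho>. D (\<xi>, \<rho>) (0, 1))"
        using lh by (auto intro!: continuous_on_compose2[OF F_cont] continuous_on_compose2[OF D_cont[OF Basis_plane(2)]] continuous_intros)
      have contf': "continuous_on {lo..hi} f'"
        unfolding f'_eq by (intro continuous_intros cF continuous_on_compose2[OF \<phi>c(2)] continuous_on_compose2[OF \<phi>c(3)]) auto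
      have contf: "continuous_on {lo..hi} f" by (rule DERIV_continuous_on[OF der])
      have "(\<phi> (\<gamma> \<xi>))\<^sup>2 = (f c)\<^sup>2" by (simp add: f_def \<gamma>_def)
      also have "\<dots> \<le> (1 + 1 / (hi - lo)) * integral {lo..hi} (\<lambda>t. (f t)\<^sup>2 + (f' t)\<^sup>2)"
        by (rule trace_inequality_interval[OF lh(2,4) der contf'])
      also have "\<dots> \<le> K * integral {lo..hi} (\<lambda>t. (1 + 2 * B\<^sup>2) * \<psi> (F (\<xi>, t)))"
      proof (rule mult_mono)
        show "1 + 1 / (hi - lo) \<le> K" using lohi ac cb by (auto simp: K_def)
        show "integral {lo..hi} (\<lambda>t. (f t)\<^sup>2 + (f' t)\<^sup>2) \<le> integral {lo..hi} (\<lambda>t. (1 + 2 * B\<^sup>2) * \<psi> (F (\<xi>, t)))"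
        proof (rule integral_le)
          show "(\<lambda>t. (f t)\<^sup>2 + (f' t)\<^sup>2) integrable_on {lo..hi}"
            by (intro integrable_continuous_real continuous_intros contf contf')
          show "(\<lambda>t. (1 + 2 * B\<^sup>2) * \<psi> (F (\<xi>, t))) integrable_on {lo..hi}"
            by (intro integrable_continuous_real continuous_intros continuous_on_compose2[OF \<psi>(1)] cF) auto
          fix t assume t: "t \<in> {lo..hi}"
          let ?p = "fst (D (\<xi>, t) (0, 1))" and ?q = "snd (D (\<xi>, t) (0, 1))"
          let ?x = "frechet_derivative \<phi> (at (F (\<xi>, t))) (1, 0)" and ?y = "frechet_derivative \<phi> (at (F (\<xi>, t))) (0, 1)"
          have pq: "?p\<^sup>2 \<le> B\<^sup>2" "?q\<^sup>2 \<le> B\<^sup>2"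
            using B(3)[OF in_dom(2)[OF t]] norm_fst_le[of "fst (D (\<xi>, t) (0, 1))" "snd (D (\<xi>, t) (0, 1))"]
              norm_snd_le[of "snd (D (\<xi>, t) (0, 1))" "fst (D (\<xi>, t) (0, 1))"]
            by (auto intro!: abs_le_square_iff[THEN iffD1])
          have "(f' t)\<^sup>2 \<le> 2 * (?p * ?x)\<^sup>2 + 2 * (?q * ?y)\<^sup>2"
            unfolding f'_eq using zero_le_power2[of "?p * ?x - ?q * ?y"] by (simp add: power2_sum power2_diff)
          also have "\<dots> \<le> 2 * (B\<^sup>2 * ?x\<^sup>2) + 2 * (B\<^sup>2 * ?y\<^sup>2)"
            unfolding power_mult_distrib using pq by (intro add_mono mult_left_mono mult_right_mono) auto
          finally have "(f' t)\<^sup>2 \<le> 2 * B\<^sup>2 * (?x\<^sup>2 + ?y\<^sup>2)" by (simp add: algebra_simps)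
          moreover have "0 \<le> 2 * B\<^sup>2 * (f t)\<^sup>2" by simp
          moreover have "0 \<le> ?x\<^sup>2 + ?y\<^sup>2" by simp
          ultimately show "(f t)\<^sup>2 + (f' t)\<^sup>2 \<le> (1 + 2 * B\<^sup>2) * \<psi> (F (\<xi>, t))"
            unfolding \<psi>_def f_def[symmetric] distrib_right distrib_left by linarith
        qed
        show "0 \<le> integral {lo..hi} (\<lambda>t. (f t)\<^sup>2 + (f' t)\<^sup>2)"
          by (intro integral_nonneg integrable_continuous_real continuous_intros contf contf') auto
      qed (use K in auto)
      finally show ?thesis by (simp add: mult.assoc)
    qed
    have c1: "continuous_on S (\<lambda>t. (\<phi> (\<gamma> t))\<^sup>2)" for S
      by (intro continuous_intros continuous_on_compose2[OF \<phi>c(1)] \<gamma>_cont) auto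
    have \<phi>m: "(\<lambda>x. (\<phi> x)\<^sup>2) \<in> borel_measurable M"
      unfolding borel_measurable_M_iff
      by (intro measurable_restrict_space1 borel_measurable_continuous_onI continuous_intros \<phi>c)
    have "(\<integral>x. (\<phi> x)\<^sup>2 \<partial>M) = integral {-1..1} (\<lambda>t. J t * (\<phi> (\<gamma> t))\<^sup>2)"
      unfolding M_integral(2)[OF \<phi>m]
      by (intro lebesgue_on_period_eq_integral(2) continuous_intros J_cont c1)
    also have "\<dots> \<le> integral {-1..1} (\<lambda>\<xi>. B * (K * (1 + 2 * B\<^sup>2)) * integral (cbox lo hi) (\<lambda>\<rho>. \<psi> (F (\<xi>, \<rho>))))"
    proof (rule integral_le)
      show "(\<lambda>t. J t * (\<phi> (\<gamma> t))\<^sup>2) integrable_on {-1..1}"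
        by (intro integrable_continuous_real continuous_intros J_cont c1)
      have "continuous_on (cbox (-1) 1) (\<lambda>\<xi>. integral (cbox lo hi) (\<lambda>\<rho>. \<psi> (F (\<xi>, \<rho>))))"
        by (rule integral_continuous_on_param) (use c\<psi> in \<open>simp add: cbox_Pair_eq split_beta\<close>)
      then show "(\<lambda>\<xi>. B * (K * (1 + 2 * B\<^sup>2)) * integral (cbox lo hi) (\<lambda>\<rho>. \<psi> (F (\<xi>, \<rho>)))) integrable_on {-1..1}"
        by (intro integrable_continuous_real continuous_intros) simp
      fix \<xi> :: real assume \<xi>: "\<xi> \<in> {-1..1}"
      have "J \<xi> \<le> B" unfolding J_def using B(2) \<xi> ac cb by auto
      then have "J \<xi> * (\<phi> (\<gamma> \<xi>))\<^sup>2 \<le> B * (K * (1 + 2 * B\<^sup>2) * integral {lo..hi} (\<lambda>\<rho>. \<psi> (F (\<xi>, \<rho>))))"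
        using B(1) line[OF \<xi>] by (intro mult_mono) auto
      then show "J \<xi> * (\<phi> (\<gamma> \<xi>))\<^sup>2 \<le> B * (K * (1 + 2 * B\<^sup>2)) * integral (cbox lo hi) (\<lambda>\<rho>. \<psi> (F (\<xi>, \<rho>)))"
        by (simp add: mult.assoc)
    qed
    also have "\<dots> = B * (K * (1 + 2 * B\<^sup>2)) * integral ?R (\<lambda>x. \<psi> (F x))"
      using integral_prod_continuous[OF c\<psi>] by simp
    also have "\<dots> \<le> B * (K * (1 + 2 * B\<^sup>2)) * ((H1_norm \<Omega> \<phi>)\<^sup>2 / d)"
    proof (rule mult_left_mono)
      show "integral ?R (\<lambda>x. \<psi> (F x)) \<le> (H1_norm \<Omega> \<phi>)\<^sup>2 / d"
        using d(2)[OF lh(1-3) \<Omega> \<psi>] d(1) unfolding H by (simp add: field_simps)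
    qed (use B K in auto)
    finally show "(\<integral>x. (\<phi> x)\<^sup>2 \<partial>M) \<le> C * (H1_norm \<Omega> \<phi>)\<^sup>2" by (simp add: C_def)
  qed
qed

end

section \<open>Fourier analysis on a period\<close>

text \<open>A Borel measure on the whole line concentrated on one period: shifts of Borel functions
  stay measurable without further care, and integrals over the interface are turned into integrals
  over \<open>per\<close>.\<close>

definition per :: "real measure" where
  "per = density lborel (indicator {-1..<1})"

lemma sets_per [measurable_cong, simp]: "sets per = sets borel"
  and space_per [simp]: "space per = UNIV"
  by (auto simp: per_def)

lemma nn_integral_per:
  "f \<in> borel_measurable borel \<Longrightarrow> (\<integral>\<^sup>+x. f x \<partial>per) = (\<integral>\<^sup>+x. indicator {-1..<1} x * f x \<partial>lborel)"
  unfolding per_def by (subst nn_integral_density) auto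

lemma emeasure_per_UNIV: "emeasure per UNIV = 2"
  unfolding per_def by (simp add: emeasure_density)

interpretation per: finite_measure per
  by standard (simp add: emeasure_per_UNIV)

interpretation per_pair: pair_sigma_finite per per ..

lemma AE_per_interval: "AE x in per. x \<in> {-1..<1}"
  unfolding per_def by (subst AE_density) (auto simp: indicator_def)

text \<open>The part of the shifted period beyond 1 is moved back by 2. This is carried out for
  shifts in [0, 2]; a negative shift is replaced by \<open>h + 2\<close>.\<close>

lemma nn_integral_shift_period:
  fixes f :: "real \<Rightarrow> ennreal"
  assumes f[measurable]: "f \<in> borel_measurable borel" and p: "\<And>x. f (x + 2) = f x" and h: "\<bar>h\<bar> \<le> 1"
  shows "(\<integral>\<^sup>+x. f (x + h) \<partial>per) = (\<integral>\<^sup>+x. f x \<partial>per)"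
proof -
  have tr: "(\<integral>\<^sup>+x. g (c + x) \<partial>lborel) = (\<integral>\<^sup>+x. g x \<partial>lborel)" if [measurable]: "g \<in> borel_measurable borel"
    for g :: "real \<Rightarrow> ennreal" and c
    using nn_integral_real_affine[of g 1 c] by simp
  have main: "(\<integral>\<^sup>+x. f (x + h) \<partial>per) = (\<integral>\<^sup>+x. f x \<partial>per)" if h: "0 \<le> h" "h \<le> 2" for h
  proof -
    have "(\<integral>\<^sup>+x. f (x + h) \<partial>per) = (\<integral>\<^sup>+x. indicator {-1..<1} x * f (x + h) \<partial>lborel)"
      by (subst nn_integral_per) auto
    also have "\<dots> = (\<integral>\<^sup>+x. indicator {h-1..<h+1} (h + x) * f (h + x) \<partial>lborel)"
      by (intro nn_integral_cong) (auto simp: indicator_def add.commute)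
    also have "\<dots> = (\<integral>\<^sup>+x. indicator {h-1..<h+1} x * f x \<partial>lborel)"
      by (rule tr) measurable
    also have "\<dots> = (\<integral>\<^sup>+x. indicator {h-1..<1} x * f x + indicator {1..<h+1} x * f x \<partial>lborel)"
      using h by (intro nn_integral_cong) (auto simp: indicator_def)
    also have "\<dots> = (\<integral>\<^sup>+x. indicator {h-1..<1} x * f x \<partial>lborel) + (\<integral>\<^sup>+x. indicator {1..<h+1} x * f x \<partial>lborel)"
      by (rule nn_integral_add) auto
    also have "(\<integral>\<^sup>+x. indicator {1..<h+1} x * f x \<partial>lborel)
        = (\<integral>\<^sup>+x. indicator {1..<h+1} (2 + x) * f (2 + x) \<partial>lborel)"
      by (rule tr[symmetric]) measurable
    also have "\<dots> = (\<integral>\<^sup>+x. indicator {-1..<h-1} x * f x \<partial>lborel)"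
      by (intro nn_integral_cong) (auto simp: indicator_def p add.commute)
    also have "(\<integral>\<^sup>+x. indicator {h-1..<1} x * f x \<partial>lborel) + (\<integral>\<^sup>+x. indicator {-1..<h-1} x * f x \<partial>lborel)
        = (\<integral>\<^sup>+x. indicator {h-1..<1} x * f x + indicator {-1..<h-1} x * f x \<partial>lborel)"
      by (rule nn_integral_add[symmetric]) auto
    also have "\<dots> = (\<integral>\<^sup>+x. indicator {-1..<1} x * f x \<partial>lborel)"
      using h by (intro nn_integral_cong) (auto simp: indicator_def)
    finally show ?thesis by (simp add: nn_integral_per)
  qed
  show ?thesis
  proof (cases "0 \<le> h")
    case True
    then show ?thesis using h main by auto
  next
    case False
    have "(\<integral>\<^sup>+x. f (x + h) \<partial>per) = (\<integral>\<^sup>+x. f (x + (h + 2)) \<partial>per)"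
      by (intro nn_integral_cong) (metis add.assoc p)
    then show ?thesis using main[of "h + 2"] h False by simp
  qed
qed

lemma integral_shift_period:
  fixes f :: "real \<Rightarrow> real"
  assumes f: "integrable per f" and p: "\<And>x. f (x + 2) = f x" and h: "\<bar>h\<bar> \<le> 1"
  shows "integrable per (\<lambda>x. f (x + h))" "(\<integral>x. f (x + h) \<partial>per) = (\<integral>x. f x \<partial>per)"
proof -
  have m[measurable]: "f \<in> borel_measurable borel" using borel_measurable_integrable[OF f] by simp
  have s: "(\<integral>\<^sup>+x. ennreal (g (x + h)) \<partial>per) = (\<integral>\<^sup>+x. ennreal (g x) \<partial>per)"
    if [measurable]: "g \<in> borel_measurable borel" and "\<And>x. g (x + 2) = g x" for g :: "real \<Rightarrow> real"
    by (rule nn_integral_shift_period[OF _ _ h]) (simp_all add: that)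
  have "(\<integral>\<^sup>+x. ennreal (norm (f (x + h))) \<partial>per) = (\<integral>\<^sup>+x. ennreal (norm (f x)) \<partial>per)"
    by (rule s) (auto simp: p)
  then show i: "integrable per (\<lambda>x. f (x + h))"
    using f unfolding integrable_iff_bounded by simp
  show "(\<integral>x. f (x + h) \<partial>per) = (\<integral>x. f x \<partial>per)"
    unfolding real_lebesgue_integral_def[OF f] real_lebesgue_integral_def[OF i]
    using s[of f] s[of "\<lambda>x. - f x"] by (simp add: p)
qed

lemma continuous_per:
  fixes f :: "real \<Rightarrow> real"
  assumes "continuous_on UNIV f"
  shows "integrable per f" "(\<integral>x. f x \<partial>per) = integral {-1..1} f"
proof -
  have m[measurable]: "f \<in> borel_measurable borel" by (rule borel_measurable_continuous_onI[OF assms])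
  have "f absolutely_integrable_on {-1..1}"
    by (rule absolutely_integrable_continuous_real[OF continuous_on_subset[OF assms]]) simp
  then have a: "f absolutely_integrable_on {-1..<1}"
    by (rule set_integrable_subset) auto
  then have "integrable lebesgue (\<lambda>x. indicator {-1..<1} x *\<^sub>R f x)"
    by (simp add: set_integrable_def)
  then have b: "integrable lborel (\<lambda>x. indicator {-1..<1} x *\<^sub>R f x)"
    by (subst (asm) integrable_completion) auto
  have ind: "(indicator {-1..<1} :: real \<Rightarrow> ennreal) = (\<lambda>x. ennreal (indicator {-1..<1} x))"
    by (auto simp: indicator_def)
  show "integrable per f"
    unfolding per_def ind using b by (subst integrable_density) auto
  have "(\<integral>x. f x \<partial>per) = (\<integral>x. indicator {-1..<1} x *\<^sub>R f x \<partial>lborel)"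
    unfolding per_def ind by (subst integral_density) auto
  also have "\<dots> = (\<integral>x. indicator {-1..<1} x *\<^sub>R f x \<partial>lebesgue)"
    by (rule integral_completion[symmetric]) auto
  also have "\<dots> = integral {-1..<1} f"
    using set_lebesgue_integral_eq_integral(2)[OF a] by (simp add: set_lebesgue_integral_def)
  also have "\<dots> = integral {-1..1} f"
  proof (rule integral_subset_negligible)
    have "{-1..1} - {-1..<1} = {1::real}" by auto
    then show "negligible ({-1..1} - {-1..<1::real})" by simp
  qed auto
  finally show "(\<integral>x. f x \<partial>per) = integral {-1..1} f" .
qed

text \<open>The Slobodeckij seminorm of a 2-periodic function of the parameter, with the second
  point written as \<open>x + h\<close>: integrated over \<open>x\<close> for fixed
  \<open>h\<close>, the squared increments are diagonal in the frequencies. At \<open>h = 0\<close>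
  the quotient is 0.\<close>

definition circ_slobodeckij :: "(real \<Rightarrow> real) \<Rightarrow> ennreal" where
  "circ_slobodeckij g = (\<integral>\<^sup>+x. \<integral>\<^sup>+h. ennreal ((g (x + h) - g x)\<^sup>2 / h\<^sup>2) \<partial>per \<partial>per)"

lemma circ_slobodeckij_swap:
  assumes [measurable]: "g \<in> borel_measurable borel"
  shows "circ_slobodeckij g = (\<integral>\<^sup>+h. \<integral>\<^sup>+x. ennreal ((g (x + h) - g x)\<^sup>2 / h\<^sup>2) \<partial>per \<partial>per)"
  unfolding circ_slobodeckij_def by (rule per_pair.Fubini') measurable

text \<open>The increment of the product is split into an increment of \<open>g\<close> and one of
  \<open>K\<close>; the Lipschitz bound on the latter cancels \<open>h\<^sup>2\<close>. The constant
  4 is 2 from the square of a sum times the total mass 2 of \<open>per\<close>.\<close>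

lemma circ_slobodeckij_mult_le:
  assumes [measurable]: "g \<in> borel_measurable borel" "K \<in> borel_measurable borel"
    and k: "\<And>x. \<bar>K x\<bar> \<le> k" and L: "\<And>x h. \<bar>K (x + h) - K x\<bar> \<le> L * \<bar>h\<bar>"
  shows "circ_slobodeckij (\<lambda>x. K x * g x)
    \<le> ennreal (2 * k\<^sup>2) * circ_slobodeckij g + ennreal (4 * L\<^sup>2) * (\<integral>\<^sup>+x. ennreal ((g x)\<^sup>2) \<partial>per)"
proof -
  have "circ_slobodeckij (\<lambda>x. K x * g x) \<le>
      (\<integral>\<^sup>+x. \<integral>\<^sup>+h. ennreal (2 * k\<^sup>2) * ennreal ((g (x + h) - g x)\<^sup>2 / h\<^sup>2) + ennreal (2 * L\<^sup>2) * ennreal ((g x)\<^sup>2) \<partial>per \<partial>per)"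
    unfolding circ_slobodeckij_def
  proof (intro nn_integral_mono)
    fix x h :: real
    have "(K (x + h) * g (x + h) - K x * g x)\<^sup>2 = (K (x + h) * (g (x + h) - g x) + g x * (K (x + h) - K x))\<^sup>2"
      by (simp add: algebra_simps)
    also have "\<dots> \<le> 2 * (K (x + h) * (g (x + h) - g x))\<^sup>2 + 2 * (g x * (K (x + h) - K x))\<^sup>2"
      using zero_le_power2[of "K (x + h) * (g (x + h) - g x) - g x * (K (x + h) - K x)"]
      by (simp add: power2_sum power2_diff)
    also have "\<dots> \<le> 2 * (k\<^sup>2 * (g (x + h) - g x)\<^sup>2) + 2 * ((g x)\<^sup>2 * (L\<^sup>2 * h\<^sup>2))"
    proof -
      have "(K (x + h))\<^sup>2 \<le> k\<^sup>2" using power_mono[OF k abs_ge_zero, of "x + h" 2] by simp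
      moreover have "(K (x + h) - K x)\<^sup>2 \<le> L\<^sup>2 * h\<^sup>2"
        using power_mono[OF L abs_ge_zero, of x h 2] by (simp add: power_mult_distrib)
      ultimately show ?thesis unfolding power_mult_distrib
        by (intro add_mono mult_left_mono mult_right_mono) auto
    qed
    finally have *: "(K (x + h) * g (x + h) - K x * g x)\<^sup>2 \<le> 2 * (k\<^sup>2 * (g (x + h) - g x)\<^sup>2) + 2 * ((g x)\<^sup>2 * (L\<^sup>2 * h\<^sup>2))" .
    have "(K (x + h) * g (x + h) - K x * g x)\<^sup>2 / h\<^sup>2 \<le> 2 * k\<^sup>2 * ((g (x + h) - g x)\<^sup>2 / h\<^sup>2) + 2 * L\<^sup>2 * (g x)\<^sup>2"
    proof (cases "h = 0")
      case False
      then show ?thesis using divide_right_mono[OF *, of "h\<^sup>2"] by (simp add: add_divide_distrib mult_ac)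
    qed simp
    then have "ennreal ((K (x + h) * g (x + h) - K x * g x)\<^sup>2 / h\<^sup>2)
        \<le> ennreal (2 * k\<^sup>2 * ((g (x + h) - g x)\<^sup>2 / h\<^sup>2) + 2 * L\<^sup>2 * (g x)\<^sup>2)"
      by (rule ennreal_leI)
    also have "\<dots> = ennreal (2 * k\<^sup>2) * ennreal ((g (x + h) - g x)\<^sup>2 / h\<^sup>2) + ennreal (2 * L\<^sup>2) * ennreal ((g x)\<^sup>2)"
      by (subst ennreal_plus) (auto simp: ennreal_mult[symmetric])
    finally show "ennreal ((K (x + h) * g (x + h) - K x * g x)\<^sup>2 / h\<^sup>2)
        \<le> ennreal (2 * k\<^sup>2) * ennreal ((g (x + h) - g x)\<^sup>2 / h\<^sup>2) + ennreal (2 * L\<^sup>2) * ennreal ((g x)\<^sup>2)" .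
  qed
  also have "\<dots> = (\<integral>\<^sup>+x. ennreal (2 * k\<^sup>2) * (\<integral>\<^sup>+h. ennreal ((g (x + h) - g x)\<^sup>2 / h\<^sup>2) \<partial>per)
      + ennreal (2 * L\<^sup>2) * ennreal ((g x)\<^sup>2) * 2 \<partial>per)"
    by (simp add: nn_integral_add nn_integral_cmult emeasure_per_UNIV)
  also have "\<dots> = ennreal (2 * k\<^sup>2) * circ_slobodeckij g + ennreal (2 * L\<^sup>2) * (\<integral>\<^sup>+x. ennreal ((g x)\<^sup>2) \<partial>per) * 2"
    unfolding circ_slobodeckij_def
    by (simp add: nn_integral_add nn_integral_cmult nn_integral_multc)
  also have "ennreal (2 * L\<^sup>2) * (\<integral>\<^sup>+x. ennreal ((g x)\<^sup>2) \<partial>per) * 2 = ennreal (4 * L\<^sup>2) * (\<integral>\<^sup>+x. ennreal ((g x)\<^sup>2) \<partial>per)"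
  proof -
    have "ennreal (4 * L\<^sup>2) = ennreal (2 * L\<^sup>2) * ennreal 2"
      by (subst ennreal_mult[symmetric]) auto
    then show ?thesis by (simp add: mult_ac)
  qed
  finally show ?thesis .
qed

section \<open>Bounds for the cosine kernel, linear in the frequency from above and below\<close>

lemma two_minus_two_cos: "2 - 2 * cos x = 4 * (sin (x / 2))\<^sup>2" for x :: real
  using cos_double_sin[of "x / 2"] by simp

text \<open>The numerator is at most 4 and at most \<open>w\<^sup>2 * h\<^sup>2\<close>, where
  \<open>w = n * pi\<close>, hence at most their harmonic mean. Divided by \<open>h\<^sup>2\<close>
  this is the rational majorant below, with an arctangent as antiderivative; the bound
  \<open>pi / 2\<close> of the arctangent leaves one factor \<open>w\<close>, hence linear growth in
  \<open>n\<close>.\<close>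

lemma cos_kernel_upper: "(\<integral>\<^sup>+h. ennreal ((2 - 2 * cos (real n * pi * h)) / h\<^sup>2) \<partial>per) \<le> ennreal (4 * pi\<^sup>2 * real n)"
proof (cases "n = 0")
  case False
  define w where "w = real n * pi"
  have w: "0 < w" using False by (simp add: w_def)
  have "(\<integral>\<^sup>+h. ennreal ((2 - 2 * cos (real n * pi * h)) / h\<^sup>2) \<partial>per)
      = (\<integral>\<^sup>+h. indicator {-1..<1} h * ennreal ((2 - 2 * cos (real n * pi * h)) / h\<^sup>2) \<partial>lborel)"
    by (rule nn_integral_per) measurable
  also have "\<dots> \<le> (\<integral>\<^sup>+h. ennreal (8 * w\<^sup>2 / (w\<^sup>2 * h\<^sup>2 + 4)) * indicator {-1..1} h \<partial>lborel)"
    proof (rule nn_integral_mono)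
      fix h :: real
      have "(2 - 2 * cos (w * h)) / h\<^sup>2 \<le> 8 * w\<^sup>2 / (w\<^sup>2 * h\<^sup>2 + 4)"
      proof (cases "h = 0")
        case False
        have "4 * (sin (w * h / 2))\<^sup>2 \<le> 4 * 1"
          by (intro mult_left_mono) (simp_all add: abs_square_le_1)
        moreover have "\<bar>sin (w * h / 2)\<bar> \<le> \<bar>w * h / 2\<bar>" by (rule abs_sin_x_le_abs_x)
        then have "(sin (w * h / 2))\<^sup>2 \<le> (w * h / 2)\<^sup>2" by (rule abs_le_square_iff[THEN iffD1])
        then have "4 * (sin (w * h / 2))\<^sup>2 \<le> w\<^sup>2 * h\<^sup>2" by (simp add: power_divide power_mult_distrib)
        ultimately have "4 * (sin (w * h / 2))\<^sup>2 * (w\<^sup>2 * h\<^sup>2) + 4 * (sin (w * h / 2))\<^sup>2 * 4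
            \<le> 4 * (w\<^sup>2 * h\<^sup>2) + (w\<^sup>2 * h\<^sup>2) * 4"
          by (intro add_mono mult_right_mono) auto
        then have "4 * (sin (w * h / 2))\<^sup>2 * (w\<^sup>2 * h\<^sup>2 + 4) \<le> 8 * w\<^sup>2 * h\<^sup>2"
          by (simp add: algebra_simps)
        moreover have "0 < w\<^sup>2 * h\<^sup>2 + 4" by (intro add_nonneg_pos) auto
        ultimately show ?thesis
          using False unfolding two_minus_two_cos by (simp add: divide_simps mult_ac)
      qed simp
      then show "indicator {-1..<1} h * ennreal ((2 - 2 * cos (real n * pi * h)) / h\<^sup>2)
          \<le> ennreal (8 * w\<^sup>2 / (w\<^sup>2 * h\<^sup>2 + 4)) * indicator {-1..1} h"
        unfolding w_def by (auto simp: indicator_def intro: ennreal_leI)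
    qed
  also have "\<dots> = ennreal (4 * w * arctan (w * 1 / 2) - 4 * w * arctan (w * (-1) / 2))"
  proof (rule nn_integral_FTC_Icc)
    fix h :: real
    have "0 < w\<^sup>2 * h\<^sup>2 + 4" by (intro add_nonneg_pos) auto
    then show "((\<lambda>h. 4 * w * arctan (w * h / 2)) has_real_derivative 8 * w\<^sup>2 / (w\<^sup>2 * h\<^sup>2 + 4)) (at h)"
      by (auto intro!: derivative_eq_intros simp: divide_simps power2_eq_square)
        (simp add: algebra_simps)
    show "0 \<le> 8 * w\<^sup>2 / (w\<^sup>2 * h\<^sup>2 + 4)" by (intro divide_nonneg_nonneg add_nonneg_nonneg) auto
  qed auto
  also have "\<dots> \<le> ennreal (4 * pi\<^sup>2 * real n)"
  proof (rule ennreal_leI)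
    have "4 * w * arctan (w * 1 / 2) - 4 * w * arctan (w * (-1) / 2) = 8 * w * arctan (w / 2)"
      by (simp add: arctan_minus)
    also have "\<dots> \<le> 8 * w * (pi / 2)"
      using w arctan_ubound[of "w / 2"] by (intro mult_left_mono) auto
    also have "\<dots> = 4 * pi\<^sup>2 * real n" by (simp add: w_def power2_eq_square)
    finally show "4 * w * arctan (w * 1 / 2) - 4 * w * arctan (w * (-1) / 2) \<le> 4 * pi\<^sup>2 * real n" .
  qed
  finally show ?thesis .
qed simp

lemma half_le_sin:
  fixes x :: real
  assumes "0 \<le> x" "x \<le> 1"
  shows "x / 2 \<le> sin x"
proof -
  have "sin 0 - 0 / 2 \<le> sin x - x / 2"
  proof (rule DERIV_nonneg_imp_nondecreasing[of 0 x "\<lambda>x. sin x - x / 2"])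
    show "\<exists>y. ((\<lambda>x. sin x - x / 2) has_real_derivative y) (at u) \<and> 0 \<le> y" if "0 \<le> u" "u \<le> x" for u
    proof (intro exI conjI)
      show "((\<lambda>x. sin x - x / 2) has_real_derivative (cos u - 1 / 2)) (at u)"
        by (auto intro!: derivative_eq_intros)
      have "u \<le> pi / 3" using that assms pi_gt3 by linarith
      then have "cos (pi / 3) \<le> cos u" using that by (intro cos_monotone_0_pi_le) auto
      then show "0 \<le> cos u - 1 / 2" by (simp add: cos_60)
    qed
  qed (use assms in auto)
  then show ?thesis by simp
qed

text \<open>On \<open>0 < \<bar>h\<bar> < 1 / w\<close> the bound \<open>x / 2 \<le> sin x\<close>
  keeps the integrand above \<open>w\<^sup>2 / 4\<close>. This set has length \<open>2 / w\<close>,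
  which yields \<open>w / 2 \<ge> n\<close>.\<close>

lemma cos_kernel_lower: "ennreal (real n) \<le> (\<integral>\<^sup>+h. ennreal ((2 - 2 * cos (real n * pi * h)) / h\<^sup>2) \<partial>per)"
proof (cases "n = 0")
  case False
  define w where "w = real n * pi"
  have w: "1 < w" using False pi_gt3 mult_mono[of 1 "real n" 3 pi] by (simp add: w_def)
  have "ennreal (real n) \<le> ennreal (w\<^sup>2 / 4 * (2 / w))"
  proof (rule ennreal_leI)
    have "real n * 2 \<le> real n * pi" using pi_gt3 by (intro mult_left_mono) auto
    then show "real n \<le> w\<^sup>2 / 4 * (2 / w)" using w by (simp add: power2_eq_square) (simp add: w_def)
  qed
  \<comment> \<open>There are two open intervals instead of one because the integrand is 0 at
    \<open>h = 0\<close> by division by zero.\<close>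
  also have "\<dots> = ennreal (w\<^sup>2 / 4) * emeasure lborel {-(1/w)<..<0} + ennreal (w\<^sup>2 / 4) * emeasure lborel {0<..<1/w}"
    using w by (simp add: ennreal_mult[symmetric] ennreal_plus[symmetric] del: ennreal_plus)
  also have "\<dots> = (\<integral>\<^sup>+h. ennreal (w\<^sup>2 / 4) * indicator {-(1/w)<..<0} h + ennreal (w\<^sup>2 / 4) * indicator {0<..<1/w} h \<partial>lborel)"
    by (subst nn_integral_add) (auto simp: nn_integral_cmult_indicator)
  also have "\<dots> \<le> (\<integral>\<^sup>+h. indicator {-1..<1} h * ennreal ((2 - 2 * cos (real n * pi * h)) / h\<^sup>2) \<partial>lborel)"
  proof (rule nn_integral_mono)
    fix h :: real
    have *: "ennreal (w\<^sup>2 / 4) \<le> indicator {-1..<1} h * ennreal ((2 - 2 * cos (real n * pi * h)) / h\<^sup>2)"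
      if h: "0 < \<bar>h\<bar>" "\<bar>h\<bar> < 1 / w"
    proof -
      have wh: "w * \<bar>h\<bar> < 1" using h w by (simp add: field_simps)
      have "1 / w < 1" using w by simp
      then have ind: "h \<in> {-1..<1}" using h by auto
      have "w * \<bar>h\<bar> / 2 / 2 \<le> sin (w * \<bar>h\<bar> / 2)" using w wh by (intro half_le_sin) auto
      then have "(w * \<bar>h\<bar> / 2 / 2)\<^sup>2 \<le> (sin (w * \<bar>h\<bar> / 2))\<^sup>2" using w by (intro power_mono) auto
      moreover have "(sin (w * \<bar>h\<bar> / 2))\<^sup>2 = (sin (w * h / 2))\<^sup>2" by (cases "0 \<le> h") auto
      ultimately have "w\<^sup>2 * h\<^sup>2 / 4 \<le> 2 - 2 * cos (w * h)"
        unfolding two_minus_two_cos by (simp add: power_divide power_mult_distrib)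
      then have "w\<^sup>2 / 4 \<le> (2 - 2 * cos (w * h)) / h\<^sup>2" using h by (simp add: divide_simps)
      then show ?thesis using ind by (simp add: w_def ennreal_leI)
    qed
    then show "ennreal (w\<^sup>2 / 4) * indicator {-(1/w)<..<0} h + ennreal (w\<^sup>2 / 4) * indicator {0<..<1/w} h
        \<le> indicator {-1..<1} h * ennreal ((2 - 2 * cos (real n * pi * h)) / h\<^sup>2)"
      by (cases "h < 0"; cases "h > 0"; cases "\<bar>h\<bar> < 1 / w") (auto simp: indicator_def)
  qed
  also have "\<dots> = (\<integral>\<^sup>+h. ennreal ((2 - 2 * cos (real n * pi * h)) / h\<^sup>2) \<partial>per)"
    by (rule nn_integral_per[symmetric]) measurable
  finally show ?thesis .
qed simp

section \<open>Shifts and differences of periodic functions in L^2\<close>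

lemma L2_per_measurable: "f \<in> L2 per \<Longrightarrow> f \<in> borel_measurable borel"
  using L2_D(1)[of f per] by simp

lemma L2_per_continuous:
  assumes "continuous_on UNIV f"
  shows "f \<in> L2 per"
  using continuous_per(1)[OF continuous_on_power[OF assms], of 2] borel_measurable_continuous_onI[OF assms]
  by (simp add: L2_def)

lemma L2_per_shift:
  assumes "f \<in> L2 per" "\<And>x. f (x + 2) = f x" "\<bar>h\<bar> \<le> 1"
  shows "(\<lambda>x. f (x + h)) \<in> L2 per"
proof -
  have [measurable]: "f \<in> borel_measurable borel" using L2_per_measurable[OF assms(1)] .
  show ?thesis
    using integral_shift_period(1)[OF L2_D(2)[OF assms(1)] _ assms(3)] assms(2) by (simp add: L2_def)
qed

lemma shift_adjoint:
  assumes "f \<in> L2 per" "\<And>x. f (x + 2) = f x" "g \<in> L2 per" "\<And>x. g (x + 2) = g x" "\<bar>h\<bar> \<le> 1"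
  shows "(\<integral>x. f (x + h) * g x \<partial>per) = (\<integral>x. f x * g (x - h) \<partial>per)"
proof -
  have "(\<lambda>x. g (x - h)) \<in> L2 per" using L2_per_shift[OF assms(3,4), of "- h"] assms(5) by simp
  from L2_mult_integrable[OF assms(1) this]
  have "(\<integral>x. f (x + h) * g (x + h - h) \<partial>per) = (\<integral>x. f x * g (x - h) \<partial>per)"
  proof (rule integral_shift_period(2)[OF _ _ assms(5)])
    fix x
    have "g (x + 2 - h) = g (x - h)" using assms(4)[of "x - h"] by (simp add: algebra_simps)
    then show "f (x + 2) * g (x + 2 - h) = f x * g (x - h)" using assms(2) by simp
  qed
  then show ?thesis by simp
qed

text \<open>Summation by parts: the shift by \<open>- h\<close> is adjoint to the shift by
  \<open>h\<close>, so a product of two first differences becomes a product with a symmetric second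
  difference, on which each frequency acts by a scalar.\<close>

lemma integral_differences:
  assumes f: "f \<in> L2 per" "\<And>x. f (x + 2) = f x" and t: "t \<in> L2 per" "\<And>x. t (x + 2) = t x" and h: "\<bar>h\<bar> \<le> 1"
  shows "(\<integral>x. (f (x + h) - f x) * (t (x + h) - t x) \<partial>per) = (\<integral>x. f x * (2 * t x - (t (x + h) + t (x - h))) \<partial>per)"
proof -
  note fh = L2_per_shift[OF f h] and th = L2_per_shift[OF t h]
  have tmh: "(\<lambda>x. t (x - h)) \<in> L2 per" using L2_per_shift[OF t, of "- h"] h by simp
  note i = L2_mult_integrable[OF fh th] L2_mult_integrable[OF fh t(1)] L2_mult_integrable[OF f(1) th]
    L2_mult_integrable[OF f(1) t(1)] L2_mult_integrable[OF f(1) tmh]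
  have "(\<integral>x. (f (x + h) - f x) * (t (x + h) - t x) \<partial>per)
      = (\<integral>x. f (x + h) * t (x + h) \<partial>per) - (\<integral>x. f (x + h) * t x \<partial>per)
        - ((\<integral>x. f x * t (x + h) \<partial>per) - (\<integral>x. f x * t x \<partial>per))"
    using i by (simp add: left_diff_distrib right_diff_distrib)
  also have "(\<integral>x. f (x + h) * t (x + h) \<partial>per) = (\<integral>x. f x * t x \<partial>per)"
    by (rule integral_shift_period(2)[OF i(4) _ h]) (simp add: f t)
  also have "(\<integral>x. f (x + h) * t x \<partial>per) = (\<integral>x. f x * t (x - h) \<partial>per)"
    by (rule shift_adjoint[OF f t h])
  finally show ?thesis
    using i by (simp add: left_diff_distrib right_diff_distrib distrib_left mult.left_commute[of _ 2])
qed

text \<open>The members are not a fixed basis: \<open>e n\<close> will be the whole component of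
  frequency \<open>n\<close> of a given trigonometric polynomial, coefficients included. The
  addition law in \<open>e_shift\<close> encodes the frequency and yields orthogonality.\<close>

locale fourier_family =
  fixes e :: "nat \<Rightarrow> real \<Rightarrow> real"
  assumes e_cont: "continuous_on UNIV (e n)"
    and e_per: "e n (x + 2) = e n x"
    and e_shift: "e n (x + h) + e n (x - h) = 2 * cos (real n * pi * h) * e n x"
begin

definition E :: "nat \<Rightarrow> real" where "E n = (\<integral>x. (e n x)\<^sup>2 \<partial>per)"

text \<open>The eigenvalue of the operator
  \<open>f x \<mapsto> 2 * f x - (f (x + h) + f (x - h))\<close> on frequency
  \<open>n\<close>.\<close>

definition lam :: "nat \<Rightarrow> real \<Rightarrow> real" where "lam n h = 2 - 2 * cos (real n * pi * h)"

definition trig :: "(nat \<Rightarrow> real) \<Rightarrow> nat \<Rightarrow> real \<Rightarrow> real" where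
  "trig \<alpha> N x = (\<Sum>n\<le>N. \<alpha> n * e n x)"

lemma e_L2: "e n \<in> L2 per"
  by (rule L2_per_continuous[OF e_cont])

lemma E_nonneg: "0 \<le> E n"
  by (simp add: E_def)

lemma lam_nonneg: "0 \<le> lam n h"
  by (simp add: lam_def)

lemma trig_cont: "continuous_on UNIV (trig \<alpha> N)"
  unfolding trig_def by (intro continuous_intros e_cont)

lemma trig_L2: "trig \<alpha> N \<in> L2 per"
  by (rule L2_per_continuous[OF trig_cont])

lemma trig_per: "trig \<alpha> N (x + 2) = trig \<alpha> N x"
  by (simp add: trig_def e_per)

lemma trig_second_difference:
  "2 * trig \<alpha> N x - (trig \<alpha> N (x + h) + trig \<alpha> N (x - h)) = trig (\<lambda>n. \<alpha> n * lam n h) N x"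
proof -
  have "2 * trig \<alpha> N x - (trig \<alpha> N (x + h) + trig \<alpha> N (x - h))
      = (\<Sum>n\<le>N. \<alpha> n * (2 * e n x - (e n (x + h) + e n (x - h))))"
    by (simp add: trig_def sum_distrib_left sum.distrib sum_subtractf algebra_simps)
  also have "\<dots> = trig (\<lambda>n. \<alpha> n * lam n h) N x"
    unfolding e_shift trig_def lam_def by (simp add: algebra_simps)
  finally show ?thesis .
qed

lemma integral_mult_trig:
  assumes "f \<in> L2 per"
  shows "(\<integral>x. f x * trig \<alpha> N x \<partial>per) = (\<Sum>n\<le>N. \<alpha> n * (\<integral>x. f x * e n x \<partial>per))"
proof -
  have "(\<integral>x. f x * trig \<alpha> N x \<partial>per) = (\<integral>x. (\<Sum>n\<le>N. \<alpha> n * (f x * e n x)) \<partial>per)"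
    by (simp add: trig_def sum_distrib_left mult_ac)
  also have "\<dots> = (\<Sum>n\<le>N. \<alpha> n * (\<integral>x. f x * e n x \<partial>per))"
    by (subst Bochner_Integration.integral_sum) (auto intro!: L2_mult_integrable assms e_L2)
  finally show ?thesis .
qed

text \<open>The operator \<open>f \<mapsto> f (\<sqdot> + h) + f (\<sqdot> - h)\<close> is symmetric and has different eigenvalues on different
  frequencies for \<open>h = 1 / n\<close>.\<close>

lemma e_orthogonal_aux:
  assumes "k < n"
  shows "(\<integral>x. e n x * e k x \<partial>per) = 0"
proof -
  define h where "h = 1 / real n"
  have h: "\<bar>h\<bar> \<le> 1" "\<bar>- h\<bar> \<le> 1" using assms by (auto simp: h_def)
  note sh = L2_per_shift[OF e_L2 e_per h(1)] L2_per_shift[OF e_L2 e_per h(2), simplified]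
  note i = L2_mult_integrable[OF e_L2 sh(1), of n k] L2_mult_integrable[OF e_L2 sh(2), of n k]
    L2_mult_integrable[OF sh(1) e_L2, of n k] L2_mult_integrable[OF sh(2) e_L2, of n k]
  have "(\<lambda>x. e n x * (e k (x + h) + e k (x - h))) = (\<lambda>x. (2 * cos (real k * pi * h)) * (e n x * e k x))"
    unfolding e_shift by (intro ext) (simp only: mult_ac)
  then have "2 * cos (real k * pi * h) * (\<integral>x. e n x * e k x \<partial>per)
      = (\<integral>x. e n x * (e k (x + h) + e k (x - h)) \<partial>per)"
    by simp
  also have "\<dots> = (\<integral>x. e n x * e k (x + h) \<partial>per) + (\<integral>x. e n x * e k (x - h) \<partial>per)"
    using i by (simp add: distrib_left)
  also have "\<dots> = (\<integral>x. e n (x - h) * e k x \<partial>per) + (\<integral>x. e n (x + h) * e k x \<partial>per)"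
    using shift_adjoint[OF e_L2 e_per e_L2 e_per h(1), of n k] shift_adjoint[OF e_L2 e_per e_L2 e_per h(2), of n k]
    by simp
  also have "\<dots> = (\<integral>x. (e n (x + h) + e n (x - h)) * e k x \<partial>per)"
    using i by (simp add: distrib_right)
  also have "\<dots> = 2 * cos (real n * pi * h) * (\<integral>x. e n x * e k x \<partial>per)"
    by (simp add: e_shift mult.assoc)
  finally have *: "(cos (real k * pi * h) - cos (real n * pi * h)) * (\<integral>x. e n x * e k x \<partial>per) = 0"
    by (simp add: algebra_simps)
  have npi: "real n * pi * h = pi" using assms by (simp add: h_def)
  have "cos pi < cos (real k * pi * h)"
    using assms by (intro cos_monotone_0_pi) (auto simp: h_def field_simps)
  then have "cos (real k * pi * h) - cos (real n * pi * h) \<noteq> 0" unfolding npi by linarith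
  then show ?thesis using * mult_eq_0_iff by blast
qed

lemma e_orthogonal: "(\<integral>x. e n x * e k x \<partial>per) = (if n = k then E n else 0)"
  using e_orthogonal_aux[of k n] e_orthogonal_aux[of n k]
  by (cases n k rule: linorder_cases) (auto simp: E_def power2_eq_square mult.commute[of "e n _"])

lemma integral_trig_trig:
  "(\<integral>x. trig \<alpha> N x * trig \<beta> N x \<partial>per) = (\<Sum>n\<le>N. \<alpha> n * \<beta> n * E n)"
proof -
  have "(\<integral>x. trig \<alpha> N x * e n x \<partial>per) = \<alpha> n * E n" if "n \<le> N" for n
  proof -
    have "(\<integral>x. e n x * trig \<alpha> N x \<partial>per) = (\<Sum>k\<le>N. \<alpha> k * (if n = k then E n else 0))"
      unfolding integral_mult_trig[OF e_L2] e_orthogonal ..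
    then show ?thesis using that by (simp add: if_distrib[of "(*) _"] mult.commute[of "e n _"] cong: if_cong)
  qed
  then show ?thesis
    by (subst integral_mult_trig[OF trig_L2]) (auto intro!: sum.cong)
qed

lemma integral_trig_power2: "(\<integral>x. (trig \<alpha> N x)\<^sup>2 \<partial>per) = (\<Sum>n\<le>N. (\<alpha> n)\<^sup>2 * E n)"
  using integral_trig_trig[of \<alpha> N \<alpha>] by (simp add: power2_eq_square)

text \<open>A component of zero energy vanishes almost everywhere. The case has to be covered
  because the family consists of components of a given function, some of which may be
  absent.\<close>

lemma coefficient_zero:
  assumes "f \<in> L2 per" "E n = 0"
  shows "(\<integral>x. f x * e n x \<partial>per) = 0"
proof -
  have "AE x in per. (e n x)\<^sup>2 = 0"
    using integral_nonneg_eq_0_iff_AE[OF L2_D(2)[OF e_L2]] assms(2) by (simp add: E_def)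
  then have "(\<integral>x. f x * e n x \<partial>per) = (\<integral>x. 0 \<partial>per)"
    using L2_mult_integrable[OF assms(1) e_L2, of n] by (intro integral_cong_AE) (auto elim!: eventually_mono)
  then show ?thesis by simp
qed

text \<open>The squared norm of the projection of \<open>f\<close> onto the line spanned by
  \<open>e n\<close>; for an absent frequency, division by zero gives the right value 0.\<close>

definition q :: "(real \<Rightarrow> real) \<Rightarrow> nat \<Rightarrow> real" where
  "q f n = (\<integral>x. f x * e n x \<partial>per)\<^sup>2 / E n"

lemma q_nonneg: "0 \<le> q f n"
  by (simp add: q_def E_nonneg)

lemma bessel:
  assumes f: "f \<in> L2 per"
  shows "(\<Sum>n\<le>N. q f n) \<le> (\<integral>x. (f x)\<^sup>2 \<partial>per)"
proof -
  define \<alpha> where "\<alpha> n = (\<integral>x. f x * e n x \<partial>per) / E n" for n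
  have "0 \<le> (\<integral>x. (f x - trig \<alpha> N x)\<^sup>2 \<partial>per)" by simp
  also have "\<dots> = (\<integral>x. (f x)\<^sup>2 \<partial>per) + (\<integral>x. (trig \<alpha> N x)\<^sup>2 \<partial>per) - 2 * (\<integral>x. f x * trig \<alpha> N x \<partial>per)"
    using L2_D(2)[OF f] L2_D(2)[OF trig_L2] L2_mult_integrable[OF f trig_L2]
    by (simp add: power2_diff mult.assoc)
  also have "(\<integral>x. (trig \<alpha> N x)\<^sup>2 \<partial>per) = (\<Sum>n\<le>N. q f n)"
    unfolding integral_trig_power2 by (intro sum.cong) (auto simp: \<alpha>_def q_def power2_eq_square)
  also have "(\<integral>x. f x * trig \<alpha> N x \<partial>per) = (\<Sum>n\<le>N. q f n)"
    unfolding integral_mult_trig[OF f] by (intro sum.cong) (auto simp: \<alpha>_def q_def power2_eq_square)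
  finally show ?thesis by simp
qed

text \<open>Bessel's inequality for first differences. For the Fourier coefficients
  \<open>\<alpha>\<close> of \<open>f\<close>, the squared difference of
  \<open>trig \<alpha> N\<close> and its product with the difference of \<open>f\<close> both
  integrate to the left-hand sum.\<close>

lemma bessel_differences:
  assumes f: "f \<in> L2 per" "\<And>x. f (x + 2) = f x" and h: "\<bar>h\<bar> \<le> 1"
  shows "(\<Sum>n\<le>N. lam n h * q f n) \<le> (\<integral>x. (f (x + h) - f x)\<^sup>2 \<partial>per)"
proof -
  define \<alpha> where "\<alpha> n = (\<integral>x. f x * e n x \<partial>per) / E n" for n
  let ?t = "trig \<alpha> N"
  have df: "(\<lambda>x. f (x + h) - f x) \<in> L2 per" by (intro L2_diff L2_per_shift f h)
  have dt: "(\<lambda>x. ?t (x + h) - ?t x) \<in> L2 per" by (intro L2_diff L2_per_shift trig_L2 trig_per h)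
  have expand: "(\<integral>x. (u x - v x)\<^sup>2 \<partial>per) = (\<integral>x. (u x)\<^sup>2 \<partial>per) + (\<integral>x. (v x)\<^sup>2 \<partial>per) - 2 * (\<integral>x. u x * v x \<partial>per)"
    if "u \<in> L2 per" "v \<in> L2 per" for u v :: "real \<Rightarrow> real"
    using L2_D(2)[OF that(1)] L2_D(2)[OF that(2)] L2_mult_integrable[OF that]
    by (simp add: power2_diff mult.assoc)
  have "0 \<le> (\<integral>x. ((f (x + h) - f x) - (?t (x + h) - ?t x))\<^sup>2 \<partial>per)" by simp
  also have "\<dots> = (\<integral>x. (f (x + h) - f x)\<^sup>2 \<partial>per) + (\<integral>x. (?t (x + h) - ?t x)\<^sup>2 \<partial>per)
      - 2 * (\<integral>x. (f (x + h) - f x) * (?t (x + h) - ?t x) \<partial>per)"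
    by (rule expand[OF df dt])
  also have "(\<integral>x. (?t (x + h) - ?t x)\<^sup>2 \<partial>per) = (\<Sum>n\<le>N. lam n h * q f n)"
    unfolding power2_eq_square integral_differences[OF trig_L2 trig_per trig_L2 trig_per h]
      trig_second_difference integral_trig_trig
    by (intro sum.cong) (auto simp: \<alpha>_def q_def power2_eq_square)
  also have "(\<integral>x. (f (x + h) - f x) * (?t (x + h) - ?t x) \<partial>per) = (\<Sum>n\<le>N. lam n h * q f n)"
    unfolding integral_differences[OF f trig_L2 trig_per h] trig_second_difference integral_mult_trig[OF f(1)]
    by (intro sum.cong) (auto simp: \<alpha>_def q_def power2_eq_square)
  finally show ?thesis by simp
qed

lemma circ_slobodeckij_L2:
  assumes f: "f \<in> L2 per" "\<And>x. f (x + 2) = f x"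
  shows "circ_slobodeckij f = (\<integral>\<^sup>+h. ennreal ((\<integral>x. (f (x + h) - f x)\<^sup>2 \<partial>per) / h\<^sup>2) \<partial>per)"
proof -
  have [measurable]: "f \<in> borel_measurable borel" by (rule L2_per_measurable[OF f(1)])
  have "(\<integral>\<^sup>+x. ennreal ((f (x + h) - f x)\<^sup>2 / h\<^sup>2) \<partial>per) = ennreal ((\<integral>x. (f (x + h) - f x)\<^sup>2 \<partial>per) / h\<^sup>2)"
    if h: "h \<in> {-1..<1}" for h
  proof -
    have "(\<lambda>x. f (x + h) - f x) \<in> L2 per" using h by (intro L2_diff L2_per_shift f) auto
    then have "integrable per (\<lambda>x. (f (x + h) - f x)\<^sup>2 / h\<^sup>2)" by (auto dest: L2_D(2))
    then show ?thesis by (subst nn_integral_eq_integral) auto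
  qed
  then show ?thesis unfolding circ_slobodeckij_swap[OF L2_per_measurable[OF f(1)]]
    by (intro nn_integral_cong_AE eventually_mono[OF AE_per_interval]) auto
qed

lemma bessel_circ_slobodeckij:
  assumes f: "f \<in> L2 per" "\<And>x. f (x + 2) = f x"
  shows "ennreal (\<Sum>n\<le>N. real n * q f n) \<le> circ_slobodeckij f"
proof -
  have "ennreal (\<Sum>n\<le>N. real n * q f n) = (\<Sum>n\<le>N. ennreal (real n) * ennreal (q f n))"
    by (simp add: q_nonneg ennreal_mult[symmetric])
  also have "\<dots> \<le> (\<Sum>n\<le>N. (\<integral>\<^sup>+h. ennreal ((2 - 2 * cos (real n * pi * h)) / h\<^sup>2) \<partial>per) * ennreal (q f n))"
    by (intro sum_mono mult_right_mono cos_kernel_lower) auto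
  also have "\<dots> = (\<Sum>n\<le>N. (\<integral>\<^sup>+h. ennreal (lam n h / h\<^sup>2) * ennreal (q f n) \<partial>per))"
    unfolding lam_def by (subst nn_integral_multc) auto
  also have "\<dots> = (\<integral>\<^sup>+h. (\<Sum>n\<le>N. ennreal (lam n h / h\<^sup>2) * ennreal (q f n)) \<partial>per)"
    unfolding lam_def by (subst nn_integral_sum) auto
  also have "\<dots> \<le> (\<integral>\<^sup>+h. ennreal ((\<integral>x. (f (x + h) - f x)\<^sup>2 \<partial>per) / h\<^sup>2) \<partial>per)"
  proof (intro nn_integral_mono_AE eventually_mono[OF AE_per_interval])
    fix h :: real assume h: "h \<in> {-1..<1}"
    have "(\<Sum>n\<le>N. ennreal (lam n h / h\<^sup>2) * ennreal (q f n)) = (\<Sum>n\<le>N. ennreal (lam n h * q f n / h\<^sup>2))"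
      by (intro sum.cong refl) (simp add: ennreal_mult[symmetric] lam_nonneg q_nonneg)
    also have "\<dots> = ennreal ((\<Sum>n\<le>N. lam n h * q f n) / h\<^sup>2)"
      by (simp add: lam_nonneg q_nonneg sum_divide_distrib)
    also have "\<dots> \<le> ennreal ((\<integral>x. (f (x + h) - f x)\<^sup>2 \<partial>per) / h\<^sup>2)"
      using h by (intro ennreal_leI divide_right_mono bessel_differences f) auto
    finally show "(\<Sum>n\<le>N. ennreal (lam n h / h\<^sup>2) * ennreal (q f n))
        \<le> ennreal ((\<integral>x. (f (x + h) - f x)\<^sup>2 \<partial>per) / h\<^sup>2)" .
  qed
  finally show ?thesis by (simp add: circ_slobodeckij_L2[OF f])
qed

lemma circ_slobodeckij_trig:
  "circ_slobodeckij (trig \<alpha> N) \<le> ennreal (4 * pi\<^sup>2 * (\<Sum>n\<le>N. real n * ((\<alpha> n)\<^sup>2 * E n)))"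
proof -
  have "circ_slobodeckij (trig \<alpha> N) = (\<integral>\<^sup>+h. ennreal ((\<integral>x. (trig \<alpha> N (x + h) - trig \<alpha> N x)\<^sup>2 \<partial>per) / h\<^sup>2) \<partial>per)"
    by (rule circ_slobodeckij_L2[OF trig_L2 trig_per])
  also have "\<dots> = (\<integral>\<^sup>+h. (\<Sum>n\<le>N. ennreal ((\<alpha> n)\<^sup>2 * E n) * ennreal (lam n h / h\<^sup>2)) \<partial>per)"
  proof (intro nn_integral_cong_AE eventually_mono[OF AE_per_interval])
    fix h :: real assume "h \<in> {-1..<1}"
    then have h: "\<bar>h\<bar> \<le> 1" by auto
    have "(\<integral>x. (trig \<alpha> N (x + h) - trig \<alpha> N x)\<^sup>2 \<partial>per) / h\<^sup>2 = (\<Sum>n\<le>N. (\<alpha> n)\<^sup>2 * E n * (lam n h / h\<^sup>2))"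
      unfolding power2_eq_square[of "trig \<alpha> N (_ + h) - trig \<alpha> N _"]
        integral_differences[OF trig_L2 trig_per trig_L2 trig_per h] trig_second_difference integral_trig_trig
        sum_divide_distrib
      by (intro sum.cong) (auto simp: power2_eq_square)
    then show "ennreal ((\<integral>x. (trig \<alpha> N (x + h) - trig \<alpha> N x)\<^sup>2 \<partial>per) / h\<^sup>2)
        = (\<Sum>n\<le>N. ennreal ((\<alpha> n)\<^sup>2 * E n) * ennreal (lam n h / h\<^sup>2))"
      by (simp add: lam_nonneg E_nonneg ennreal_mult[symmetric])
  qed
  also have "\<dots> = (\<Sum>n\<le>N. ennreal ((\<alpha> n)\<^sup>2 * E n) * (\<integral>\<^sup>+h. ennreal (lam n h / h\<^sup>2) \<partial>per))"
    unfolding lam_def by (subst nn_integral_sum) (auto simp: nn_integral_cmult)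
  also have "\<dots> \<le> (\<Sum>n\<le>N. ennreal ((\<alpha> n)\<^sup>2 * E n) * ennreal (4 * pi\<^sup>2 * real n))"
    unfolding lam_def by (intro sum_mono mult_left_mono cos_kernel_upper) auto
  also have "\<dots> = (\<Sum>n\<le>N. ennreal (4 * pi\<^sup>2 * (real n * ((\<alpha> n)\<^sup>2 * E n))))"
    by (intro sum.cong refl) (simp add: ennreal_mult[symmetric] E_nonneg mult_ac)
  also have "\<dots> = ennreal (4 * pi\<^sup>2 * (\<Sum>n\<le>N. real n * ((\<alpha> n)\<^sup>2 * E n)))"
    by (simp add: E_nonneg sum_distrib_left)
  finally show ?thesis .
qed

text \<open>The duality of H^{1/2} and H^{-1/2} in Fourier terms: Cauchy-Schwarz with the weights
  \<open>1 + n\<close> and \<open>1 / (1 + n)\<close>. Bessel's inequality for \<open>f\<close>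
  accounts for the summand 1 of the weight, the one for its differences for the summand
  \<open>n\<close>.\<close>

lemma trig_duality:
  assumes f: "f \<in> L2 per" "\<And>x. f (x + 2) = f x" and fin: "circ_slobodeckij f < \<infinity>"
  shows "(\<integral>x. f x * trig \<alpha> N x \<partial>per)\<^sup>2
    \<le> (\<Sum>n\<le>N. (\<alpha> n)\<^sup>2 * E n / (1 + real n)) * ((\<integral>x. (f x)\<^sup>2 \<partial>per) + enn2real (circ_slobodeckij f))"
proof -
  define p where "p n = (\<integral>x. f x * e n x \<partial>per)" for n
  define u where "u n = \<alpha> n * sqrt (E n / (1 + real n))" for n
  define v where "v n = p n * sqrt ((1 + real n) / E n)" for n
  \<comment> \<open>For \<open>E n = 0\<close> the factor \<open>v n\<close> is 0 by division by
    zero, and \<open>p n\<close> is 0 by \<open>coefficient_zero\<close>; otherwise the square roots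
    cancel.\<close>
  have "\<alpha> n * p n = u n * v n" for n
  proof (cases "E n = 0")
    case True
    then show ?thesis using coefficient_zero[OF f(1)] by (simp add: p_def v_def)
  next
    case False
    then have "sqrt (E n / (1 + real n)) * sqrt ((1 + real n) / E n) = 1"
      by (simp flip: real_sqrt_mult)
    then show ?thesis by (simp add: u_def v_def mult_ac)
  qed
  then have "(\<integral>x. f x * trig \<alpha> N x \<partial>per)\<^sup>2 = (\<Sum>n\<le>N. u n * v n)\<^sup>2"
    by (simp add: integral_mult_trig[OF f(1)] p_def)
  also have "\<dots> \<le> (\<Sum>n\<le>N. (u n)\<^sup>2) * (\<Sum>n\<le>N. (v n)\<^sup>2)"
    by (rule Cauchy_Schwarz_ineq_sum)
  also have "(\<Sum>n\<le>N. (u n)\<^sup>2) = (\<Sum>n\<le>N. (\<alpha> n)\<^sup>2 * E n / (1 + real n))"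
    by (simp add: u_def power_mult_distrib E_nonneg)
  also have "(\<Sum>n\<le>N. (v n)\<^sup>2) = (\<Sum>n\<le>N. q f n) + (\<Sum>n\<le>N. real n * q f n)"
    unfolding sum.distrib[symmetric]
    by (intro sum.cong) (auto simp: v_def q_def p_def power_mult_distrib E_nonneg algebra_simps add_divide_distrib)
  also have "(\<Sum>n\<le>N. (\<alpha> n)\<^sup>2 * E n / (1 + real n)) * ((\<Sum>n\<le>N. q f n) + (\<Sum>n\<le>N. real n * q f n))
    \<le> (\<Sum>n\<le>N. (\<alpha> n)\<^sup>2 * E n / (1 + real n)) * ((\<integral>x. (f x)\<^sup>2 \<partial>per) + enn2real (circ_slobodeckij f))"
  proof (intro mult_left_mono add_mono bessel f(1))
    show "(\<Sum>n\<le>N. real n * q f n) \<le> enn2real (circ_slobodeckij f)"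
      using enn2real_mono[OF bessel_circ_slobodeckij[OF f, of N]] fin q_nonneg by (simp add: sum_nonneg)
  qed (auto intro!: sum_nonneg simp: E_nonneg)
  finally show ?thesis .
qed

end

section \<open>The interface as a regular periodic curve and uniqueness of traces\<close>

lemma periodic_int:
  fixes f :: "real \<Rightarrow> 'b"
  assumes "\<And>x. f (x + 2) = f x"
  shows "f (x + 2 * real_of_int k) = f x"
proof (induction k rule: int_induct[where k = 0])
  case (step1 i)
  then show ?case using assms[of "x + 2 * real_of_int i"] by (simp add: algebra_simps)
next
  case (step2 i)
  then show ?case using assms[of "x + 2 * real_of_int (i - 1)"] by (simp add: algebra_simps)
qed simp

lemma period_representative:
  fixes x :: real
  obtains k :: int where "x + 2 * real_of_int k \<in> {-1..<1}"
proof (rule that[of "- \<lfloor>(x + 1) / 2\<rfloor>"])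
  have "real_of_int \<lfloor>(x + 1) / 2\<rfloor> \<le> (x + 1) / 2" "(x + 1) / 2 < real_of_int \<lfloor>(x + 1) / 2\<rfloor> + 1"
    by (rule of_int_floor_le, rule real_of_int_floor_add_one_gt)
  then show "x + 2 * real_of_int (- \<lfloor>(x + 1) / 2\<rfloor>) \<in> {-1..<1}" by (auto simp: field_simps)
qed

lemma periodic_bounded:
  fixes f :: "real \<Rightarrow> real"
  assumes "\<And>x. f (x + 2) = f x" "continuous_on UNIV f"
  obtains B where "0 < B" "\<And>x. f x \<le> B"
proof -
  have "bounded (f ` {-1..1})"
    by (intro compact_imp_bounded compact_continuous_image continuous_on_subset[OF assms(2)]) auto
  then obtain B where B: "0 < B" "\<And>x. x \<in> {-1..1} \<Longrightarrow> \<bar>f x\<bar> \<le> B" by (auto simp: bounded_pos)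
  have "f x \<le> B" for x
  proof -
    obtain k where "x + 2 * real_of_int k \<in> {-1..<1}" by (rule period_representative)
    then show ?thesis using B(2)[of "x + 2 * real_of_int k"] periodic_int[of f x k] assms(1) by auto
  qed
  then show ?thesis using that B(1) by blast
qed

lemma periodic_vector_derivative:
  assumes "\<And>x. f (x + 2) = f x" "\<And>x. (f has_vector_derivative f' x) (at x)"
  shows "f' (x + 2) = f' (x :: real)"
proof -
  have "((\<lambda>x. x + 2) has_vector_derivative 1) (at x)" by (auto intro!: derivative_eq_intros)
  from vector_diff_chain_at[OF this assms(2)]
  have "(f has_vector_derivative f' (x + 2)) (at x)" using assms(1) by (simp add: o_def)
  then show ?thesis using assms(2) vector_derivative_unique_at by blast
qed

lemma vector_derivative_norm_bound:
  fixes f :: "real \<Rightarrow> 'b::real_normed_vector"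
  assumes "convex S" "\<And>x. x \<in> S \<Longrightarrow> (f has_vector_derivative f' x) (at x)"
    and "\<And>x. x \<in> S \<Longrightarrow> norm (f' x) \<le> B" "x \<in> S" "y \<in> S"
  shows "norm (f x - f y) \<le> B * \<bar>x - y\<bar>"
  unfolding real_norm_def[symmetric]
proof (rule differentiable_bound[OF assms(1) _ _ assms(4,5)])
  show "(f has_derivative (\<lambda>h. h *\<^sub>R f' u)) (at u within S)" if "u \<in> S" for u
    using assms(2)[OF that] unfolding has_vector_derivative_def by (rule has_derivative_at_withinI)
  show "onorm (\<lambda>h. h *\<^sub>R f' u) \<le> B" if "u \<in> S" for u
  proof (rule onorm_bound)
    have "0 \<le> norm (f' u)" by simp
    then show "0 \<le> B" using assms(3)[OF that] by linarith
    show "norm (h *\<^sub>R f' u) \<le> B * norm h" for h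
      using mult_right_mono[OF assms(3)[OF that], of "norm h"] by (simp add: mult.commute)
  qed
qed

context machine
begin

definition \<gamma>' :: "real \<Rightarrow> plane" where "\<gamma>' \<xi> = D (\<xi>, c) (1, 0)"

definition \<gamma>'' :: "real \<Rightarrow> plane" where
  "\<gamma>'' \<xi> = frechet_derivative (\<lambda>x. D x (1, 0)) (at (\<xi>, c)) (1, 0)"

definition J' :: "real \<Rightarrow> real" where "J' \<xi> = (\<gamma>' \<xi> \<bullet> \<gamma>'' \<xi>) / J \<xi>"

lemma on_interface: "(\<xi>, c) \<in> UNIV \<times> {a..b}"
  using ac cb by auto

lemma J_norm: "J \<xi> = norm (\<gamma>' \<xi>)"
  by (simp add: J_def \<gamma>'_def)

lemma \<gamma>_vd: "(\<gamma> has_vector_derivative \<gamma>' \<xi>) (at \<xi>)"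
  using \<gamma>_derivative by (simp add: \<gamma>'_def)

lemma \<gamma>'_vd: "(\<gamma>' has_vector_derivative \<gamma>'' \<xi>) (at \<xi>)"
proof -
  let ?L = "frechet_derivative (\<lambda>x. D x (1, 0)) (at (\<xi>, c))"
  have 1: "((\<lambda>x. D x (1, 0)) has_derivative ?L) (at (\<xi>, c))"
    by (rule F_derivs(2)[OF on_interface Basis_plane(1)])
  have "((\<lambda>\<xi>. D (\<xi>, c) (1, 0)) has_derivative (\<lambda>h. ?L (h, 0))) (at \<xi>)"
    by (rule has_derivative_compose[where f = "\<lambda>\<xi>. (\<xi>, c)" and g = "\<lambda>x. D x (1, 0)", OF _ 1])
      (auto intro!: derivative_eq_intros)
  moreover have "?L (h, 0) = h *\<^sub>R ?L (1, 0)" for h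
    using linear_cmul[OF has_derivative_linear[OF 1], of h "(1, 0)"] by simp
  then have "(\<lambda>h. ?L (h, 0)) = (\<lambda>h. h *\<^sub>R ?L (1, 0))" by (intro ext)
  ultimately show ?thesis by (simp add: has_vector_derivative_def \<gamma>'_def[abs_def] \<gamma>''_def)
qed

lemma \<gamma>'_cont: "continuous_on S \<gamma>'"
  by (intro continuous_at_imp_continuous_on ballI has_vector_derivative_continuous[OF \<gamma>'_vd])

lemma \<gamma>''_cont: "continuous_on UNIV \<gamma>''"
proof -
  have "continuous_on UNIV ((\<lambda>x. frechet_derivative (\<lambda>x. D x (1, 0)) (at x) (1, 0)) \<circ> (\<lambda>\<xi>. (\<xi>, c)))"
    using ac cb by (intro continuous_on_compose continuous_intros continuous_on_subset[OF D2_cont] Basis_plane) auto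
  then show ?thesis by (simp add: \<gamma>''_def[abs_def] o_def)
qed

lemma \<gamma>'_periodic: "\<gamma>' (\<xi> + 2) = \<gamma>' \<xi>"
  by (rule periodic_vector_derivative[OF \<gamma>_periodic \<gamma>_vd])

lemma \<gamma>''_periodic: "\<gamma>'' (\<xi> + 2) = \<gamma>'' \<xi>"
  by (rule periodic_vector_derivative[OF \<gamma>'_periodic \<gamma>'_vd])

lemma J_periodic: "J (\<xi> + 2) = J \<xi>"
  by (simp add: J_norm \<gamma>'_periodic)

lemma J_has_derivative: "(J has_real_derivative J' \<xi>) (at \<xi>)"
proof -
  have 1: "(\<gamma>' has_derivative (\<lambda>h. h *\<^sub>R \<gamma>'' \<xi>)) (at \<xi>)"
    using \<gamma>'_vd by (simp add: has_vector_derivative_def)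
  have pos: "0 < \<gamma>' \<xi> \<bullet> \<gamma>' \<xi>" using J_pos[of \<xi>] by (simp add: J_norm)
  have "((\<lambda>\<xi>. \<gamma>' \<xi> \<bullet> \<gamma>' \<xi>) has_derivative (\<lambda>h. \<gamma>' \<xi> \<bullet> (h *\<^sub>R \<gamma>'' \<xi>) + (h *\<^sub>R \<gamma>'' \<xi>) \<bullet> \<gamma>' \<xi>)) (at \<xi>)"
    by (rule has_derivative_inner[OF 1 1])
  also have "(\<lambda>h. \<gamma>' \<xi> \<bullet> (h *\<^sub>R \<gamma>'' \<xi>) + (h *\<^sub>R \<gamma>'' \<xi>) \<bullet> \<gamma>' \<xi>) = (*) (2 * (\<gamma>' \<xi> \<bullet> \<gamma>'' \<xi>))"
    by (auto simp: inner_commute algebra_simps)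
  finally have 2: "((\<lambda>\<xi>. \<gamma>' \<xi> \<bullet> \<gamma>' \<xi>) has_real_derivative 2 * (\<gamma>' \<xi> \<bullet> \<gamma>'' \<xi>)) (at \<xi>)"
    by (simp add: has_field_derivative_def)
  have "((\<lambda>\<xi>. sqrt (\<gamma>' \<xi> \<bullet> \<gamma>' \<xi>)) has_real_derivative J' \<xi>) (at \<xi>)"
    using DERIV_chain'[OF 2 DERIV_real_sqrt[OF pos]]
    by (simp add: J'_def J_norm norm_eq_sqrt_inner field_simps)
  then show ?thesis by (simp add: J_norm[abs_def] norm_eq_sqrt_inner)
qed

lemma J'_cont: "continuous_on S J'"
proof -
  have "continuous_on UNIV J'"
    unfolding J'_def by (intro continuous_intros \<gamma>'_cont \<gamma>''_cont J_cont) (use J_pos in \<open>auto simp: less_imp_neq[symmetric]\<close>)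
  then show ?thesis by (rule continuous_on_subset) simp
qed

lemma J'_periodic: "J' (\<xi> + 2) = J' \<xi>"
  by (simp add: J'_def J_periodic \<gamma>'_periodic \<gamma>''_periodic)

text \<open>A step of at most half a period, moved so that it starts in \<open>{-1..<1}\<close>,
  ends in the same interval up to one shift by 2, and there \<open>\<gamma>\<close> is
  injective.\<close>

lemma \<gamma>_locally_injective:
  assumes "0 < \<bar>h\<bar>" "\<bar>h\<bar> \<le> 1"
  shows "\<gamma> (x + h) \<noteq> \<gamma> x"
proof
  assume eq: "\<gamma> (x + h) = \<gamma> x"
  obtain k where k: "x + 2 * real_of_int k \<in> {-1..<1}" by (rule period_representative)
  define y where "y = x + 2 * real_of_int k"
  have y: "y \<in> {-1..<1}" using k by (simp add: y_def)
  have "\<gamma> (x + h + 2 * real_of_int k) = \<gamma> (x + 2 * real_of_int k)"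
    using eq by (simp add: periodic_int[of \<gamma>, OF \<gamma>_periodic])
  then have eq: "\<gamma> (y + h) = \<gamma> y" by (simp add: y_def algebra_simps)
  have per: "\<gamma> (y + h - 2) = \<gamma> (y + h)" "\<gamma> (y + h + 2) = \<gamma> (y + h)"
    using \<gamma>_periodic[of "y + h - 2"] \<gamma>_periodic[of "y + h"] by auto
  consider "y + h \<in> {-1..<1}" | "y + h - 2 \<in> {-1..<1}" | "y + h + 2 \<in> {-1..<1}"
    using y assms by (auto simp: abs_if split: if_splits) linarith+
  then show False
  proof cases
    case 1
    then show ?thesis using inj_onD[OF \<gamma>_inj eq] y assms by auto
  next
    case 2
    then show ?thesis using inj_onD[OF \<gamma>_inj, of "y + h - 2" y] eq per y assms by auto
  next
    case 3
    then show ?thesis using inj_onD[OF \<gamma>_inj, of "y + h + 2" y] eq per y assms by auto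
  qed
qed

text \<open>The chord-arc bound of a regular simple closed curve. For small steps the derivative
  dominates the second-order remainder; for the remaining steps the distance has a positive minimum
  by compactness and \<open>\<gamma>_locally_injective\<close>.\<close>

lemma \<gamma>_dist_lower:
  obtains d where "0 < d" "\<And>x h. \<bar>h\<bar> \<le> 1 \<Longrightarrow> d * \<bar>h\<bar> \<le> dist (\<gamma> x) (\<gamma> (x + h))"
proof -
  obtain B where B: "0 < B" "\<And>x. norm (\<gamma>'' x) \<le> B"
    by (rule periodic_bounded[of "\<lambda>x. norm (\<gamma>'' x)"])
      (auto intro!: continuous_intros \<gamma>''_cont simp: \<gamma>''_periodic)
  have ne: "1 / J x \<noteq> 0" for x using J_pos[of x] by simp
  obtain j where j: "0 < j" "\<And>x. 1 / J x \<le> j"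
    by (rule periodic_bounded[of "\<lambda>x. 1 / J x"])
      (use J_pos in \<open>auto intro!: continuous_intros J_cont simp: J_periodic less_imp_neq[symmetric]\<close>)
  have Jj: "1 / j \<le> J x" for x using j J_pos[of x] by (simp add: field_simps) (metis j(2) mult.commute pos_divide_le_eq)
  \<comment> \<open>Chosen so that the remainder \<open>B * h\<^sup>2\<close> is at most half of the
    lower bound \<open>\<bar>h\<bar> / j\<close> of the linear term.\<close>
  define \<delta> where "\<delta> = min 1 (1 / (2 * j * B))"
  have \<delta>: "0 < \<delta>" "\<delta> \<le> 1" "B * \<delta> \<le> 1 / (2 * j)" using B(1) j(1) by (auto simp: \<delta>_def min_def field_simps)
  have small: "1 / (2 * j) * \<bar>h\<bar> \<le> dist (\<gamma> x) (\<gamma> (x + h))" if h: "\<bar>h\<bar> \<le> \<delta>" for x h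
  proof -
    have "norm ((\<gamma> (x + h) - h *\<^sub>R \<gamma>' x) - (\<gamma> (x + 0) - 0 *\<^sub>R \<gamma>' x)) \<le> (B * \<bar>h\<bar>) * \<bar>h - 0\<bar>"
    proof (rule vector_derivative_norm_bound[where S = "{-\<bar>h\<bar>..\<bar>h\<bar>}"])
      fix s assume s: "s \<in> {-\<bar>h\<bar>..\<bar>h\<bar>}"
      have "((\<lambda>s. x + s) has_vector_derivative 1) (at s)" by (auto intro!: derivative_eq_intros)
      from vector_diff_chain_at[OF this \<gamma>_vd]
      have "((\<lambda>s. \<gamma> (x + s)) has_vector_derivative \<gamma>' (x + s)) (at s)" by (simp add: o_def)
      then show "((\<lambda>s. \<gamma> (x + s) - s *\<^sub>R \<gamma>' x) has_vector_derivative (\<gamma>' (x + s) - \<gamma>' x)) (at s)"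
        by (auto intro!: derivative_eq_intros)
      have "norm (\<gamma>' (x + s) - \<gamma>' x) \<le> B * \<bar>x + s - x\<bar>"
        by (rule vector_derivative_norm_bound[where S = UNIV and f' = \<gamma>'']) (auto simp: \<gamma>'_vd B(2))
      also have "\<dots> \<le> B * \<bar>h\<bar>" using B(1) s by (intro mult_left_mono) auto
      finally show "norm (\<gamma>' (x + s) - \<gamma>' x) \<le> B * \<bar>h\<bar>" .
    qed auto
    also have "\<dots> \<le> 1 / (2 * j) * \<bar>h\<bar>"
    proof -
      have "B * \<bar>h\<bar> \<le> B * \<delta>" using h B(1) by simp
      then have "B * \<bar>h\<bar> \<le> 1 / (2 * j)" using \<delta>(3) by linarith
      from mult_right_mono[OF this abs_ge_zero[of h]] show ?thesis by simp
    qed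
    finally have "norm (\<gamma> (x + h) - \<gamma> x - h *\<^sub>R \<gamma>' x) \<le> 1 / (2 * j) * \<bar>h\<bar>" by (simp add: algebra_simps)
    moreover have "norm (h *\<^sub>R \<gamma>' x) \<le> norm (\<gamma> (x + h) - \<gamma> x) + norm (\<gamma> (x + h) - \<gamma> x - h *\<^sub>R \<gamma>' x)"
      using norm_triangle_ineq4[of "\<gamma> (x + h) - \<gamma> x" "\<gamma> (x + h) - \<gamma> x - h *\<^sub>R \<gamma>' x"] by simp
    moreover have "\<bar>h\<bar> * (1 / j) \<le> norm (h *\<^sub>R \<gamma>' x)"
      using mult_left_mono[OF Jj[of x], of "\<bar>h\<bar>"] by (simp add: J_norm)
    ultimately have "\<bar>h\<bar> * (1 / j) - 1 / (2 * j) * \<bar>h\<bar> \<le> norm (\<gamma> (x + h) - \<gamma> x)" by linarith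
    moreover have "\<bar>h\<bar> * (1 / j) - 1 / (2 * j) * \<bar>h\<bar> = 1 / (2 * j) * \<bar>h\<bar>" using j(1) by (simp add: field_simps)
    ultimately show ?thesis by (simp add: dist_norm norm_minus_commute)
  qed
  let ?S = "{-1..1} \<times> ({-1..-\<delta>} \<union> {\<delta>..1}) :: (real \<times> real) set"
  have cS: "compact ?S" by (intro compact_Times compact_Un) auto
  have neS: "?S \<noteq> {}" using \<delta> by auto
  have "continuous_on ?S (\<lambda>p. dist (\<gamma> (fst p)) (\<gamma> (fst p + snd p)))"
    by (intro continuous_intros continuous_on_compose2[OF \<gamma>_cont[of UNIV]]) auto
  then obtain p where p: "p \<in> ?S"
    "\<And>y. y \<in> ?S \<Longrightarrow> dist (\<gamma> (fst p)) (\<gamma> (fst p + snd p)) \<le> dist (\<gamma> (fst y)) (\<gamma> (fst y + snd y))"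
    using continuous_attains_inf[OF cS neS] by blast
  define m where "m = dist (\<gamma> (fst p)) (\<gamma> (fst p + snd p))"
  have m: "0 < m" unfolding m_def using \<gamma>_locally_injective[of "snd p" "fst p"] p(1) \<delta> by auto
  have large: "m * \<bar>h\<bar> \<le> dist (\<gamma> x) (\<gamma> (x + h))" if h: "\<delta> \<le> \<bar>h\<bar>" "\<bar>h\<bar> \<le> 1" for x h
  proof -
    obtain k where k: "x + 2 * real_of_int k \<in> {-1..<1}" by (rule period_representative)
    have "h \<in> {-1..-\<delta>} \<union> {\<delta>..1}" using h by (auto simp: abs_if split: if_splits)
    then have "m \<le> dist (\<gamma> (x + 2 * real_of_int k)) (\<gamma> (x + 2 * real_of_int k + h))"
      using p(2)[of "(x + 2 * real_of_int k, h)"] k by (auto simp: m_def)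
    also have "\<gamma> (x + 2 * real_of_int k) = \<gamma> x" by (rule periodic_int[of \<gamma>, OF \<gamma>_periodic])
    also have "x + 2 * real_of_int k + h = x + h + 2 * real_of_int k" by simp
    also have "\<gamma> (x + h + 2 * real_of_int k) = \<gamma> (x + h)" by (rule periodic_int[of \<gamma>, OF \<gamma>_periodic])
    finally have "m * 1 \<le> dist (\<gamma> x) (\<gamma> (x + h))" by simp
    moreover have "m * \<bar>h\<bar> \<le> m * 1" using h m by (intro mult_left_mono) auto
    ultimately show ?thesis by linarith
  qed
  show ?thesis
  proof (rule that[of "min m (1 / (2 * j))"])
    show "0 < min m (1 / (2 * j))" using m j by simp
    fix x h :: real assume h: "\<bar>h\<bar> \<le> 1"
    have "min m (1 / (2 * j)) * \<bar>h\<bar> \<le> m * \<bar>h\<bar>" "min m (1 / (2 * j)) * \<bar>h\<bar> \<le> 1 / (2 * j) * \<bar>h\<bar>"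
      by (intro mult_right_mono; simp)+
    then show "min m (1 / (2 * j)) * \<bar>h\<bar> \<le> dist (\<gamma> x) (\<gamma> (x + h))"
      using small[of h x] large[of h x] h by linarith
  qed
qed

section \<open>Square-integrability on the interface and uniqueness of traces\<close>

lemma M_continuous_L2:
  assumes "g \<in> borel_measurable M" "continuous_on UNIV (\<lambda>t. g (\<gamma> t))"
  shows "g \<in> L2 M"
proof -
  have m: "(\<lambda>x. (g x)\<^sup>2) \<in> borel_measurable M" using assms(1) by simp
  have "continuous_on UNIV (\<lambda>t. J t * (g (\<gamma> t))\<^sup>2)" by (intro continuous_intros J_cont assms)
  then have "integrable (lebesgue_on {-1..<1}) (\<lambda>t. J t * (g (\<gamma> t))\<^sup>2)"
    by (intro lebesgue_on_period_eq_integral(1)) (rule continuous_on_subset, auto)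
  then show ?thesis using M_integral(1)[OF m] assms(1) by (simp add: L2_def)
qed

lemma continuous_L2_M:
  assumes "continuous_on UNIV f"
  shows "f \<in> L2 M"
proof (rule M_continuous_L2)
  show "f \<in> borel_measurable M"
    unfolding borel_measurable_M_iff by (intro measurable_restrict_space1 borel_measurable_continuous_onI assms)
  show "continuous_on UNIV (\<lambda>t. f (\<gamma> t))"
    by (intro continuous_on_compose2[OF assms] \<gamma>_cont) auto
qed

lemma \<Omega>_props:
  "\<Omega>1 = F ` ({-1..<1} \<times> {c<..<b})" "\<Omega>2 = F ` ({-1..<1} \<times> {a<..<c})"
  "open \<Omega>1" "bounded \<Omega>1" "open \<Omega>2" "bounded \<Omega>2"
  using geometry by (auto simp: machine_geometry_def)

text \<open>Two sequences of C^1 functions that approximate the same \<open>v\<close> differ by a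
  null sequence in H^1, hence, by the trace inequality, in L^2 of the interface. This gives meaning
  to \<open>bd_trace\<close>, which is a choice.\<close>

lemma trace_unique:
  assumes \<Omega>: "\<Omega> = \<Omega>1 \<or> \<Omega> = \<Omega>2" and tr: "has_trace \<Omega> M v g" "has_trace \<Omega> M v g'"
  shows "AE x in M. g x = g' x"
proof -
  obtain C where C: "0 < C"
    "\<And>lo hi \<Omega> \<phi>. \<lbrakk>(lo, hi) = (c, b) \<or> (lo, hi) = (a, c); \<Omega> = F ` ({-1..<1} \<times> {lo<..<hi}); open \<Omega>; bounded \<Omega>;
      Ck 1 UNIV \<phi>\<rbrakk> \<Longrightarrow> (\<integral>x. (\<phi> x)\<^sup>2 \<partial>M) \<le> C * (H1_norm \<Omega> \<phi>)\<^sup>2"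
    by (rule trace_inequality) (rule that)
  have ob: "open \<Omega>" "bounded \<Omega>" using \<Omega> \<Omega>_props by auto
  have C': "(\<integral>x. (\<phi> x)\<^sup>2 \<partial>M) \<le> C * (H1_norm \<Omega> \<phi>)\<^sup>2" if "Ck 1 UNIV \<phi>" for \<phi>
    using \<Omega> C(2)[of c b \<Omega>1 \<phi>] C(2)[of a c \<Omega>2 \<phi>] \<Omega>_props that by metis
  obtain \<phi> where \<phi>: "\<And>n. Ck 1 UNIV (\<phi> n)" "(\<lambda>n. H1_norm \<Omega> (\<lambda>x. \<phi> n x - v x)) \<longlonglongrightarrow> 0"
    "(\<lambda>n. \<integral>x. (\<phi> n x - g x)\<^sup>2 \<partial>M) \<longlonglongrightarrow> 0"
    using tr(1) unfolding has_trace_def by blast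
  obtain \<psi> where \<psi>: "\<And>n. Ck 1 UNIV (\<psi> n)" "(\<lambda>n. H1_norm \<Omega> (\<lambda>x. \<psi> n x - v x)) \<longlonglongrightarrow> 0"
    "(\<lambda>n. \<integral>x. (\<psi> n x - g' x)\<^sup>2 \<partial>M) \<longlonglongrightarrow> 0"
    using tr(2) unfolding has_trace_def by blast
  have v: "v \<in> H1 \<Omega>" and g: "g \<in> L2 M" "g' \<in> L2 M" using tr by (auto simp: has_trace_def)
  note h1 = C1_H1(1)[OF \<phi>(1) ob] C1_H1(1)[OF \<psi>(1) ob]
  note l2 = continuous_L2_M[OF C1_D(2)[OF \<phi>(1)]] continuous_L2_M[OF C1_D(2)[OF \<psi>(1)]]
  let ?I = "\<integral>x. (g x - g' x)\<^sup>2 \<partial>M"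
  let ?R = "\<lambda>n. 2 * (2 * (C * (2 * (H1_norm \<Omega> (\<lambda>x. \<phi> n x - v x))\<^sup>2 + 2 * (H1_norm \<Omega> (\<lambda>x. \<psi> n x - v x))\<^sup>2))
      + 2 * (\<integral>x. (\<psi> n x - g' x)\<^sup>2 \<partial>M)) + 2 * (\<integral>x. (\<phi> n x - g x)\<^sup>2 \<partial>M)"
  have bound: "?I \<le> ?R n" for n
  proof -
    have "(\<integral>x. (\<phi> n x - \<psi> n x)\<^sup>2 \<partial>M) \<le> C * (H1_norm \<Omega> (\<lambda>x. \<phi> n x - \<psi> n x))\<^sup>2"
      using Ck_add[OF \<phi>(1)[of n] Ck_mult[OF Ck_const[of 1 "-1"] \<psi>(1)[of n]]] by (intro C') (simp del: Ck.simps One_nat_def)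
    also have "(H1_norm \<Omega> (\<lambda>x. \<phi> n x - \<psi> n x))\<^sup>2
        \<le> 2 * (H1_norm \<Omega> (\<lambda>x. \<phi> n x - v x))\<^sup>2 + 2 * (H1_norm \<Omega> (\<lambda>x. \<psi> n x - v x))\<^sup>2"
      using H1_diff(2)[OF ob(1) H1_diff(1)[OF ob(1) h1(1) v] H1_diff(1)[OF ob(1) h1(2) v], of n n] by simp
    finally have 1: "(\<integral>x. (\<phi> n x - \<psi> n x)\<^sup>2 \<partial>M)
        \<le> C * (2 * (H1_norm \<Omega> (\<lambda>x. \<phi> n x - v x))\<^sup>2 + 2 * (H1_norm \<Omega> (\<lambda>x. \<psi> n x - v x))\<^sup>2)"
      using C(1) by simp
    have 2: "(\<integral>x. (\<phi> n x - g' x)\<^sup>2 \<partial>M) \<le> 2 * (\<integral>x. (\<phi> n x - \<psi> n x)\<^sup>2 \<partial>M) + 2 * (\<integral>x. (\<psi> n x - g' x)\<^sup>2 \<partial>M)"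
      using integral_power2_diff_le[OF L2_diff[OF l2(1,2)] L2_diff[OF g(2) l2(2)], of n n n]
      by (simp add: power2_commute[of "g' _"])
    have 3: "?I \<le> 2 * (\<integral>x. (\<phi> n x - g' x)\<^sup>2 \<partial>M) + 2 * (\<integral>x. (\<phi> n x - g x)\<^sup>2 \<partial>M)"
      using integral_power2_diff_le[OF L2_diff[OF l2(1) g(2)] L2_diff[OF l2(1) g(1)], of n n] by simp
    have "r \<le> 2 * (2 * u + 2 * w) + 2 * z" if "p \<le> u" "q \<le> 2 * p + 2 * w" "r \<le> 2 * q + 2 * z"
      for p q r u w z :: real using that by (simp add: algebra_simps)
    from this[OF 1 2 3] show ?thesis .
  qed
  have "?R \<longlonglongrightarrow> 2 * (2 * (C * (2 * 0\<^sup>2 + 2 * 0\<^sup>2)) + 2 * 0) + 2 * 0"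
    by (intro tendsto_intros \<phi> \<psi>)
  then have "?I \<le> 0" using LIMSEQ_le_const[of ?R _ ?I] bound by fastforce
  then have "?I = 0" by (simp add: antisym)
  then have "AE x in M. (g x - g' x)\<^sup>2 = 0"
    using integral_nonneg_eq_0_iff_AE[OF L2_D(2)[OF L2_diff[OF g]]] by simp
  then show ?thesis by eventually_elim simp
qed

lemma bd_trace_AE:
  assumes "\<Omega> = \<Omega>1 \<or> \<Omega> = \<Omega>2" "has_trace \<Omega> M v g"
  shows "has_trace \<Omega> M v (bd_trace \<Omega> M v)" "AE x in M. bd_trace \<Omega> M v x = g x"
proof -
  show "has_trace \<Omega> M v (bd_trace \<Omega> M v)"
    unfolding bd_trace_def by (rule someI[of "has_trace \<Omega> M v", OF assms(2)])
  then show "AE x in M. bd_trace \<Omega> M v x = g x"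
    by (rule trace_unique[OF assms(1) _ assms(2)])
qed

end

section \<open>$H^{1/2}$ and its dual on the interface\<close>

text \<open>A single constant \<open>C\<close> absorbs all bounds on the geometry, so that the constants below are
  visibly independent of the multiplier and of the discretisation.\<close>

locale machine_bounds = machine +
  fixes C :: real
  assumes C_ge_1: "1 \<le> C"
    and J_le: "J \<xi> \<le> C" and J_ge: "1 \<le> C * J \<xi>"
    and J'_le: "\<bar>J' \<xi>\<bar> \<le> C" and K'_le: "\<bar>J' \<xi> / (J \<xi>)\<^sup>2\<bar> \<le> C"
    and \<gamma>_lip: "dist (\<gamma> x) (\<gamma> (x + h)) \<le> C * \<bar>h\<bar>"
    and \<gamma>_low: "\<bar>h\<bar> \<le> 1 \<Longrightarrow> \<bar>h\<bar> \<le> C * dist (\<gamma> x) (\<gamma> (x + h))"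
    and det_ge: "p \<in> {-1..1} \<times> {a..b} \<Longrightarrow> 1 \<le> C * \<bar>det_plane (D p)\<bar>"
    and D1_le: "p \<in> {-1..1} \<times> {a..b} \<Longrightarrow> norm (D p (1, 0)) \<le> C"
    and D2_le: "p \<in> {-1..1} \<times> {a..b} \<Longrightarrow> norm (D p (0, 1)) \<le> C"
    and area_le: "\<lbrakk>continuous_on UNIV \<psi>; \<And>x. 0 \<le> \<psi> x\<rbrakk> \<Longrightarrow>
      (\<integral>x. \<psi> x \<partial>lebesgue_on \<Omega>1) \<le> C * integral (cbox (-1, c) (1, b)) (\<lambda>x. \<psi> (F x))"

lemma (in machine) machine_bounds_exist:
  obtains C where "machine_bounds F a c b \<Omega>1 \<Omega>2 \<Gamma> \<Sigma>1 \<Sigma>2 C"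
proof -
  obtain B1 d where B1: "0 < d"
    "\<And>x. x \<in> {-1..1} \<times> {a..b} \<Longrightarrow> d \<le> \<bar>det_plane (D x)\<bar>"
    "\<And>x. x \<in> {-1..1} \<times> {a..b} \<Longrightarrow> norm (D x (1, 0)) \<le> B1"
    "\<And>x. x \<in> {-1..1} \<times> {a..b} \<Longrightarrow> norm (D x (0, 1)) \<le> B1"
    by (rule D_bounds) (rule that)
  obtain B2 d2 :: real where B2: "0 < d2"
    "\<And>lo hi \<Omega> \<psi>. \<lbrakk>a \<le> lo; lo < hi; hi \<le> b; \<Omega> = F ` ({-1..<1} \<times> {lo<..<hi}); open \<Omega>; bounded \<Omega>;
      continuous_on UNIV \<psi>; \<And>x. 0 \<le> \<psi> x\<rbrakk> \<Longrightarrow>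
      (\<integral>x. \<psi> x \<partial>lebesgue_on \<Omega>) \<le> B2 * integral (cbox (-1, lo) (1, hi)) (\<lambda>x. \<psi> (F x)) \<and>
      d2 * integral (cbox (-1, lo) (1, hi)) (\<lambda>x. \<psi> (F x)) \<le> (\<integral>x. \<psi> x \<partial>lebesgue_on \<Omega>)"
    by (rule integral_F_region_bounds) blast
  have Jne: "J x \<noteq> 0" for x using J_pos[of x] by simp
  obtain B3 where B3: "\<And>x. J x \<le> B3" by (rule periodic_bounded[OF J_periodic J_cont]) (rule that)
  obtain B4 where B4: "\<And>x. 1 / J x \<le> B4"
    by (rule periodic_bounded[of "\<lambda>x. 1 / J x"]) (auto intro!: continuous_intros J_cont that simp: J_periodic Jne)
  obtain B5 where B5: "\<And>x. \<bar>J' x\<bar> \<le> B5"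
    by (rule periodic_bounded[of "\<lambda>x. \<bar>J' x\<bar>"]) (auto intro!: continuous_intros J'_cont that simp: J'_periodic)
  obtain B6 where B6: "\<And>x. \<bar>J' x / (J x)\<^sup>2\<bar> \<le> B6"
    by (rule periodic_bounded[of "\<lambda>x. \<bar>J' x / (J x)\<^sup>2\<bar>"])
      (auto intro!: continuous_intros J_cont J'_cont that simp: J'_periodic J_periodic Jne)
  obtain d7 where d7: "0 < d7" "\<And>x h. \<bar>h\<bar> \<le> 1 \<Longrightarrow> d7 * \<bar>h\<bar> \<le> dist (\<gamma> x) (\<gamma> (x + h))"
    by (rule \<gamma>_dist_lower) (rule that)
  define C where "C = Max {1, B1, B2, B3, B4, B5, B6, 1 / d, 1 / d7}"
  have pos: "0 < 1 / d" "0 < 1 / d7" using B1(1) d7(1) by auto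
  have C: "1 \<le> C" "B1 \<le> C" "B2 \<le> C" "B3 \<le> C" "B4 \<le> C" "B5 \<le> C" "B6 \<le> C" "1 / d \<le> C" "1 / d7 \<le> C"
    unfolding C_def by (rule Max_ge; simp)+
  have "machine_bounds F a c b \<Omega>1 \<Omega>2 \<Gamma> \<Sigma>1 \<Sigma>2 C"
  proof (unfold_locales)
    show "1 \<le> C" by (rule C(1))
    show "J \<xi> \<le> C" for \<xi> using B3[of \<xi>] C by linarith
    show "1 \<le> C * J \<xi>" for \<xi>
    proof -
      have "1 / J \<xi> \<le> C" using B4[of \<xi>] C by linarith
      then show ?thesis using J_pos[of \<xi>] by (simp add: pos_divide_le_eq)
    qed
    show "\<bar>J' \<xi>\<bar> \<le> C" "\<bar>J' \<xi> / (J \<xi>)\<^sup>2\<bar> \<le> C" for \<xi> using B5[of \<xi>] B6[of \<xi>] C by linarith+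
    show "dist (\<gamma> x) (\<gamma> (x + h)) \<le> C * \<bar>h\<bar>" for x h
    proof -
      have "norm (\<gamma> x - \<gamma> (x + h)) \<le> C * \<bar>x - (x + h)\<bar>"
      proof (rule vector_derivative_norm_bound[where S = UNIV and f' = \<gamma>'])
        show "norm (\<gamma>' u) \<le> C" for u using B3[of u] C by (simp add: J_norm[symmetric])
      qed (auto simp: \<gamma>_vd)
      then show ?thesis by (simp add: dist_norm)
    qed
    show "\<bar>h\<bar> \<le> C * dist (\<gamma> x) (\<gamma> (x + h))" if "\<bar>h\<bar> \<le> 1" for x h
    proof -
      have "\<bar>h\<bar> = 1 / d7 * (d7 * \<bar>h\<bar>)" using d7(1) by simp
      also have "\<dots> \<le> C * dist (\<gamma> x) (\<gamma> (x + h))"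
        using d7 that pos C by (intro mult_mono) auto
      finally show ?thesis .
    qed
    show "1 \<le> C * \<bar>det_plane (D x)\<bar>" if "x \<in> {-1..1} \<times> {a..b}" for x
    proof -
      have "1 = 1 / d * d" using B1(1) by simp
      also have "\<dots> \<le> C * \<bar>det_plane (D x)\<bar>" using B1(1) B1(2)[OF that] pos C by (intro mult_mono) auto
      finally show ?thesis .
    qed
    show "norm (D x (1, 0)) \<le> C" "norm (D x (0, 1)) \<le> C" if "x \<in> {-1..1} \<times> {a..b}" for x
      using B1(3,4)[OF that] C by linarith+
    fix \<psi> :: "plane \<Rightarrow> real" assume \<psi>: "continuous_on UNIV \<psi>" "\<And>x. 0 \<le> \<psi> x"
    have 1: "(\<integral>x. \<psi> x \<partial>lebesgue_on \<Omega>1) \<le> B2 * integral (cbox (-1, c) (1, b)) (\<lambda>x. \<psi> (F x))"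
      using B2(2)[of c b \<Omega>1 \<psi>] ac cb \<Omega>_props \<psi> by simp
    have "cbox (-1, c) (1, b) \<subseteq> UNIV \<times> {a..b}" using ac by (auto simp: cbox_Pair_eq)
    then have "continuous_on (cbox (-1, c) (1, b)) (\<lambda>x. \<psi> (F x))"
      by (intro continuous_on_compose2[OF \<psi>(1)] continuous_on_subset[OF F_cont]) auto
    then have "0 \<le> integral (cbox (-1, c) (1, b)) (\<lambda>x. \<psi> (F x))"
      by (intro integral_nonneg integrable_continuous \<psi>)
    then have "B2 * integral (cbox (-1, c) (1, b)) (\<lambda>x. \<psi> (F x)) \<le> C * integral (cbox (-1, c) (1, b)) (\<lambda>x. \<psi> (F x))"
      using C by (intro mult_right_mono) auto
    then show "(\<integral>x. \<psi> x \<partial>lebesgue_on \<Omega>1) \<le> C * integral (cbox (-1, c) (1, b)) (\<lambda>x. \<psi> (F x))"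
      using 1 by linarith
  qed
  then show ?thesis by (rule that)
qed

lemma nn_integral_lebesgue_period:
  fixes g :: "real \<Rightarrow> ennreal"
  assumes [measurable]: "g \<in> borel_measurable borel"
  shows "(\<integral>\<^sup>+t. g t \<partial>lebesgue_on {-1..<1}) = (\<integral>\<^sup>+t. g t \<partial>per)"
proof -
  have "(\<integral>\<^sup>+t. g t \<partial>lebesgue_on {-1..<1}) = (\<integral>\<^sup>+t. g t * indicator {-1..<1} t \<partial>lebesgue)"
    by (rule nn_integral_restrict_space) simp
  also have "\<dots> = (\<integral>\<^sup>+t. g t * indicator {-1..<1} t \<partial>lborel)"
    by (rule nn_integral_completion) measurable
  also have "\<dots> = (\<integral>\<^sup>+t. g t \<partial>per)"
    by (simp add: nn_integral_per mult.commute)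
  finally show ?thesis .
qed

lemma integral_lebesgue_period:
  fixes g :: "real \<Rightarrow> real"
  assumes [measurable]: "g \<in> borel_measurable borel"
  shows "integrable (lebesgue_on {-1..<1}) g \<longleftrightarrow> integrable per g"
    and "(\<integral>t. g t \<partial>lebesgue_on {-1..<1}) = (\<integral>t. g t \<partial>per)"
proof -
  have m: "g \<in> borel_measurable (lebesgue_on {-1..<1})"
    by (intro measurable_restrict_space1 measurable_completion) simp
  show 1: "integrable (lebesgue_on {-1..<1}) g \<longleftrightarrow> integrable per g"
    unfolding integrable_iff_bounded using m by (simp add: nn_integral_lebesgue_period)
  show "(\<integral>t. g t \<partial>lebesgue_on {-1..<1}) = (\<integral>t. g t \<partial>per)"
  proof (cases "integrable per g")
    case True
    then show ?thesis using 1 by (simp add: real_lebesgue_integral_def nn_integral_lebesgue_period)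
  next
    case False
    then show ?thesis using 1 by (simp add: not_integrable_integral_eq)
  qed
qed

context machine
begin

section \<open>Interface integrals as integrals over the period\<close>

lemma \<gamma>_in_\<Gamma>: "\<gamma> t \<in> \<Gamma>"
proof -
  obtain k where "t + 2 * real_of_int k \<in> {-1..<1}" by (rule period_representative)
  moreover have "\<gamma> (t + 2 * real_of_int k) = \<gamma> t" by (rule periodic_int[of \<gamma>, OF \<gamma>_periodic])
  ultimately show ?thesis unfolding \<Gamma>_eq by (metis image_eqI)
qed

lemma \<gamma>_borel: "\<gamma> \<in> borel \<rightarrow>\<^sub>M M"
proof -
  have "\<gamma> \<in> borel \<rightarrow>\<^sub>M restrict_space borel \<Gamma>"
    using \<gamma>_in_\<Gamma> by (intro measurable_restrict_space2 borel_measurable_continuous_onI \<gamma>_cont) auto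
  then show ?thesis by (simp add: measurable_cong_sets[OF refl sets_M])
qed

lemma J_borel [measurable]: "J \<in> borel_measurable borel"
  by (rule borel_measurable_continuous_onI[OF J_cont])

lemma M_per:
  fixes g :: "plane \<Rightarrow> real"
  assumes "g \<in> borel_measurable M"
  shows "(\<lambda>t. g (\<gamma> t)) \<in> borel_measurable borel"
    and "integrable M g \<longleftrightarrow> integrable per (\<lambda>t. J t * g (\<gamma> t))"
    and "(\<integral>x. g x \<partial>M) = (\<integral>t. J t * g (\<gamma> t) \<partial>per)"
proof -
  show [measurable]: "(\<lambda>t. g (\<gamma> t)) \<in> borel_measurable borel"
    by (rule measurable_compose[OF \<gamma>_borel assms])
  show "integrable M g \<longleftrightarrow> integrable per (\<lambda>t. J t * g (\<gamma> t))"
    unfolding M_integral(1)[OF assms] by (rule integral_lebesgue_period(1)) measurable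
  show "(\<integral>x. g x \<partial>M) = (\<integral>t. J t * g (\<gamma> t) \<partial>per)"
    unfolding M_integral(2)[OF assms] by (rule integral_lebesgue_period(2)) measurable
qed

lemma M_per_nn:
  assumes "g \<in> borel_measurable M"
  shows "(\<integral>\<^sup>+x. g x \<partial>M) = (\<integral>\<^sup>+t. ennreal (J t) * g (\<gamma> t) \<partial>per)"
proof -
  have [measurable]: "(\<lambda>t. g (\<gamma> t)) \<in> borel_measurable borel"
    by (rule measurable_compose[OF \<gamma>_borel assms])
  show ?thesis unfolding M_nn_integral[OF assms] by (rule nn_integral_lebesgue_period) measurable
qed

lemma finite_measure_M: "finite_measure M"
proof
  have "emeasure M (space M) = (\<integral>\<^sup>+x. 1 \<partial>M)" by simp
  also have "\<dots> = (\<integral>\<^sup>+t. ennreal (J t) \<partial>per)" by (subst M_per_nn) auto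
  also have "\<dots> < \<infinity>"
    using continuous_per(1)[OF J_cont] J_pos unfolding integrable_iff_bounded by (simp add: less_imp_le)
  finally show "emeasure M (space M) \<noteq> \<infinity>" by simp
qed

text \<open>Both variables are pulled back along \<open>\<gamma>\<close>, and the inner one is
  shifted to the increment \<open>h\<close>, which periodicity permits.\<close>

lemma slobodeckij_per:
  assumes w[measurable]: "w \<in> borel_measurable M"
  shows "slobodeckij M w = (\<integral>\<^sup>+s. ennreal (J s) * (\<integral>\<^sup>+h. ennreal (J (s + h)) *
    ennreal ((w (\<gamma> (s + h)) - w (\<gamma> s))\<^sup>2 / (dist (\<gamma> s) (\<gamma> (s + h)))\<^sup>2) \<partial>per) \<partial>per)"
proof -
  interpret M: finite_measure M by (rule finite_measure_M)
  have id[measurable]: "(\<lambda>x. x) \<in> M \<rightarrow>\<^sub>M borel"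
    by (subst measurable_cong_sets[OF sets_M refl]) (rule measurable_restrict_space1, simp)
  let ?k = "\<lambda>x y. ennreal ((w x - w y)\<^sup>2 / (dist x y)\<^sup>2)"
  have [measurable]: "(\<lambda>p. fst p) \<in> M \<Otimes>\<^sub>M M \<rightarrow>\<^sub>M borel" "(\<lambda>p. snd p) \<in> M \<Otimes>\<^sub>M M \<rightarrow>\<^sub>M borel"
    using measurable_compose[OF measurable_fst id] measurable_compose[OF measurable_snd id] by auto
  have k[measurable]: "(\<lambda>p. ?k (fst p) (snd p)) \<in> borel_measurable (M \<Otimes>\<^sub>M M)"
    by measurable
  have outer: "(\<lambda>x. \<integral>\<^sup>+y. ?k x y \<partial>M) \<in> borel_measurable M"
    using M.borel_measurable_nn_integral[of "\<lambda>x y. ?k x y" M] k by (simp add: split_beta)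
  have inner: "(\<integral>\<^sup>+y. ?k x y \<partial>M) = (\<integral>\<^sup>+t. ennreal (J t) * ?k x (\<gamma> t) \<partial>per)" if "x \<in> \<Gamma>" for x
    by (rule M_per_nn) measurable
  have "slobodeckij M w = (\<integral>\<^sup>+s. ennreal (J s) * (\<integral>\<^sup>+t. ennreal (J t) * ?k (\<gamma> s) (\<gamma> t) \<partial>per) \<partial>per)"
    unfolding slobodeckij_def M_per_nn[OF outer] by (simp add: inner[OF \<gamma>_in_\<Gamma>])
  also have "\<dots> = (\<integral>\<^sup>+s. ennreal (J s) * (\<integral>\<^sup>+h. ennreal (J (s + h)) *
    ennreal ((w (\<gamma> (s + h)) - w (\<gamma> s))\<^sup>2 / (dist (\<gamma> s) (\<gamma> (s + h)))\<^sup>2) \<partial>per) \<partial>per)"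
  proof (intro nn_integral_cong_AE eventually_mono[OF AE_per_interval])
    fix s :: real assume s: "s \<in> {-1..<1}"
    have [measurable]: "(\<lambda>t. w (\<gamma> t)) \<in> borel_measurable borel" "\<gamma> \<in> borel_measurable borel"
      by (rule M_per(1)[OF w], rule borel_measurable_continuous_onI[OF \<gamma>_cont])
    have "(\<integral>\<^sup>+h. ennreal (J (h + s)) * ?k (\<gamma> s) (\<gamma> (h + s)) \<partial>per) = (\<integral>\<^sup>+t. ennreal (J t) * ?k (\<gamma> s) (\<gamma> t) \<partial>per)"
      using s by (intro nn_integral_shift_period[where f = "\<lambda>t. ennreal (J t) * ?k (\<gamma> s) (\<gamma> t)"])
        (auto simp: J_periodic \<gamma>_periodic)
    then show "ennreal (J s) * (\<integral>\<^sup>+t. ennreal (J t) * ?k (\<gamma> s) (\<gamma> t) \<partial>per)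
      = ennreal (J s) * (\<integral>\<^sup>+h. ennreal (J (s + h)) *
        ennreal ((w (\<gamma> (s + h)) - w (\<gamma> s))\<^sup>2 / (dist (\<gamma> s) (\<gamma> (s + h)))\<^sup>2) \<partial>per)"
      by (simp add: add.commute power2_commute[of "w (\<gamma> s)"])
  qed
  finally show ?thesis .
qed

end

context machine_bounds
begin

section \<open>Comparison of the norms on the interface with those on the period\<close>

lemma C_pos: "0 < C"
  using C_ge_1 by linarith

lemma J_lip: "\<bar>J (x + h) - J x\<bar> \<le> C * \<bar>h\<bar>"
proof -
  have "norm (J (x + h) - J x) \<le> C * \<bar>x + h - x\<bar>"
    by (rule vector_derivative_norm_bound[where S = UNIV and f' = J'])
      (use J_has_derivative J'_le in \<open>auto simp: has_real_derivative_iff_has_vector_derivative\<close>)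
  then show ?thesis by simp
qed

lemma inverse_J_derivative: "((\<lambda>\<xi>. 1 / J \<xi>) has_real_derivative (- J' \<xi> / (J \<xi>)\<^sup>2)) (at \<xi>)"
  using J_pos[of \<xi>] by (auto intro!: derivative_eq_intros J_has_derivative simp: power2_eq_square)

lemma inverse_J_lip: "\<bar>1 / J (x + h) - 1 / J x\<bar> \<le> C * \<bar>h\<bar>"
proof -
  have "norm (1 / J (x + h) - 1 / J x) \<le> C * \<bar>x + h - x\<bar>"
    by (rule vector_derivative_norm_bound[where S = UNIV and f' = "\<lambda>\<xi>. - J' \<xi> / (J \<xi>)\<^sup>2"])
      (use inverse_J_derivative K'_le in \<open>auto simp: has_real_derivative_iff_has_vector_derivative\<close>)
  then show ?thesis by simp
qed

lemma inverse_J_le: "\<bar>1 / J x\<bar> \<le> C"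
  using J_ge[of x] J_pos[of x] by (simp add: field_simps)

lemma abs_J_le: "\<bar>J x\<bar> \<le> C"
  using J_le[of x] J_pos[of x] by simp

text \<open>Each of the two speeds costs a factor \<open>C\<close>, and exchanging chord and
  increment in the squared distance costs \<open>C\<^sup>2\<close>, together \<open>C ^ 4\<close>.
  The same count holds in the reverse bound \<open>circ_slobodeckij_le\<close>.\<close>

lemma slobodeckij_le:
  assumes "w \<in> borel_measurable M"
  shows "slobodeckij M w \<le> ennreal (C ^ 4) * circ_slobodeckij (\<lambda>t. w (\<gamma> t))"
proof -
  note [measurable] = M_per(1)[OF assms]
  have "slobodeckij M w \<le> (\<integral>\<^sup>+s. ennreal C * (\<integral>\<^sup>+h. ennreal (C ^ 3) *
      ennreal ((w (\<gamma> (s + h)) - w (\<gamma> s))\<^sup>2 / h\<^sup>2) \<partial>per) \<partial>per)"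
    unfolding slobodeckij_per[OF assms]
  proof (rule nn_integral_mono, rule mult_mono)
    show "ennreal (J s) \<le> ennreal C" for s by (intro ennreal_leI J_le)
  next
    fix s
    show "(\<integral>\<^sup>+h. ennreal (J (s + h)) *
        ennreal ((w (\<gamma> (s + h)) - w (\<gamma> s))\<^sup>2 / (dist (\<gamma> s) (\<gamma> (s + h)))\<^sup>2) \<partial>per)
      \<le> (\<integral>\<^sup>+h. ennreal (C ^ 3) * ennreal ((w (\<gamma> (s + h)) - w (\<gamma> s))\<^sup>2 / h\<^sup>2) \<partial>per)"
    proof (intro nn_integral_mono_AE eventually_mono[OF AE_per_interval])
      fix h :: real assume h: "h \<in> {-1..<1}"
      let ?n = "(w (\<gamma> (s + h)) - w (\<gamma> s))\<^sup>2" and ?d = "dist (\<gamma> s) (\<gamma> (s + h))"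
      have "?n / ?d\<^sup>2 \<le> C\<^sup>2 * (?n / h\<^sup>2)"
      proof (cases "h = 0")
        case False
        have "\<bar>h\<bar> \<le> C * ?d" using h by (intro \<gamma>_low) auto
        moreover from this False have "0 < ?d" using C_pos by (auto simp: zero_less_mult_iff)
        ultimately have "h\<^sup>2 \<le> C\<^sup>2 * ?d\<^sup>2" using power_mono[of "\<bar>h\<bar>" "C * ?d" 2] by (simp add: power_mult_distrib)
        then have "?n * h\<^sup>2 \<le> ?n * (C\<^sup>2 * ?d\<^sup>2)" by (intro mult_left_mono) auto
        then show ?thesis using \<open>0 < ?d\<close> False by (simp add: divide_simps mult_ac)
      qed simp
      then have "J (s + h) * (?n / ?d\<^sup>2) \<le> C * (C\<^sup>2 * (?n / h\<^sup>2))"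
        using J_le[of "s + h"] C_pos by (intro mult_mono) auto
      then have "ennreal (J (s + h) * (?n / ?d\<^sup>2)) \<le> ennreal (C ^ 3 * (?n / h\<^sup>2))"
        by (intro ennreal_leI) (simp add: power2_eq_square power3_eq_cube mult.assoc)
      then show "ennreal (J (s + h)) * ennreal (?n / ?d\<^sup>2) \<le> ennreal (C ^ 3) * ennreal (?n / h\<^sup>2)"
        using J_pos[of "s + h"] C_pos by (simp add: ennreal_mult[symmetric])
    qed
  qed auto
  also have "\<dots> = ennreal C * (ennreal (C ^ 3) * circ_slobodeckij (\<lambda>t. w (\<gamma> t)))"
    unfolding circ_slobodeckij_def by (simp add: nn_integral_cmult)
  also have "\<dots> = ennreal (C ^ 4) * circ_slobodeckij (\<lambda>t. w (\<gamma> t))"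
    using C_pos by (simp add: mult.assoc[symmetric] ennreal_mult[symmetric] power_numeral_reduce)
  finally show ?thesis .
qed

lemma circ_slobodeckij_le:
  assumes "w \<in> borel_measurable M"
  shows "circ_slobodeckij (\<lambda>t. w (\<gamma> t)) \<le> ennreal (C ^ 4) * slobodeckij M w"
proof -
  note [measurable] = M_per(1)[OF assms] borel_measurable_continuous_onI[OF \<gamma>_cont]
  have "circ_slobodeckij (\<lambda>t. w (\<gamma> t)) \<le> (\<integral>\<^sup>+s. (ennreal C * ennreal (J s)) * (\<integral>\<^sup>+h. ennreal (C ^ 3) *
      (ennreal (J (s + h)) * ennreal ((w (\<gamma> (s + h)) - w (\<gamma> s))\<^sup>2 / (dist (\<gamma> s) (\<gamma> (s + h)))\<^sup>2)) \<partial>per) \<partial>per)"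
    unfolding circ_slobodeckij_def
  proof (rule nn_integral_mono)
    fix s
    have "(\<integral>\<^sup>+h. ennreal ((w (\<gamma> (s + h)) - w (\<gamma> s))\<^sup>2 / h\<^sup>2) \<partial>per)
        \<le> 1 * (\<integral>\<^sup>+h. ennreal (C ^ 3) *
      (ennreal (J (s + h)) * ennreal ((w (\<gamma> (s + h)) - w (\<gamma> s))\<^sup>2 / (dist (\<gamma> s) (\<gamma> (s + h)))\<^sup>2)) \<partial>per)"
      unfolding mult_1
    proof (intro nn_integral_mono_AE eventually_mono[OF AE_per_interval])
      fix h :: real assume h: "h \<in> {-1..<1}"
      let ?n = "(w (\<gamma> (s + h)) - w (\<gamma> s))\<^sup>2" and ?d = "dist (\<gamma> s) (\<gamma> (s + h))"
      have "?n / h\<^sup>2 \<le> C\<^sup>2 * (?n / ?d\<^sup>2)"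
      proof (cases "h = 0")
        case False
        have "\<bar>h\<bar> \<le> C * ?d" using h by (intro \<gamma>_low) auto
        from this False have "0 < ?d" using C_pos by (auto simp: zero_less_mult_iff)
        have "?d\<^sup>2 \<le> C\<^sup>2 * h\<^sup>2" using power_mono[OF \<gamma>_lip[of s h] zero_le_dist, of 2] by (simp add: power_mult_distrib)
        then have "?n * ?d\<^sup>2 \<le> ?n * (C\<^sup>2 * h\<^sup>2)" by (intro mult_left_mono) auto
        then show ?thesis using \<open>0 < ?d\<close> False by (simp add: divide_simps mult_ac)
      qed simp
      also have "\<dots> \<le> (C * J (s + h)) * (C\<^sup>2 * (?n / ?d\<^sup>2))"
        using mult_right_mono[OF J_ge[of "s + h"], of "C\<^sup>2 * (?n / ?d\<^sup>2)"] by simp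
      also have "\<dots> = C ^ 3 * (J (s + h) * (?n / ?d\<^sup>2))"
        by (simp add: power2_eq_square power3_eq_cube mult_ac)
      finally have "ennreal (?n / h\<^sup>2) \<le> ennreal (C ^ 3 * (J (s + h) * (?n / ?d\<^sup>2)))"
        by (rule ennreal_leI)
      then show "ennreal (?n / h\<^sup>2) \<le> ennreal (C ^ 3) * (ennreal (J (s + h)) * ennreal (?n / ?d\<^sup>2))"
        using J_pos[of "s + h"] C_pos by (simp add: ennreal_mult[symmetric])
    qed
    also have "\<dots> \<le> (ennreal C * ennreal (J s)) * (\<integral>\<^sup>+h. ennreal (C ^ 3) *
      (ennreal (J (s + h)) * ennreal ((w (\<gamma> (s + h)) - w (\<gamma> s))\<^sup>2 / (dist (\<gamma> s) (\<gamma> (s + h)))\<^sup>2)) \<partial>per)"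
    proof (rule mult_right_mono)
      have "ennreal 1 \<le> ennreal (C * J s)" by (intro ennreal_leI J_ge)
      then show "1 \<le> ennreal C * ennreal (J s)" using J_pos[of s] C_pos by (simp add: ennreal_mult)
    qed simp
    finally show "(\<integral>\<^sup>+h. ennreal ((w (\<gamma> (s + h)) - w (\<gamma> s))\<^sup>2 / h\<^sup>2) \<partial>per)
        \<le> (ennreal C * ennreal (J s)) * (\<integral>\<^sup>+h. ennreal (C ^ 3) *
      (ennreal (J (s + h)) * ennreal ((w (\<gamma> (s + h)) - w (\<gamma> s))\<^sup>2 / (dist (\<gamma> s) (\<gamma> (s + h)))\<^sup>2)) \<partial>per)" .
  qed
  also have "\<dots> = ennreal C * (ennreal (C ^ 3) * slobodeckij M w)"
    unfolding slobodeckij_per[OF assms]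
    by (simp add: nn_integral_cmult mult.assoc mult.left_commute[of "ennreal (J _)" "ennreal (C ^ 3)"])
  also have "\<dots> = ennreal (C ^ 4) * slobodeckij M w"
    using C_pos by (simp add: mult.assoc[symmetric] ennreal_mult[symmetric] power_numeral_reduce)
  finally show ?thesis .
qed

lemma L2_M_per:
  assumes "w \<in> L2 M"
  shows "(\<lambda>t. w (\<gamma> t)) \<in> L2 per" "(\<integral>t. (w (\<gamma> t))\<^sup>2 \<partial>per) \<le> C * (\<integral>x. (w x)\<^sup>2 \<partial>M)"
proof -
  have m: "w \<in> borel_measurable M" "(\<lambda>x. (w x)\<^sup>2) \<in> borel_measurable M" using assms by (auto simp: L2_def)
  note [measurable] = M_per(1)[OF m(1)]
  have i: "integrable per (\<lambda>t. J t * (w (\<gamma> t))\<^sup>2)"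
    using assms M_per(2)[OF m(2)] by (simp add: L2_def)
  have le: "(w (\<gamma> t))\<^sup>2 \<le> C * (J t * (w (\<gamma> t))\<^sup>2)" for t
    using mult_right_mono[OF J_ge[of t], of "(w (\<gamma> t))\<^sup>2"] by (simp add: mult.assoc)
  have "integrable per (\<lambda>t. (w (\<gamma> t))\<^sup>2)"
    by (rule Bochner_Integration.integrable_bound[OF integrable_mult_right[OF i, of C]])
      (use le C_pos in \<open>auto simp: abs_mult abs_of_pos[OF J_pos] intro!: AE_I2\<close>)
  then show "(\<lambda>t. w (\<gamma> t)) \<in> L2 per" by (simp add: L2_def)
  have "(\<integral>t. (w (\<gamma> t))\<^sup>2 \<partial>per) \<le> (\<integral>t. C * (J t * (w (\<gamma> t))\<^sup>2) \<partial>per)"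
    by (rule integral_mono) (use i le \<open>integrable per (\<lambda>t. (w (\<gamma> t))\<^sup>2)\<close> in auto)
  then show "(\<integral>t. (w (\<gamma> t))\<^sup>2 \<partial>per) \<le> C * (\<integral>x. (w x)\<^sup>2 \<partial>M)"
    by (simp add: M_per(3)[OF m(2)])
qed

lemma Hhalf_norm_power2:
  assumes "w \<in> Hhalf M"
  shows "(Hhalf_norm M w)\<^sup>2 = (\<integral>x. (w x)\<^sup>2 \<partial>M) + enn2real (slobodeckij M w)"
  unfolding Hhalf_norm_def by (intro real_sqrt_pow2 add_nonneg_nonneg) auto

text \<open>In the parameter the pairing carries the weight \<open>J\<close>, which is moved to the
  test function: \<open>f t = J t * w (\<gamma> t)\<close> has finite periodic seminorm because
  \<open>J\<close> is bounded and Lipschitz, and \<open>trig_duality\<close> applies to it. In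
  \<open>8 * C ^ 6\<close> the L^2 part uses 5 and the seminorm 2; the rest is slack.\<close>

lemma trig_pairing_le:
  assumes "fourier_family e" "w \<in> Hhalf M" "\<mu> \<in> borel_measurable M"
    and \<mu>: "\<And>t. \<mu> (\<gamma> t) = fourier_family.trig e \<alpha> N t"
  shows "(pairing M \<mu> w)\<^sup>2 \<le> 8 * C ^ 6 * (\<Sum>n\<le>N. (\<alpha> n)\<^sup>2 * fourier_family.E e n / (1 + real n)) * (Hhalf_norm M w)\<^sup>2"
proof -
  interpret fourier_family e by fact
  have w: "w \<in> L2 M" "slobodeckij M w < \<infinity>" using assms(2) by (auto simp: Hhalf_def)
  have wm: "w \<in> borel_measurable M" using w by (simp add: L2_def)
  note [measurable] = M_per(1)[OF wm]
  define f where "f t = J t * w (\<gamma> t)" for t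
  have fper: "f (t + 2) = f t" for t by (simp add: f_def J_periodic \<gamma>_periodic)
  let ?W = "\<integral>x. (w x)\<^sup>2 \<partial>M" and ?S = "enn2real (slobodeckij M w)"
  have pw: "integrable per (\<lambda>t. (w (\<gamma> t))\<^sup>2)" using L2_M_per(1)[OF w(1)] by (simp add: L2_def)
  have f2: "(f t)\<^sup>2 \<le> C\<^sup>2 * (w (\<gamma> t))\<^sup>2" for t
    unfolding f_def power_mult_distrib using power_mono[OF J_le[of t], of 2] J_pos[of t]
    by (intro mult_right_mono) auto
  have fi: "integrable per (\<lambda>t. (f t)\<^sup>2)"
    by (rule Bochner_Integration.integrable_bound[OF integrable_mult_right[OF pw, of "C\<^sup>2"]])
      (use f2 in \<open>auto simp: f_def\<close>)
  have "f \<in> borel_measurable borel" unfolding f_def[abs_def] by measurable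
  with fi have fL2: "f \<in> L2 per" by (simp add: L2_def)
  have "(\<integral>t. (f t)\<^sup>2 \<partial>per) \<le> (\<integral>t. C\<^sup>2 * (w (\<gamma> t))\<^sup>2 \<partial>per)"
    by (rule integral_mono) (use fi pw f2 in auto)
  also have "\<dots> \<le> C\<^sup>2 * (C * ?W)" using L2_M_per(2)[OF w(1)] by (simp add: mult_left_mono)
  finally have f_norm: "(\<integral>t. (f t)\<^sup>2 \<partial>per) \<le> C ^ 3 * ?W" by (simp add: power2_eq_square power3_eq_cube mult.assoc)
  have "circ_slobodeckij f \<le> ennreal (2 * C\<^sup>2) * circ_slobodeckij (\<lambda>t. w (\<gamma> t))
      + ennreal (4 * C\<^sup>2) * (\<integral>\<^sup>+t. ennreal ((w (\<gamma> t))\<^sup>2) \<partial>per)"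
    unfolding f_def by (rule circ_slobodeckij_mult_le) (auto simp: abs_J_le J_lip)
  also have "\<dots> \<le> ennreal (2 * C\<^sup>2) * (ennreal (C ^ 4) * slobodeckij M w) + ennreal (4 * C\<^sup>2) * ennreal (C * ?W)"
  proof (intro add_mono mult_left_mono circ_slobodeckij_le wm)
    show "(\<integral>\<^sup>+t. ennreal ((w (\<gamma> t))\<^sup>2) \<partial>per) \<le> ennreal (C * ?W)"
      using nn_integral_eq_integral[OF pw] L2_M_per(2)[OF w(1)] by (simp add: ennreal_leI)
  qed auto
  also have "slobodeckij M w = ennreal ?S" using w(2) by simp
  also have "ennreal (2 * C\<^sup>2) * (ennreal (C ^ 4) * ennreal ?S) + ennreal (4 * C\<^sup>2) * ennreal (C * ?W)
      = ennreal (2 * C\<^sup>2 * (C ^ 4 * ?S) + 4 * C\<^sup>2 * (C * ?W))"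
    using C_pos by (simp add: ennreal_mult[symmetric] ennreal_plus[symmetric] del: ennreal_plus)
  finally have cf: "circ_slobodeckij f \<le> ennreal (2 * C\<^sup>2 * (C ^ 4 * ?S) + 4 * C\<^sup>2 * (C * ?W))" .
  then have fin: "circ_slobodeckij f < \<infinity>" by (rule le_less_trans) simp
  have cf': "enn2real (circ_slobodeckij f) \<le> 2 * C\<^sup>2 * (C ^ 4 * ?S) + 4 * C\<^sup>2 * (C * ?W)"
    using C_pos by (intro enn2real_leI[OF _ cf]) auto
  have S0: "0 \<le> ?S" and W0: "0 \<le> ?W" by auto
  have C3: "C ^ 3 \<le> C ^ 6" using C_ge_1 by (intro power_increasing) auto
  have total: "(\<integral>t. (f t)\<^sup>2 \<partial>per) + enn2real (circ_slobodeckij f) \<le> 8 * C ^ 6 * (Hhalf_norm M w)\<^sup>2"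
  proof -
    have "(\<integral>t. (f t)\<^sup>2 \<partial>per) + enn2real (circ_slobodeckij f) \<le> 5 * (C ^ 3 * ?W) + 2 * (C ^ 6 * ?S)"
      using f_norm cf' by (simp add: power_numeral_reduce mult.assoc)
    also have "\<dots> \<le> 8 * (C ^ 6 * ?W) + 8 * (C ^ 6 * ?S)"
    proof -
      have "C ^ 3 * ?W \<le> C ^ 6 * ?W" using C3 W0 by (rule mult_right_mono)
      moreover have "0 \<le> C ^ 6 * ?W" "0 \<le> C ^ 6 * ?S" using C_pos S0 W0 by auto
      ultimately show ?thesis by linarith
    qed
    finally show ?thesis unfolding Hhalf_norm_power2[OF assms(2)] by (simp add: algebra_simps)
  qed
  have "pairing M \<mu> w = (\<integral>t. J t * (\<mu> (\<gamma> t) * w (\<gamma> t)) \<partial>per)"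
    unfolding pairing_def by (rule M_per(3)) (use assms(3) wm in measurable)
  also have "\<dots> = (\<integral>t. f t * trig \<alpha> N t \<partial>per)"
    by (simp add: f_def \<mu> mult_ac)
  finally have "(pairing M \<mu> w)\<^sup>2 \<le> (\<Sum>n\<le>N. (\<alpha> n)\<^sup>2 * E n / (1 + real n)) * ((\<integral>t. (f t)\<^sup>2 \<partial>per) + enn2real (circ_slobodeckij f))"
    using trig_duality[OF fL2 fper fin, of \<alpha> N] by simp
  also have "\<dots> \<le> (\<Sum>n\<le>N. (\<alpha> n)\<^sup>2 * E n / (1 + real n)) * (8 * C ^ 6 * (Hhalf_norm M w)\<^sup>2)"
    using total by (intro mult_left_mono sum_nonneg) (auto simp: E_nonneg)
  finally show ?thesis by (simp add: mult_ac)
qed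

text \<open>Applied with \<open>K = 1\<close> to the multiplier itself and with
  \<open>K = 1 / J\<close> to the test function; both are bounded by \<open>C\<close> and Lipschitz
  with constant \<open>C\<close>. The number 400 is a generous round bound; its main part is
  \<open>8 * pi\<^sup>2 \<le> 128\<close>.\<close>

lemma trig_Hhalf:
  assumes "fourier_family e" "w \<in> borel_measurable M"
    and K: "continuous_on UNIV K" "\<And>x. \<bar>K x\<bar> \<le> C" "\<And>x h. \<bar>K (x + h) - K x\<bar> \<le> C * \<bar>h\<bar>"
    and w: "\<And>t. w (\<gamma> t) = K t * fourier_family.trig e \<alpha> N t"
  shows "w \<in> Hhalf M"
    and "(Hhalf_norm M w)\<^sup>2 \<le> 400 * C ^ 6 * (\<Sum>n\<le>N. (1 + real n) * ((\<alpha> n)\<^sup>2 * fourier_family.E e n))"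
proof -
  interpret fourier_family e by fact
  have cw: "continuous_on UNIV (\<lambda>t. w (\<gamma> t))" unfolding w by (intro continuous_intros K trig_cont)
  have wL2: "w \<in> L2 M" by (rule M_continuous_L2[OF assms(2) cw])
  have Km: "K \<in> borel_measurable borel" by (rule borel_measurable_continuous_onI[OF K(1)])
  have tm: "trig \<alpha> N \<in> borel_measurable borel" by (rule borel_measurable_continuous_onI[OF trig_cont])
  let ?P = "\<Sum>n\<le>N. (\<alpha> n)\<^sup>2 * E n" and ?Q = "\<Sum>n\<le>N. real n * ((\<alpha> n)\<^sup>2 * E n)"
  have P0: "0 \<le> ?P" and Q0: "0 \<le> ?Q" by (auto intro!: sum_nonneg simp: E_nonneg)
  have "(\<integral>x. (w x)\<^sup>2 \<partial>M) = (\<integral>t. J t * (w (\<gamma> t))\<^sup>2 \<partial>per)"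
    by (rule M_per(3)) (use assms(2) in measurable)
  also have "\<dots> \<le> (\<integral>t. C ^ 3 * (trig \<alpha> N t)\<^sup>2 \<partial>per)"
  proof (rule integral_mono)
    show "integrable per (\<lambda>t. J t * (w (\<gamma> t))\<^sup>2)" by (intro continuous_per(1) continuous_intros J_cont cw)
    show "integrable per (\<lambda>t. C ^ 3 * (trig \<alpha> N t)\<^sup>2)" by (intro continuous_per(1) continuous_intros trig_cont)
    fix t
    have "(K t)\<^sup>2 \<le> C\<^sup>2" using power_mono[OF K(2)[of t] abs_ge_zero, of 2] by simp
    then have "J t * (K t)\<^sup>2 \<le> C * C\<^sup>2" using J_le[of t] C_pos by (intro mult_mono) auto
    then have "J t * (K t)\<^sup>2 * (trig \<alpha> N t)\<^sup>2 \<le> C ^ 3 * (trig \<alpha> N t)\<^sup>2"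
      by (intro mult_right_mono) (auto simp: power2_eq_square power3_eq_cube)
    then show "J t * (w (\<gamma> t))\<^sup>2 \<le> C ^ 3 * (trig \<alpha> N t)\<^sup>2" by (simp add: w power_mult_distrib mult.assoc)
  qed
  also have "\<dots> = C ^ 3 * ?P" by (simp add: integral_trig_power2)
  finally have wn: "(\<integral>x. (w x)\<^sup>2 \<partial>M) \<le> C ^ 3 * ?P" .
  have "slobodeckij M w \<le> ennreal (C ^ 4) * circ_slobodeckij (\<lambda>t. K t * trig \<alpha> N t)"
    using slobodeckij_le[OF assms(2)] by (simp add: w)
  also have "circ_slobodeckij (\<lambda>t. K t * trig \<alpha> N t) \<le> ennreal (2 * C\<^sup>2) * circ_slobodeckij (trig \<alpha> N)
      + ennreal (4 * C\<^sup>2) * (\<integral>\<^sup>+t. ennreal ((trig \<alpha> N t)\<^sup>2) \<partial>per)"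
    by (rule circ_slobodeckij_mult_le[OF tm Km K(2,3)])
  also have "(\<integral>\<^sup>+t. ennreal ((trig \<alpha> N t)\<^sup>2) \<partial>per) = ennreal ?P"
    using nn_integral_eq_integral[OF L2_D(2)[OF trig_L2]] by (simp add: integral_trig_power2)
  also have "ennreal (2 * C\<^sup>2) * circ_slobodeckij (trig \<alpha> N) \<le> ennreal (2 * C\<^sup>2) * ennreal (4 * pi\<^sup>2 * ?Q)"
    by (intro mult_left_mono circ_slobodeckij_trig) auto
  finally have "slobodeckij M w \<le> ennreal (C ^ 4) * (ennreal (2 * C\<^sup>2) * ennreal (4 * pi\<^sup>2 * ?Q) + ennreal (4 * C\<^sup>2) * ennreal ?P)"
    by (simp add: mult_left_mono add_mono)
  also have "\<dots> = ennreal (C ^ 4 * (2 * C\<^sup>2 * (4 * pi\<^sup>2 * ?Q) + 4 * C\<^sup>2 * ?P))"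
    using C_pos P0 Q0 by (simp add: ennreal_mult[symmetric] ennreal_plus[symmetric] del: ennreal_plus)
  finally have S: "slobodeckij M w \<le> ennreal (C ^ 4 * (2 * C\<^sup>2 * (4 * pi\<^sup>2 * ?Q) + 4 * C\<^sup>2 * ?P))" .
  then have fin: "slobodeckij M w < \<infinity>" by (rule le_less_trans) simp
  show wH: "w \<in> Hhalf M" using wL2 fin by (simp add: Hhalf_def)
  have "enn2real (slobodeckij M w) \<le> C ^ 4 * (2 * C\<^sup>2 * (4 * pi\<^sup>2 * ?Q) + 4 * C\<^sup>2 * ?P)"
    using enn2real_mono[OF S] C_pos P0 Q0 by simp
  also have "\<dots> = 8 * pi\<^sup>2 * (C ^ 6 * ?Q) + 4 * (C ^ 6 * ?P)"
    by (simp add: algebra_simps power_numeral_reduce)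
  also have "\<dots> \<le> 8 * 16 * (C ^ 6 * ?Q) + 4 * (C ^ 6 * ?P)"
  proof -
    have "pi\<^sup>2 \<le> 4\<^sup>2" using pi_less_4 pi_ge_zero by (intro power_mono) auto
    then show ?thesis using C_pos Q0 by (intro add_mono[OF _ order_refl] mult_right_mono mult_nonneg_nonneg) auto
  qed
  finally have sn: "enn2real (slobodeckij M w) \<le> 128 * (C ^ 6 * ?Q) + 4 * (C ^ 6 * ?P)" by simp
  have "C ^ 3 \<le> C ^ 6" using C_ge_1 by (intro power_increasing) auto
  then have "C ^ 3 * ?P \<le> C ^ 6 * ?P" using P0 by (rule mult_right_mono)
  moreover have "0 \<le> C ^ 6 * ?P" "0 \<le> C ^ 6 * ?Q" using C_pos P0 Q0 by auto
  ultimately have "(Hhalf_norm M w)\<^sup>2 \<le> 400 * (C ^ 6 * ?P) + 400 * (C ^ 6 * ?Q)"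
    unfolding Hhalf_norm_power2[OF wH] using wn sn by linarith
  also have "\<dots> = 400 * C ^ 6 * (\<Sum>n\<le>N. (1 + real n) * ((\<alpha> n)\<^sup>2 * E n))"
    by (simp add: distrib_right distrib_left sum.distrib mult.assoc)
  finally show "(Hhalf_norm M w)\<^sup>2 \<le> 400 * C ^ 6 * (\<Sum>n\<le>N. (1 + real n) * ((\<alpha> n)\<^sup>2 * E n))" .
qed

end

section \<open>Lifting from the interface\<close>

context machine
begin

lemma F_periodic_int: "\<rho> \<in> {a..b} \<Longrightarrow> F (\<xi> + 2 * real_of_int k, \<rho>) = F (\<xi>, \<rho>)"
  by (rule periodic_int[of "\<lambda>\<xi>. F (\<xi>, \<rho>)"]) (rule F_periodic)

lemma F_eq_D:
  assumes "F (\<xi>, \<rho>) = F (\<xi>', \<rho>')" "\<rho> \<in> {a..b}" "\<rho>' \<in> {a..b}"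
  obtains k :: int where "\<rho> = \<rho>'" "\<xi>' = \<xi> + 2 * real_of_int k"
proof -
  obtain i where i: "\<xi> + 2 * real_of_int i \<in> {-1..<1}" by (rule period_representative)
  obtain j where j: "\<xi>' + 2 * real_of_int j \<in> {-1..<1}" by (rule period_representative)
  have "F (\<xi> + 2 * real_of_int i, \<rho>) = F (\<xi>' + 2 * real_of_int j, \<rho>')"
    using assms by (simp add: F_periodic_int)
  then have "(\<xi> + 2 * real_of_int i, \<rho>) = (\<xi>' + 2 * real_of_int j, \<rho>')"
    by (rule inj_onD[OF F_inj]) (use i j assms in auto)
  then have "\<rho> = \<rho>'" "\<xi>' = \<xi> + 2 * real_of_int (i - j)" by auto
  then show ?thesis by (rule that)
qed

text \<open>The inverse of \<open>D z\<close>, written out by Cramer's rule so that its continuity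
  in \<open>z\<close> is visible.\<close>

definition Dinv :: "plane \<Rightarrow> plane \<Rightarrow> plane" where
  "Dinv z h = ((snd (D z (0, 1)) * fst h - fst (D z (0, 1)) * snd h) / det_plane (D z),
    (fst (D z (1, 0)) * snd h - snd (D z (1, 0)) * fst h) / det_plane (D z))"

lemma Dinv_linear: "bounded_linear (Dinv z)"
  by (rule linear_conv_bounded_linear[THEN iffD1], rule linearI)
    (auto simp: Dinv_def algebra_simps diff_divide_distrib add_divide_distrib)

lemma Dinv_inverse:
  assumes "z \<in> UNIV \<times> {a..b}"
  shows "Dinv z \<circ> D z = id"
proof (rule ext)
  fix h :: plane
  obtain p q where h: "h = (p, q)" by (cases h)
  have "D z (p *\<^sub>R (1, 0) + q *\<^sub>R (0, 1)) = p *\<^sub>R D z (1, 0) + q *\<^sub>R D z (0, 1)"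
    by (simp only: linear_add[OF F_derivs(3)[OF assms]] linear_cmul[OF F_derivs(3)[OF assms]])
  then have Dh: "D z h = p *\<^sub>R D z (1, 0) + q *\<^sub>R D z (0, 1)" by (simp add: h)
  have "snd (D z (0, 1)) * fst (D z h) - fst (D z (0, 1)) * snd (D z h) = p * det_plane (D z)"
    "fst (D z (1, 0)) * snd (D z h) - snd (D z (1, 0)) * fst (D z h) = q * det_plane (D z)"
    unfolding Dh by (simp_all add: det_plane_def algebra_simps)
  then show "(Dinv z \<circ> D z) h = id h"
    using det_nonzero[OF assms] by (simp add: Dinv_def h)
qed

lemma Dinv_cont: "continuous_on (UNIV \<times> {a..b}) (\<lambda>z. Dinv z h)"
  unfolding Dinv_def by (intro continuous_intros D_cont Basis_plane det_cont) (auto simp: det_nonzero)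

text \<open>On an open window of one full angular period \<open>F\<close> is injective, so
  invariance of domain provides an open image and a continuous inverse, whose derivative is then the
  inverse matrix. The inverse has to be local because the angle is determined only up to the
  period.\<close>

lemma F_local_inverse:
  assumes z0: "z0 \<in> UNIV \<times> {a<..<b}"
  obtains W g where "open W" "z0 \<in> W" "W \<subseteq> UNIV \<times> {a<..<b}" "open (F ` W)" "continuous_on (F ` W) g"
    "\<And>z. z \<in> W \<Longrightarrow> g (F z) = z"
    "\<And>y. y \<in> F ` W \<Longrightarrow> (g has_derivative Dinv (g y)) (at y)"
proof -
  define W where "W = {fst z0 - 1<..<fst z0 + 1} \<times> {a<..<b}"
  have W: "open W" "z0 \<in> W" "W \<subseteq> UNIV \<times> {a<..<b}" "W \<subseteq> UNIV \<times> {a..b}"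
    using z0 by (auto simp: W_def intro!: open_Times)
  have injW: "inj_on F W"
  proof (rule inj_onI)
    fix x y assume xy: "x \<in> W" "y \<in> W" "F x = F y"
    then have "F (fst x, snd x) = F (fst y, snd y)" by simp
    then obtain k where k: "snd x = snd y" "fst y = fst x + 2 * real_of_int k"
      by (rule F_eq_D) (use xy W in \<open>auto simp: W_def\<close>)
    have "\<bar>fst y - fst x\<bar> < 2" using xy by (auto simp: W_def)
    then have "\<bar>real_of_int k\<bar> < 1" using k by simp
    then have "k = 0" by linarith
    then show "x = y" using k by (simp add: prod_eq_iff)
  qed
  have cF: "continuous_on W F" by (rule continuous_on_subset[OF F_cont W(4)])
  have oF: "open (F ` W)" by (rule invariance_of_domain[OF cF W(1) injW])
  obtain g where g: "homeomorphism W (F ` W) F g"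
    by (rule invariance_of_domain_homeomorphism[OF W(1) cF _ injW]) auto
  then have gc: "continuous_on (F ` W) g" and gF: "\<And>z. z \<in> W \<Longrightarrow> g (F z) = z" and Fg: "\<And>y. y \<in> F ` W \<Longrightarrow> F (g y) = y"
    by (auto simp: homeomorphism_def)
  have "(g has_derivative Dinv (g y)) (at y)" if y: "y \<in> F ` W" for y
  proof (rule has_derivative_inverse_basic[where f = F and f' = "D (g y)" and T = "F ` W"])
    have gy: "g y \<in> UNIV \<times> {a..b}" using y gF W(4) by auto
    show "(F has_derivative D (g y)) (at (g y))" by (rule F_derivs(1)[OF gy])
    show "Dinv (g y) \<circ> D (g y) = id" by (rule Dinv_inverse[OF gy])
    show "continuous (at y) g" using gc y continuous_on_eq_continuous_at[OF oF] by blast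
  qed (use oF y Fg Dinv_linear in auto)
  then show ?thesis using that[OF W(1,2,3) oF gc gF] by blast
qed

end

context machine_bounds
begin

text \<open>The function \<open>v\<close> is \<open>G \<circ> F\<^sup>-\<^sup>1\<close> on the annulus, extended by zero.\<close>

lemma annulus_function:
  fixes G Gx Gy :: "plane \<Rightarrow> real"
  assumes \<delta>: "0 < \<delta>" "a < c - \<delta>" "c + \<delta> < b"
    and G: "\<And>z. (G has_derivative (\<lambda>h. fst h * Gx z + snd h * Gy z)) (at z)"
    and cont: "continuous_on UNIV Gx" "continuous_on UNIV Gy"
    and per: "\<And>\<xi> \<rho>. G (\<xi> + 2, \<rho>) = G (\<xi>, \<rho>)"
    and supp: "\<And>\<xi> \<rho>. \<rho> \<notin> {c-\<delta>..c+\<delta>} \<Longrightarrow> G (\<xi>, \<rho>) = 0"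
  obtains v where "Ck 1 UNIV v" "\<And>\<xi> \<rho>. \<rho> \<in> {a..b} \<Longrightarrow> v (F (\<xi>, \<rho>)) = G (\<xi>, \<rho>)"
    "\<And>z. z \<in> {-1..1} \<times> {a..b} \<Longrightarrow>
      (frechet_derivative v (at (F z)) (1, 0))\<^sup>2 + (frechet_derivative v (at (F z)) (0, 1))\<^sup>2
        \<le> 4 * C ^ 4 * ((Gx z)\<^sup>2 + (Gy z)\<^sup>2)"
proof -
  define R :: "plane set" where "R = UNIV \<times> {a..b}"
  \<comment> \<open>The choice of the preimage does not affect the value: any two preimages differ
    by a multiple of the period, under which \<open>G\<close> is invariant.\<close>
  define v where "v x = (if x \<in> F ` R then G (SOME z. z \<in> R \<and> F z = x) else 0)" for x
  have v_eq: "v (F (\<xi>, \<rho>)) = G (\<xi>, \<rho>)" if \<rho>: "\<rho> \<in> {a..b}" for \<xi> \<rho>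
  proof -
    define z where "z = (SOME z. z \<in> R \<and> F z = F (\<xi>, \<rho>))"
    have "z \<in> R \<and> F z = F (\<xi>, \<rho>)"
      unfolding z_def by (rule someI[of _ "(\<xi>, \<rho>)"]) (use \<rho> in \<open>auto simp: R_def\<close>)
    then have z: "F (fst z, snd z) = F (\<xi>, \<rho>)" "snd z \<in> {a..b}" by (auto simp: R_def)
    obtain k where "snd z = \<rho>" "\<xi> = fst z + 2 * real_of_int k"
      by (rule F_eq_D[OF z \<rho>])
    then have "G (\<xi>, \<rho>) = G (fst z, snd z)"
      using periodic_int[of "\<lambda>\<xi>. G (\<xi>, \<rho>)", OF per] by simp
    moreover have "F (\<xi>, \<rho>) \<in> F ` R" using \<rho> by (auto simp: R_def)
    ultimately show ?thesis by (simp add: v_def z_def)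
  qed
  \<comment> \<open>\<open>K\<close> is the compact image of the strip that supports
    \<open>G\<close>. Its complement is open and \<open>v\<close> vanishes there, so
    differentiability is trivial off \<open>K\<close>; points of \<open>K\<close> come from the
    interior of the annulus, where local inverses exist.\<close>
  define K where "K = F ` ({-1..1} \<times> {c-\<delta>..c+\<delta>})"
  have "compact K" unfolding K_def
    by (intro compact_continuous_image compact_Times continuous_on_subset[OF F_cont]) (use \<delta> in auto)
  then have opK: "open (- K)" using compact_imp_closed by blast
  have notK: "F (\<xi>, \<rho>) \<notin> K" if "\<rho> \<in> {a..b}" "\<rho> \<notin> {c-\<delta>..c+\<delta>}" for \<xi> \<rho>
  proof
    assume "F (\<xi>, \<rho>) \<in> K"
    then obtain \<xi>' \<rho>' where "F (\<xi>, \<rho>) = F (\<xi>', \<rho>')" "\<rho>' \<in> {c-\<delta>..c+\<delta>}" by (auto simp: K_def)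
    moreover from this(2) have "\<rho>' \<in> {a..b}" using \<delta> by auto
    ultimately show False using F_eq_D[of \<xi> \<rho> \<xi>' \<rho>'] that by metis
  qed
  have v0: "v x = 0" if "x \<notin> K" for x
  proof (cases "x \<in> F ` R")
    case True
    then obtain \<xi> \<rho> where x: "x = F (\<xi>, \<rho>)" "\<rho> \<in> {a..b}" by (auto simp: R_def)
    obtain k where k: "\<xi> + 2 * real_of_int k \<in> {-1..<1}" by (rule period_representative)
    have "\<rho> \<notin> {c-\<delta>..c+\<delta>}"
    proof
      assume "\<rho> \<in> {c-\<delta>..c+\<delta>}"
      then have "F (\<xi> + 2 * real_of_int k, \<rho>) \<in> K" using k by (auto simp: K_def)
      then show False using that x by (simp add: F_periodic_int)
    qed
    then show ?thesis using v_eq[OF x(2)] supp x(1) by simp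
  qed (simp add: v_def)
  have der0: "(v has_derivative (\<lambda>_. 0)) (at x)" if "x \<notin> K" for x
    by (rule has_derivative_transform_within_open[OF has_derivative_const opK]) (use that v0 in auto)
  define Q where "Q z e = fst (Dinv z e) * Gx z + snd (Dinv z e) * Gy z" for z e
  have loc: "\<exists>Y g. open Y \<and> F z0 \<in> Y \<and> continuous_on Y g \<and> (\<forall>y\<in>Y. g y \<in> UNIV \<times> {a<..<b})
      \<and> g (F z0) = z0 \<and> (\<forall>y\<in>Y. (v has_derivative Q (g y)) (at y))"
    if z0: "z0 \<in> UNIV \<times> {a<..<b}" for z0
  proof -
    obtain W g where W: "open W" "z0 \<in> W" "W \<subseteq> UNIV \<times> {a<..<b}" "open (F ` W)" "continuous_on (F ` W) g"
      "\<And>z. z \<in> W \<Longrightarrow> g (F z) = z" "\<And>y. y \<in> F ` W \<Longrightarrow> (g has_derivative Dinv (g y)) (at y)"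
      by (rule F_local_inverse[OF z0]) blast
    have "(v has_derivative Q (g y)) (at y)" if y: "y \<in> F ` W" for y
    proof -
      have "((\<lambda>y. G (g y)) has_derivative (\<lambda>h. fst (Dinv (g y) h) * Gx (g y) + snd (Dinv (g y) h) * Gy (g y))) (at y)"
        by (rule has_derivative_compose[OF W(7)[OF y] G])
      then have "((\<lambda>y. G (g y)) has_derivative Q (g y)) (at y)" by (simp add: Q_def[abs_def])
      moreover have "G (g y') = v y'" if y': "y' \<in> F ` W" for y'
      proof -
        obtain z where "z \<in> W" "y' = F z" using y' by blast
        then show ?thesis using v_eq[of "snd z" "fst z"] W(3,6) by auto
      qed
      ultimately show ?thesis by (rule has_derivative_transform_within_open[OF _ W(4) y])
    qed
    moreover have "g y \<in> UNIV \<times> {a<..<b}" if "y \<in> F ` W" for y using that W(3,6) by auto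
    ultimately show ?thesis using W by (intro exI[of _ "F ` W"] exI[of _ g]) auto
  qed
  have inK: "\<exists>z0. z0 \<in> UNIV \<times> {a<..<b} \<and> x = F z0" if "x \<in> K" for x
  proof -
    obtain z0 where "z0 \<in> {-1..1} \<times> {c-\<delta>..c+\<delta>}" "x = F z0"
      using \<open>x \<in> K\<close> unfolding K_def by (rule imageE)
    then show ?thesis using \<delta> by (intro exI[of _ z0]) auto
  qed
  have diff: "v differentiable (at x)" for x
  proof (cases "x \<in> K")
    case True
    from inK[OF True] obtain z0 where z0: "z0 \<in> UNIV \<times> {a<..<b}" "x = F z0" by (elim exE conjE)
    from loc[OF z0(1)] z0(2) show ?thesis unfolding differentiable_def by blast
  next
    case False
    then show ?thesis unfolding differentiable_def by (intro exI) (rule der0)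
  qed
  have pcont: "continuous_on UNIV (\<lambda>x. frechet_derivative v (at x) e)" for e
  proof (intro continuous_at_imp_continuous_on ballI)
    fix x
    show "isCont (\<lambda>x. frechet_derivative v (at x) e) x"
    proof (cases "x \<in> K")
      case True
      from inK[OF True] obtain z0 where z0: "z0 \<in> UNIV \<times> {a<..<b}" "x = F z0" by (elim exE conjE)
      obtain Y g where Y: "open Y" "x \<in> Y" "continuous_on Y g" "\<And>y. y \<in> Y \<Longrightarrow> g y \<in> UNIV \<times> {a<..<b}"
        "\<And>y. y \<in> Y \<Longrightarrow> (v has_derivative Q (g y)) (at y)"
        using loc[OF z0(1)] z0(2) by blast
      have "continuous_on Y (\<lambda>y. Dinv (g y) e)"
        by (intro continuous_on_compose2[OF Dinv_cont Y(3)] subsetI) (elim imageE, use Y(4) in fastforce)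
      then have "continuous_on Y (\<lambda>y. Q (g y) e)"
        unfolding Q_def by (intro continuous_intros continuous_on_compose2[OF cont(1) Y(3)] continuous_on_compose2[OF cont(2) Y(3)]) auto
      moreover have "frechet_derivative v (at y) e = Q (g y) e" if "y \<in> Y" for y
        using frechet_derivative_at[OF Y(5)[OF that]] by simp
      ultimately have "continuous_on Y (\<lambda>x. frechet_derivative v (at x) e)"
        by (simp cong: continuous_on_cong)
      then show ?thesis using Y(1,2) by (simp add: continuous_on_eq_continuous_at)
    next
      case False
      have "frechet_derivative v (at y) e = 0" if "y \<notin> K" for y
        unfolding frechet_derivative_at[OF der0[OF that], symmetric] ..
      then have "continuous_on (- K) (\<lambda>x. frechet_derivative v (at x) e) \<longleftrightarrow> continuous_on (- K) (\<lambda>_. 0 :: real)"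
        by (intro continuous_on_cong refl) (simp only: Compl_iff)
      then show ?thesis using False opK by (simp add: continuous_on_eq_continuous_at)
    qed
  qed
  show ?thesis
  proof (rule that[of v])
    show "Ck 1 UNIV v" using diff pcont by simp
    show "v (F (\<xi>, \<rho>)) = G (\<xi>, \<rho>)" if "\<rho> \<in> {a..b}" for \<xi> \<rho> by (rule v_eq[OF that])
    fix z :: plane assume z: "z \<in> {-1..1} \<times> {a..b}"
    show "(frechet_derivative v (at (F z)) (1, 0))\<^sup>2 + (frechet_derivative v (at (F z)) (0, 1))\<^sup>2
        \<le> 4 * C ^ 4 * ((Gx z)\<^sup>2 + (Gy z)\<^sup>2)"
    proof (cases "snd z \<in> {c-\<delta>..c+\<delta>}")
      case False
      then have "F z \<notin> K" using notK[of "snd z" "fst z"] z by auto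
      from frechet_derivative_at[OF der0[OF this]] show ?thesis
        using C_pos by (auto simp: fun_eq_iff)
    next
      case True
      then have z': "z \<in> UNIV \<times> {a<..<b}" using \<delta> by (cases z) auto
      obtain g where "g (F z) = z" "(v has_derivative Q (g (F z))) (at (F z))"
        using loc[OF z'] by blast
      then have fd: "frechet_derivative v (at (F z)) = Q z" using frechet_derivative_at by metis
      let ?p = "fst (D z (1, 0))" and ?q = "snd (D z (1, 0))" and ?r = "fst (D z (0, 1))" and ?s = "snd (D z (0, 1))"
      have abs: "\<bar>?p\<bar> \<le> C" "\<bar>?q\<bar> \<le> C" "\<bar>?r\<bar> \<le> C" "\<bar>?s\<bar> \<le> C"
        using D1_le[OF z] D2_le[OF z] norm_fst_le[of "fst (D z (1, 0))" "snd (D z (1, 0))"] norm_snd_le[of "snd (D z (1, 0))" "fst (D z (1, 0))"]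
          norm_fst_le[of "fst (D z (0, 1))" "snd (D z (0, 1))"] norm_snd_le[of "snd (D z (0, 1))" "fst (D z (0, 1))"]
        by auto
      have det: "\<bar>1 / det_plane (D z)\<bar> \<le> C"
        using det_ge[OF z] det_nonzero[of z] z by (auto simp: divide_simps mult.commute)
      \<comment> \<open>The entries of the inverse matrix are, up to sign, entries of
        \<open>D z\<close> over the determinant, so at most \<open>C * C\<close>. The square of a
        sum of two terms gives \<open>2 * C ^ 4\<close> for each partial derivative and
        \<open>4 * C ^ 4\<close> for both.\<close>
      have bound: "(m / det_plane (D z) * X + n / det_plane (D z) * Y)\<^sup>2 \<le> 2 * C ^ 4 * (X\<^sup>2 + Y\<^sup>2)"
        if "\<bar>m\<bar> \<le> C" "\<bar>n\<bar> \<le> C" for m n X Y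
      proof -
        have sq: "(k / det_plane (D z))\<^sup>2 \<le> C ^ 4" if k: "\<bar>k\<bar> \<le> C" for k
        proof -
          have "\<bar>k\<bar> * \<bar>1 / det_plane (D z)\<bar> \<le> C * C" using k det C_pos by (intro mult_mono) auto
          then have "\<bar>k / det_plane (D z)\<bar> \<le> C\<^sup>2" by (simp add: power2_eq_square)
          moreover have "(C\<^sup>2)\<^sup>2 = C ^ 4" by (simp flip: power_mult)
          ultimately show ?thesis using power_mono[of "\<bar>k / det_plane (D z)\<bar>" "C\<^sup>2" 2] by (simp only: power2_abs abs_ge_zero)
        qed
        have "(m / det_plane (D z) * X + n / det_plane (D z) * Y)\<^sup>2
            \<le> 2 * (m / det_plane (D z) * X)\<^sup>2 + 2 * (n / det_plane (D z) * Y)\<^sup>2"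
          using zero_le_power2[of "m / det_plane (D z) * X - n / det_plane (D z) * Y"]
          by (simp add: power2_sum power2_diff)
        also have "\<dots> \<le> 2 * (C ^ 4 * X\<^sup>2) + 2 * (C ^ 4 * Y\<^sup>2)"
          unfolding power_mult_distrib[of "_ / _"] using that by (intro add_mono mult_left_mono mult_right_mono sq) auto
        finally show ?thesis by (simp add: algebra_simps)
      qed
      have "(Q z (1, 0))\<^sup>2 \<le> 2 * C ^ 4 * ((Gx z)\<^sup>2 + (Gy z)\<^sup>2)"
        using bound[of ?s "- ?q" "Gx z" "Gy z"] abs by (simp add: Q_def Dinv_def)
      moreover have "(Q z (0, 1))\<^sup>2 \<le> 2 * C ^ 4 * ((Gx z)\<^sup>2 + (Gy z)\<^sup>2)"
        using bound[of "- ?r" ?p "Gx z" "Gy z"] abs by (simp add: Q_def Dinv_def)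
      ultimately show ?thesis unfolding fd by linarith
    qed
  qed
qed

end

section \<open>Frequency components of a trigonometric polynomial and their conjugates\<close>

definition tcomp :: "(nat \<Rightarrow> real) \<Rightarrow> (nat \<Rightarrow> real) \<Rightarrow> nat \<Rightarrow> real \<Rightarrow> real" where
  "tcomp r s n x = r n * sin (real n * pi * x) + s n * cos (real n * pi * x)"

lemma tcomp_cont: "continuous_on S (tcomp r s n)"
  unfolding tcomp_def by (intro continuous_intros)

lemma fourier_family_tcomp: "fourier_family (tcomp r s)"
proof
  show "continuous_on UNIV (tcomp r s n)" for n by (rule tcomp_cont)
  show "tcomp r s n (x + 2) = tcomp r s n x" for n x
  proof -
    have "real n * pi * (x + 2) = real n * pi * x + 2 * real n * pi" by (simp add: algebra_simps)
    then show ?thesis unfolding tcomp_def by (simp only: sin_add cos_add sin_2npi cos_2npi) simp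
  qed
  show "tcomp r s n (x + h) + tcomp r s n (x - h) = 2 * cos (real n * pi * h) * tcomp r s n x" for n x h
    unfolding tcomp_def distrib_left right_diff_distrib sin_add sin_diff cos_add cos_diff
    by (simp add: algebra_simps)
qed

lemma DERIV_tcomp:
  "(tcomp r s n has_real_derivative (real n * pi * tcomp (\<lambda>n. - s n) r n x)) (at x)"
  unfolding tcomp_def by (auto intro!: derivative_eq_intros simp: algebra_simps)

text \<open>The angular derivative turns a component into a multiple of its conjugate, which is the
  component shifted by a quarter of its wave length, \<open>1 / (2 * n)\<close>; shifts preserve the
  energy. At frequency 0 there is no such shift.\<close>

lemma E_tcomp_conjugate:
  assumes "n \<noteq> 0"
  shows "fourier_family.E (tcomp (\<lambda>n. - s n) r) n = fourier_family.E (tcomp r s) n"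
proof -
  interpret e: fourier_family "tcomp r s" by (rule fourier_family_tcomp)
  interpret e': fourier_family "tcomp (\<lambda>n. - s n) r" by (rule fourier_family_tcomp)
  have "tcomp (\<lambda>n. - s n) r n x = tcomp r s n (x + 1 / (2 * real n))" for x
  proof -
    have "real n * pi * (x + 1 / (2 * real n)) = real n * pi * x + pi / 2"
      using assms by (simp add: field_simps)
    then show ?thesis unfolding tcomp_def by (simp only: sin_add cos_add sin_pi_half cos_pi_half) simp
  qed
  moreover have "(\<integral>x. (tcomp r s n (x + 1 / (2 * real n)))\<^sup>2 \<partial>per) = (\<integral>x. (tcomp r s n x)\<^sup>2 \<partial>per)"
    using assms by (intro integral_shift_period(2) L2_D(2)[OF e.e_L2]) (auto simp: e.e_per divide_simps)
  ultimately show ?thesis unfolding e.E_def e'.E_def by simp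
qed

text \<open>A truncated polynomial of class C^1 with value 1 at 0 and support [-1, 1], serving as
  cut-off.\<close>

definition cap :: "real \<Rightarrow> real" where "cap x = (max 0 (1 - x\<^sup>2))\<^sup>2"

definition cap' :: "real \<Rightarrow> real" where "cap' x = - 4 * x * max 0 (1 - x\<^sup>2)"

lemma DERIV_pos_part_power2: "((\<lambda>y. (max 0 y)\<^sup>2) has_real_derivative 2 * max 0 y) (at (y :: real))"
proof (cases y "0 :: real" rule: linorder_cases)
  case greater
  have "((\<lambda>y. y\<^sup>2) has_real_derivative 2 * max 0 y) (at y)"
    using greater by (auto intro!: derivative_eq_intros)
  moreover have "\<forall>\<^sub>F u in nhds y. (max 0 u)\<^sup>2 = u\<^sup>2"
    using eventually_nhds_in_open[of "{0<..}" y] greater by (auto elim!: eventually_mono)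
  ultimately show ?thesis by (simp only: DERIV_cong_ev[OF refl _ refl])
next
  case less
  have "((\<lambda>y. 0) has_real_derivative 2 * max 0 y) (at y)"
    using less by (auto intro!: derivative_eq_intros)
  moreover have "\<forall>\<^sub>F u in nhds y. (max 0 u)\<^sup>2 = 0"
    using eventually_nhds_in_open[of "{..<0}" y] less by (auto elim!: eventually_mono)
  ultimately show ?thesis by (simp only: DERIV_cong_ev[OF refl _ refl])
next
  case equal
  have "((\<lambda>h. ((max 0 (0 + h))\<^sup>2 - (max 0 0)\<^sup>2) / h) \<longlongrightarrow> (0::real)) (at 0)"
  proof (rule Lim_null_comparison)
    show "((\<lambda>h. \<bar>h\<bar>) \<longlongrightarrow> (0::real)) (at 0)" by (auto intro!: tendsto_eq_intros)
    have "norm (((max 0 (0 + h))\<^sup>2 - (max 0 0)\<^sup>2) / h) \<le> \<bar>h\<bar>" for h :: real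
      by (cases "0 < h") (auto simp: max_def power2_eq_square)
    then show "\<forall>\<^sub>F h in at 0. norm (((max 0 (0 + h))\<^sup>2 - (max 0 0)\<^sup>2) / h) \<le> \<bar>h :: real\<bar>" by simp
  qed
  then show ?thesis using equal by (simp add: DERIV_def)
qed

lemma DERIV_cap: "(cap has_real_derivative cap' x) (at x)"
proof -
  have "((\<lambda>x. 1 - x\<^sup>2) has_real_derivative (- 2 * x)) (at x)"
    by (auto intro!: derivative_eq_intros)
  from DERIV_chain'[OF this DERIV_pos_part_power2]
  show ?thesis by (simp add: cap_def[abs_def] cap'_def mult_ac)
qed

lemma cap'_cont: "continuous_on S cap'"
  unfolding cap'_def by (intro continuous_intros)

lemma cap_cont: "continuous_on S cap"
  unfolding cap_def by (intro continuous_intros)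

lemma cap_simps: "cap 0 = 1" "1 \<le> \<bar>x\<bar> \<Longrightarrow> cap x = 0" "1 \<le> \<bar>x\<bar> \<Longrightarrow> cap' x = 0"
  "(cap x)\<^sup>2 \<le> 1" "(cap' x)\<^sup>2 \<le> 16"
proof -
  have *: "max 0 (1 - x\<^sup>2) = 0" if "1 \<le> \<bar>x\<bar>" for x :: real
    using power_mono[OF that, of 2] by simp
  show "cap 0 = 1" "1 \<le> \<bar>x\<bar> \<Longrightarrow> cap x = 0" "1 \<le> \<bar>x\<bar> \<Longrightarrow> cap' x = 0"
    using * by (auto simp: cap_def cap'_def)
  have m: "0 \<le> max 0 (1 - x\<^sup>2)" "max 0 (1 - x\<^sup>2) \<le> 1" by auto
  then show "(cap x)\<^sup>2 \<le> 1" unfolding cap_def by (simp add: power_le_one)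
  show "(cap' x)\<^sup>2 \<le> 16"
  proof (cases "1 \<le> \<bar>x\<bar>")
    case False
    have "\<bar>cap' x\<bar> = 4 * \<bar>x\<bar> * max 0 (1 - x\<^sup>2)" by (simp add: cap'_def abs_mult)
    also have "\<dots> \<le> 4 * 1 * 1" using False m by (intro mult_mono) auto
    finally have "\<bar>cap' x\<bar> \<le> 4" by simp
    from power_mono[OF this abs_ge_zero, of 2] show ?thesis by simp
  qed (use * in \<open>simp add: cap'_def\<close>)
qed

context machine_bounds
begin

section \<open>Radial profiles and the energy of the lifting\<close>

definition \<delta> :: real where "\<delta> = min (b - c) (c - a) / 2"

lemma \<delta>_props: "0 < \<delta>" "a < c - \<delta>" "c + \<delta> < b"
  using ac cb by (auto simp: \<delta>_def min_def field_simps)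

text \<open>The profile \<open>B n\<close> stands in for the decay \<open>exp (- n \<bar>\<rho> - c\<bar>)\<close> of the harmonic extension of
  frequency \<open>n\<close>; being $C^1$ and of compact support it needs no correction at the boundary.\<close>

definition B :: "nat \<Rightarrow> real \<Rightarrow> real" where "B n \<rho> = cap ((1 + real n) / \<delta> * (\<rho> - c))"

definition B' :: "nat \<Rightarrow> real \<Rightarrow> real" where
  "B' n \<rho> = cap' ((1 + real n) / \<delta> * (\<rho> - c)) * ((1 + real n) / \<delta>)"

lemma DERIV_B: "(B n has_real_derivative B' n \<rho>) (at \<rho>)"
proof -
  have "((\<lambda>\<rho>. (1 + real n) / \<delta> * (\<rho> - c)) has_real_derivative ((1 + real n) / \<delta>)) (at \<rho>)"
    using \<delta>_props(1) by (auto intro!: derivative_eq_intros)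
  from DERIV_chain'[OF this DERIV_cap] show ?thesis by (simp add: B_def[abs_def] B'_def mult.commute)
qed

lemma B_cont: "continuous_on S (B n)" "continuous_on S (B' n)"
  unfolding B_def B'_def
  by (intro continuous_intros continuous_on_compose2[OF cap_cont[of UNIV]] continuous_on_compose2[OF cap'_cont[of UNIV]]; simp)+

lemma B_c: "B n c = 1"
  by (simp add: B_def cap_simps)

lemma B_outside:
  assumes "\<delta> / (1 + real n) \<le> \<bar>\<rho> - c\<bar>"
  shows "B n \<rho> = 0" "B' n \<rho> = 0"
proof -
  have "1 \<le> \<bar>(1 + real n) / \<delta> * (\<rho> - c)\<bar>"
  proof -
    have "\<bar>(1 + real n) / \<delta> * (\<rho> - c)\<bar> = (1 + real n) / \<delta> * \<bar>\<rho> - c\<bar>"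
      using \<delta>_props(1) by (simp add: abs_mult)
    moreover have "1 \<le> (1 + real n) / \<delta> * \<bar>\<rho> - c\<bar>"
      using assms \<delta>_props(1) by (simp add: field_simps)
    ultimately show ?thesis by simp
  qed
  then show "B n \<rho> = 0" "B' n \<rho> = 0" by (auto simp: B_def B'_def cap_simps)
qed

text \<open>On this side of the interface the profile lives on a strip of width
  \<open>\<delta> / (1 + n)\<close>, where the integrand is of order \<open>(1 + n)\<^sup>2\<close>;
  the product is linear in \<open>1 + n\<close>, the weight of H^{1/2}. In
  \<open>17 + 16 / \<delta>\<^sup>2\<close> the terms come from bounding the square of the profile
  by 1, \<open>pi\<^sup>2\<close> by 16 and the square of \<open>cap'\<close> by 16.\<close>

lemma B_energy:
  "integral {c..b} (\<lambda>\<rho>. (B n \<rho>)\<^sup>2 + (B n \<rho> * (real n * pi))\<^sup>2 + (B' n \<rho>)\<^sup>2)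
    \<le> (17 * \<delta> + 16 / \<delta>) * (1 + real n)"
proof -
  let ?f = "\<lambda>\<rho>. (B n \<rho>)\<^sup>2 + (B n \<rho> * (real n * pi))\<^sup>2 + (B' n \<rho>)\<^sup>2"
  let ?X = "(17 + 16 / \<delta>\<^sup>2) * (1 + real n)\<^sup>2"
  define l where "l = \<delta> / (1 + real n)"
  have "\<delta> * 1 \<le> \<delta> * (1 + real n)" using \<delta>_props(1) by (intro mult_left_mono) auto
  then have l: "0 < l" "l \<le> \<delta>" using \<delta>_props(1) by (auto simp: l_def field_simps)
  then have lb: "c + l \<le> b" using \<delta>_props(3) by linarith
  have cf: "continuous_on S ?f" for S by (intro continuous_intros B_cont)
  have split: "integral {c..b} ?f = integral {c..c+l} ?f + integral {c+l..b} ?f"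
    using l lb cf by (intro Henstock_Kurzweil_Integration.integral_combine[symmetric] integrable_continuous_real) auto
  have outer: "integral {c+l..b} ?f = integral {c+l..b} (\<lambda>_. 0)"
    by (intro integral_cong) (use B_outside[of n] l in \<open>auto simp: l_def[symmetric]\<close>)
  have inner: "integral {c..c+l} ?f \<le> integral {c..c+l} (\<lambda>_. ?X)"
  proof (intro integral_le integrable_continuous_real cf)
    fix \<rho>
    have "(B n \<rho>)\<^sup>2 \<le> 1" by (simp add: B_def cap_simps)
    moreover have "(B' n \<rho>)\<^sup>2 \<le> 16 * ((1 + real n) / \<delta>)\<^sup>2"
      unfolding B'_def power_mult_distrib by (intro mult_right_mono cap_simps) auto
    moreover have "(B n \<rho> * (real n * pi))\<^sup>2 \<le> 1 * ((1 + real n)\<^sup>2 * 16)"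
    proof -
      have "(real n)\<^sup>2 \<le> (1 + real n)\<^sup>2" by (intro power_mono) auto
      moreover have "pi\<^sup>2 \<le> 4\<^sup>2" using pi_less_4 pi_ge_zero by (intro power_mono) auto
      ultimately have "(real n)\<^sup>2 * pi\<^sup>2 \<le> (1 + real n)\<^sup>2 * 16" by (intro mult_mono) auto
      from mult_mono[OF \<open>(B n \<rho>)\<^sup>2 \<le> 1\<close> this] show ?thesis by (simp add: power_mult_distrib)
    qed
    moreover have "1 \<le> (1 + real n)\<^sup>2" by (simp add: one_le_power)
    moreover have "?X = (1 + real n)\<^sup>2 + (1 + real n)\<^sup>2 * 16 + 16 * ((1 + real n) / \<delta>)\<^sup>2"
      by (simp add: power_divide algebra_simps)
    ultimately show "?f \<rho> \<le> ?X" by linarith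
  qed auto
  have "integral {c..b} ?f \<le> integral {c..c+l} (\<lambda>_. ?X)" using split outer inner by simp
  also have "\<dots> = l * ?X" using l by simp
  also have "\<dots> = (17 * \<delta> + 16 / \<delta>) * (1 + real n)"
  proof -
    have "\<delta> / m * ((17 + 16 / \<delta>\<^sup>2) * m\<^sup>2) = (17 * \<delta> + 16 / \<delta>) * m" if "0 < m" for m
      using that \<delta>_props(1) by (simp add: power2_eq_square field_simps)
    then show ?thesis unfolding l_def by simp
  qed
  finally show ?thesis .
qed

text \<open>The factor \<open>9 * C ^ 6\<close> bounds the pulled back integrand pointwise, one more
  \<open>C\<close> comes from \<open>area_le\<close>, and the bracket from
  \<open>B_energy\<close>.\<close>

definition lift_const :: real where "lift_const = 9 * C ^ 7 * (17 * \<delta> + 16 / \<delta>)"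

lemma lift_const_pos: "0 < lift_const"
  using C_pos \<delta>_props(1) by (auto simp: lift_const_def intro!: mult_pos_pos add_pos_pos)

text \<open>Every frequency is damped away from the interface by its own profile. At fixed radius
  the components are orthogonal in the angle, so the energy splits into a sum over frequencies, and
  \<open>B_energy\<close> supplies the weight \<open>1 + n\<close> of each. The zero values at radii
  \<open>a\<close> and \<open>b\<close> place \<open>v\<close> in the space with homogeneous
  boundary conditions.\<close>

lemma trig_lift:
  obtains v where "Ck 1 UNIV v" "\<And>t. v (\<gamma> t) = 1 / J t * fourier_family.trig (tcomp r s) \<alpha> N t"
    "\<And>\<xi>. v (F (\<xi>, a)) = 0" "\<And>\<xi>. v (F (\<xi>, b)) = 0"
    "(H1_norm \<Omega>1 v)\<^sup>2 \<le> lift_const * (\<Sum>n\<le>N. (1 + real n) * ((\<alpha> n)\<^sup>2 * fourier_family.E (tcomp r s) n))"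
proof -
  let ?e = "tcomp r s" and ?e' = "tcomp (\<lambda>n. - s n) r"
  interpret e: fourier_family ?e by (rule fourier_family_tcomp)
  interpret e': fourier_family ?e' by (rule fourier_family_tcomp)
  define K where "K \<xi> = 1 / J \<xi>" for \<xi>
  define K' where "K' \<xi> = - J' \<xi> / (J \<xi>)\<^sup>2" for \<xi>
  have Jne: "J x \<noteq> 0" for x using J_pos[of x] by simp
  have K: "(K has_real_derivative K' \<xi>) (at \<xi>)" for \<xi>
    using inverse_J_derivative by (simp add: K_def[abs_def] K'_def)
  have Kc: "continuous_on S K" "continuous_on S K'" for S
    unfolding K_def K'_def by (intro continuous_intros J_cont J'_cont; simp add: Jne)+
  have Kb: "(K x)\<^sup>2 \<le> C\<^sup>2" "(K' x)\<^sup>2 \<le> C\<^sup>2" for x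
    using power_mono[OF inverse_J_le[of x] abs_ge_zero, of 2] power_mono[OF K'_le[of x] abs_ge_zero, of 2]
    by (simp_all only: K_def K'_def power2_abs minus_divide_left[symmetric] power2_minus)
  \<comment> \<open>\<open>T0\<close> is the lifted polynomial without the factor \<open>K\<close>;
    \<open>T1\<close> and \<open>T2\<close> are its angular and radial derivatives, the former in
    the conjugate family.\<close>
  define T0 where "T0 z = e.trig (\<lambda>n. \<alpha> n * B n (snd z)) N (fst z)" for z
  define T1 where "T1 z = e'.trig (\<lambda>n. \<alpha> n * (B n (snd z) * (real n * pi))) N (fst z)" for z
  define T2 where "T2 z = e.trig (\<lambda>n. \<alpha> n * B' n (snd z)) N (fst z)" for z
  define G where "G z = K (fst z) * T0 z" for z
  define Gx where "Gx z = K' (fst z) * T0 z + K (fst z) * T1 z" for z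
  define Gy where "Gy z = K (fst z) * T2 z" for z
  have Tc: "continuous_on S T0" "continuous_on S T1" "continuous_on S T2" for S
    unfolding T0_def T1_def T2_def e.trig_def e'.trig_def
    by (intro continuous_intros continuous_on_compose2[OF B_cont(1)[of UNIV]] continuous_on_compose2[OF B_cont(2)[of UNIV]]
        continuous_on_compose2[OF tcomp_cont[of UNIV]]; simp)+
  have Gc: "continuous_on S G" "continuous_on S Gx" "continuous_on S Gy" for S
    unfolding G_def Gx_def Gy_def
    by (intro continuous_intros Tc continuous_on_compose2[OF Kc(1)[of UNIV]] continuous_on_compose2[OF Kc(2)[of UNIV]]; simp)+
  have fst_der: "(fst has_derivative fst) (at z)" and snd_der: "(snd has_derivative snd) (at z)" for z :: plane
    by (auto intro!: derivative_eq_intros)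
  have T0_der: "(T0 has_derivative (\<lambda>h. fst h * T1 z + snd h * T2 z)) (at z)" for z
  proof -
    have "((\<lambda>z. \<alpha> n * B n (snd z) * ?e n (fst z)) has_derivative
        (\<lambda>h. fst h * (\<alpha> n * (B n (snd z) * (real n * pi)) * ?e' n (fst z)) + snd h * (\<alpha> n * B' n (snd z) * ?e n (fst z)))) (at z)" for n
    proof -
      note 1 = DERIV_compose_FDERIV[OF DERIV_B snd_der, of n z] and 2 = DERIV_compose_FDERIV[OF DERIV_tcomp fst_der, of r s n z]
      show ?thesis
        by (rule has_derivative_eq_rhs[OF has_derivative_mult[OF has_derivative_mult_right[OF 1] 2]])
          (auto simp: fun_eq_iff algebra_simps)
    qed
    from has_derivative_sum[where I = "{..N}", OF this] show ?thesis
      unfolding T0_def[abs_def] T1_def T2_def e.trig_def e'.trig_def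
      by (simp add: sum.distrib sum_distrib_left)
  qed
  have G_der: "(G has_derivative (\<lambda>h. fst h * Gx z + snd h * Gy z)) (at z)" for z
    unfolding G_def[abs_def]
    by (rule has_derivative_eq_rhs[OF has_derivative_mult[OF DERIV_compose_FDERIV[OF K fst_der] T0_der]])
      (auto simp: fun_eq_iff Gx_def Gy_def algebra_simps)
  have G_per: "G (\<xi> + 2, \<rho>) = G (\<xi>, \<rho>)" for \<xi> \<rho>
    by (simp add: G_def T0_def K_def J_periodic e.trig_per)
  have G_supp: "G (\<xi>, \<rho>) = 0" if "\<rho> \<notin> {c-\<delta>..c+\<delta>}" for \<xi> \<rho>
  proof -
    have "B n \<rho> = 0" for n
    proof (rule B_outside(1))
      have "\<delta> / (1 + real n) \<le> \<delta> / 1" using \<delta>_props(1) by (intro divide_left_mono) auto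
      then show "\<delta> / (1 + real n) \<le> \<bar>\<rho> - c\<bar>" using that by auto
    qed
    then show ?thesis by (simp add: G_def T0_def e.trig_def)
  qed
  obtain v where v: "Ck 1 UNIV v" "\<And>\<xi> \<rho>. \<rho> \<in> {a..b} \<Longrightarrow> v (F (\<xi>, \<rho>)) = G (\<xi>, \<rho>)"
    "\<And>z. z \<in> {-1..1} \<times> {a..b} \<Longrightarrow>
      (frechet_derivative v (at (F z)) (1, 0))\<^sup>2 + (frechet_derivative v (at (F z)) (0, 1))\<^sup>2
        \<le> 4 * C ^ 4 * ((Gx z)\<^sup>2 + (Gy z)\<^sup>2)"
    by (rule annulus_function[OF \<delta>_props G_der Gc(2,3) G_per]) (rule G_supp, assumption, rule that)
  define \<psi> where "\<psi> x = (v x)\<^sup>2 + ((frechet_derivative v (at x) (1, 0))\<^sup>2 + (frechet_derivative v (at x) (0, 1))\<^sup>2)" for x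
  have \<psi>: "continuous_on UNIV \<psi>" "\<And>x. 0 \<le> \<psi> x"
    unfolding \<psi>_def
    by (intro continuous_intros C1_D(2)[OF v(1)] C1_D(3)[OF v(1) Basis_plane(1)] C1_D(3)[OF v(1) Basis_plane(2)]) simp
  let ?R = "cbox (-1, c) (1, b) :: plane set"
  let ?\<Phi> = "\<lambda>z. 9 * C ^ 6 * ((T0 z)\<^sup>2 + (T1 z)\<^sup>2 + (T2 z)\<^sup>2)"
  have pow: "C ^ 2 \<le> C ^ 6" using C_ge_1 by (intro power_increasing) auto
  have pt: "\<psi> (F z) \<le> ?\<Phi> z" if z: "z \<in> ?R" for z
  proof -
    have z': "z \<in> {-1..1} \<times> {a..b}" "snd z \<in> {a..b}" using z ac by (auto simp: cbox_Pair_eq)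
    have g: "(G z)\<^sup>2 \<le> C\<^sup>2 * (T0 z)\<^sup>2" "(Gy z)\<^sup>2 \<le> C\<^sup>2 * (T2 z)\<^sup>2"
      unfolding G_def Gy_def power_mult_distrib by (intro mult_right_mono Kb; simp)+
    have gx: "(Gx z)\<^sup>2 \<le> 2 * (C\<^sup>2 * (T0 z)\<^sup>2) + 2 * (C\<^sup>2 * (T1 z)\<^sup>2)"
    proof -
      have "(Gx z)\<^sup>2 \<le> 2 * (K' (fst z) * T0 z)\<^sup>2 + 2 * (K (fst z) * T1 z)\<^sup>2"
        unfolding Gx_def using zero_le_power2[of "K' (fst z) * T0 z - K (fst z) * T1 z"]
        by (simp add: power2_sum power2_diff)
      also have "\<dots> \<le> 2 * (C\<^sup>2 * (T0 z)\<^sup>2) + 2 * (C\<^sup>2 * (T1 z)\<^sup>2)"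
        unfolding power_mult_distrib by (intro add_mono mult_left_mono mult_right_mono Kb) auto
      finally show ?thesis .
    qed
    have "v (F z) = G z" using v(2)[OF z'(2), of "fst z"] by simp
    then have "\<psi> (F z) \<le> (G z)\<^sup>2 + 4 * C ^ 4 * ((Gx z)\<^sup>2 + (Gy z)\<^sup>2)"
      unfolding \<psi>_def using v(3)[OF z'(1)] by simp
    also have "\<dots> \<le> C\<^sup>2 * (T0 z)\<^sup>2 + 4 * C ^ 4 * ((2 * (C\<^sup>2 * (T0 z)\<^sup>2) + 2 * (C\<^sup>2 * (T1 z)\<^sup>2)) + C\<^sup>2 * (T2 z)\<^sup>2)"
      using g gx C_pos by (intro add_mono mult_left_mono) auto
    also have "\<dots> = C ^ 2 * (T0 z)\<^sup>2 + 8 * (C ^ 6 * (T0 z)\<^sup>2) + 8 * (C ^ 6 * (T1 z)\<^sup>2) + 4 * (C ^ 6 * (T2 z)\<^sup>2)"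
      by (simp add: algebra_simps flip: power_add)
    \<comment> \<open>The 9 is 1 from \<open>G\<close> itself plus 8 from its angular derivative,
      after raising \<open>C ^ 2\<close> to \<open>C ^ 6\<close>.\<close>
    also have "\<dots> \<le> C ^ 6 * (T0 z)\<^sup>2 + 8 * (C ^ 6 * (T0 z)\<^sup>2) + 9 * (C ^ 6 * (T1 z)\<^sup>2) + 9 * (C ^ 6 * (T2 z)\<^sup>2)"
      using pow C_pos by (intro add_mono mult_right_mono) auto
    also have "\<dots> = ?\<Phi> z" by (simp add: algebra_simps)
    finally show ?thesis .
  qed
  define S where "S \<rho> = (\<Sum>n\<le>N. (\<alpha> n)\<^sup>2 * e.E n * ((B n \<rho>)\<^sup>2 + (B n \<rho> * (real n * pi))\<^sup>2 + (B' n \<rho>)\<^sup>2))" for \<rho>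
  have inner: "integral (cbox (-1) 1) (\<lambda>\<xi>. ?\<Phi> (\<xi>, \<rho>)) = 9 * C ^ 6 * S \<rho>" for \<rho>
  proof -
    let ?t0 = "e.trig (\<lambda>n. \<alpha> n * B n \<rho>) N" and ?t1 = "e'.trig (\<lambda>n. \<alpha> n * (B n \<rho> * (real n * pi))) N"
      and ?t2 = "e.trig (\<lambda>n. \<alpha> n * B' n \<rho>) N"
    note i = L2_D(2)[OF e.trig_L2, of "\<lambda>n. \<alpha> n * B n \<rho>" N] L2_D(2)[OF e'.trig_L2, of "\<lambda>n. \<alpha> n * (B n \<rho> * (real n * pi))" N]
      L2_D(2)[OF e.trig_L2, of "\<lambda>n. \<alpha> n * B' n \<rho>" N]
    have "continuous_on UNIV (\<lambda>\<xi>. 9 * C ^ 6 * ((?t0 \<xi>)\<^sup>2 + (?t1 \<xi>)\<^sup>2 + (?t2 \<xi>)\<^sup>2))"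
      by (intro continuous_intros e.trig_cont e'.trig_cont)
    from continuous_per(2)[OF this, symmetric]
    have "integral (cbox (-1) 1) (\<lambda>\<xi>. ?\<Phi> (\<xi>, \<rho>)) = (\<integral>\<xi>. 9 * C ^ 6 * ((?t0 \<xi>)\<^sup>2 + (?t1 \<xi>)\<^sup>2 + (?t2 \<xi>)\<^sup>2) \<partial>per)"
      by (simp only: T0_def T1_def T2_def fst_conv snd_conv cbox_interval)
    also have "\<dots> = 9 * C ^ 6 * ((\<integral>\<xi>. (?t0 \<xi>)\<^sup>2 \<partial>per) + (\<integral>\<xi>. (?t1 \<xi>)\<^sup>2 \<partial>per) + (\<integral>\<xi>. (?t2 \<xi>)\<^sup>2 \<partial>per))"
      using i by simp
    finally have 1: "integral (cbox (-1) 1) (\<lambda>\<xi>. ?\<Phi> (\<xi>, \<rho>))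
      = 9 * C ^ 6 * ((\<integral>\<xi>. (?t0 \<xi>)\<^sup>2 \<partial>per) + (\<integral>\<xi>. (?t1 \<xi>)\<^sup>2 \<partial>per) + (\<integral>\<xi>. (?t2 \<xi>)\<^sup>2 \<partial>per))" .
    have 2: "(\<integral>\<xi>. (?t1 \<xi>)\<^sup>2 \<partial>per) = (\<Sum>n\<le>N. (\<alpha> n * (B n \<rho> * (real n * pi)))\<^sup>2 * e.E n)"
      unfolding e'.integral_trig_power2
    proof (intro sum.cong refl)
      fix n
      \<comment> \<open>At \<open>n = 0\<close> both sides vanish through the factor
        \<open>n * pi\<close>; this is the frequency that \<open>E_tcomp_conjugate\<close>
        excludes.\<close>
      show "(\<alpha> n * (B n \<rho> * (real n * pi)))\<^sup>2 * e'.E n = (\<alpha> n * (B n \<rho> * (real n * pi)))\<^sup>2 * e.E n"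
        by (cases "n = 0") (simp_all add: E_tcomp_conjugate)
    qed
    have "(\<Sum>n\<le>N. (\<alpha> n * B n \<rho>)\<^sup>2 * e.E n) + (\<Sum>n\<le>N. (\<alpha> n * (B n \<rho> * (real n * pi)))\<^sup>2 * e.E n)
        + (\<Sum>n\<le>N. (\<alpha> n * B' n \<rho>)\<^sup>2 * e.E n) = S \<rho>"
      unfolding S_def sum.distrib[symmetric]
      by (intro sum.cong refl) (simp add: power_mult_distrib algebra_simps)
    then show ?thesis unfolding 1 2 e.integral_trig_power2 by simp
  qed
  have cPhi: "continuous_on X ?\<Phi>" for X by (intro continuous_intros Tc)
  have R: "?R \<subseteq> UNIV \<times> {a..b}" using ac by (auto simp: cbox_Pair_eq)
  have "(H1_norm \<Omega>1 v)\<^sup>2 = (\<integral>x. \<psi> x \<partial>lebesgue_on \<Omega>1)"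
    unfolding \<psi>_def by (rule H1_norm_C1_plane[OF v(1) \<Omega>_props(3,4)])
  also have "\<dots> \<le> C * integral ?R (\<lambda>x. \<psi> (F x))" by (rule area_le[OF \<psi>])
  also have le_Phi: "\<dots> \<le> C * integral ?R ?\<Phi>"
  proof (intro mult_left_mono integral_le pt)
    show "(\<lambda>x. \<psi> (F x)) integrable_on ?R"
      by (intro integrable_continuous continuous_on_compose2[OF \<psi>(1)] continuous_on_subset[OF F_cont R]) auto
    show "?\<Phi> integrable_on ?R" by (intro integrable_continuous cPhi)
  qed (use C_pos in auto)
  finally have upper: "(H1_norm \<Omega>1 v)\<^sup>2 \<le> C * integral ?R ?\<Phi>" .
  have "integral ?R ?\<Phi> = integral (cbox (-1) 1) (\<lambda>\<xi>. integral (cbox c b) (\<lambda>\<rho>. ?\<Phi> (\<xi>, \<rho>)))"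
    by (rule integral_prod_continuous[OF cPhi])
  \<comment> \<open>The angle is made the inner variable, since orthogonality holds at a fixed
    radius.\<close>
  also have "\<dots> = integral (cbox c b) (\<lambda>\<rho>. integral (cbox (-1) 1) (\<lambda>\<xi>. ?\<Phi> (\<xi>, \<rho>)))"
    by (rule integral_swap_continuous) (use cPhi in \<open>simp add: split_beta\<close>)
  also have "\<dots> = integral {c..b} (\<lambda>\<rho>. 9 * C ^ 6 * S \<rho>)"
    unfolding inner by (simp only: cbox_interval)
  also have "\<dots> = 9 * C ^ 6 * integral {c..b} S" by (rule integral_mult_right)
  finally have fubini: "integral ?R ?\<Phi> = 9 * C ^ 6 * integral {c..b} S" .
  let ?b = "\<lambda>n \<rho>. (B n \<rho>)\<^sup>2 + (B n \<rho> * (real n * pi))\<^sup>2 + (B' n \<rho>)\<^sup>2"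
  have "(?b n) integrable_on {c..b}" for n
    by (intro integrable_continuous_real continuous_intros B_cont)
  then have "integral {c..b} S = (\<Sum>n\<le>N. integral {c..b} (\<lambda>\<rho>. (\<alpha> n)\<^sup>2 * e.E n * ?b n \<rho>))"
    unfolding S_def by (intro Henstock_Kurzweil_Integration.integral_sum integrable_on_mult_right) auto
  also have "\<dots> = (\<Sum>n\<le>N. (\<alpha> n)\<^sup>2 * e.E n * integral {c..b} (?b n))"
    by (intro sum.cong refl integral_mult_right)
  also have "\<dots> \<le> (\<Sum>n\<le>N. (\<alpha> n)\<^sup>2 * e.E n * ((17 * \<delta> + 16 / \<delta>) * (1 + real n)))"
    by (intro sum_mono mult_left_mono B_energy) (auto simp: e.E_nonneg)
  finally have "C * (9 * C ^ 6 * integral {c..b} S)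
      \<le> C * (9 * C ^ 6 * (\<Sum>n\<le>N. (\<alpha> n)\<^sup>2 * e.E n * ((17 * \<delta> + 16 / \<delta>) * (1 + real n))))"
    using C_pos by (intro mult_left_mono) auto
  also have "\<dots> = lift_const * (\<Sum>n\<le>N. (1 + real n) * ((\<alpha> n)\<^sup>2 * e.E n))"
  proof -
    have "(\<Sum>n\<le>N. (\<alpha> n)\<^sup>2 * e.E n * (x * (1 + real n))) = x * (\<Sum>n\<le>N. (1 + real n) * ((\<alpha> n)\<^sup>2 * e.E n))" for x
      by (simp add: sum_distrib_left mult_ac)
    moreover have "C * (9 * C ^ 6 * (x * y)) = 9 * C ^ 7 * x * y" for x y
      by (simp add: power_numeral_reduce)
    ultimately show ?thesis by (simp only: lift_const_def)
  qed
  finally have "C * integral ?R ?\<Phi> \<le> lift_const * (\<Sum>n\<le>N. (1 + real n) * ((\<alpha> n)\<^sup>2 * e.E n))"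
    unfolding fubini .
  with upper have bound: "(H1_norm \<Omega>1 v)\<^sup>2 \<le> lift_const * (\<Sum>n\<le>N. (1 + real n) * ((\<alpha> n)\<^sup>2 * e.E n))"
    by (rule order_trans)
  show ?thesis
  proof (rule that[OF v(1) _ _ _ bound])
    show "v (\<gamma> t) = 1 / J t * e.trig \<alpha> N t" for t
      using v(2)[of c t] ac cb by (simp add: \<gamma>_def G_def T0_def K_def B_c)
    show "v (F (\<xi>, a)) = 0" "v (F (\<xi>, b)) = 0" for \<xi>
      using v(2)[of a \<xi>] v(2)[of b \<xi>] ac cb G_supp[of a \<xi>] G_supp[of b \<xi>] \<delta>_props by auto
  qed
qed

end

section \<open>The discrete inf-sup condition\<close>

lemma L2_Cauchy_Schwarz:
  assumes "f \<in> L2 M" "g \<in> L2 M"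
  shows "(\<integral>x. f x * g x \<partial>M)\<^sup>2 \<le> (\<integral>x. (f x)\<^sup>2 \<partial>M) * (\<integral>x. (g x)\<^sup>2 \<partial>M)"
proof -
  define p where "p = (\<integral>x. f x * g x \<partial>M)"
  define m where "m = (\<integral>x. (g x)\<^sup>2 \<partial>M)"
  note i = L2_D(2)[OF assms(1)] L2_D(2)[OF assms(2)] L2_mult_integrable[OF assms]
  have m0: "0 \<le> m" by (simp add: m_def)
  show ?thesis
  proof (cases "m = 0")
    case True
    then have "AE x in M. (g x)\<^sup>2 = 0"
      using integral_nonneg_eq_0_iff_AE[OF i(2)] by (simp add: m_def)
    then have "(\<integral>x. f x * g x \<partial>M) = 0" by (intro integral_eq_zero_AE) (auto elim!: eventually_mono)
    then show ?thesis by simp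
  next
    case False
    have "0 \<le> (\<integral>x. (m * f x - p * g x)\<^sup>2 \<partial>M)" by simp
    also have "(\<lambda>x. (m * f x - p * g x)\<^sup>2) = (\<lambda>x. m\<^sup>2 * (f x)\<^sup>2 + p\<^sup>2 * (g x)\<^sup>2 - 2 * m * p * (f x * g x))"
      by (simp add: power2_diff power_mult_distrib algebra_simps)
    also have "(\<integral>x. m\<^sup>2 * (f x)\<^sup>2 + p\<^sup>2 * (g x)\<^sup>2 - 2 * m * p * (f x * g x) \<partial>M)
        = m\<^sup>2 * (\<integral>x. (f x)\<^sup>2 \<partial>M) + p\<^sup>2 * m - 2 * m * p * p"
      using i by (simp add: p_def m_def)
    also have "\<dots> = m * ((\<integral>x. (f x)\<^sup>2 \<partial>M) * m - p\<^sup>2)" by (simp add: algebra_simps power2_eq_square)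
    finally have "0 \<le> (\<integral>x. (f x)\<^sup>2 \<partial>M) * m - p\<^sup>2" using m0 False by (simp add: zero_le_mult_iff)
    then show ?thesis by (simp add: p_def m_def)
  qed
qed

lemma Hhalf_norm_nonneg: "0 \<le> Hhalf_norm M w"
  unfolding Hhalf_norm_def by simp

text \<open>A supremum of reals dominates the members only of a set that is bounded above;
  Cauchy-Schwarz in L^2 supplies the bound, the L^2 norm being part of \<open>Hhalf_norm\<close>. It
  also settles test functions of norm 0.\<close>

lemma pairing_le_Hmhalf_norm:
  assumes f: "f \<in> L2 M" and w: "w \<in> Hhalf M"
  shows "\<bar>pairing M f w\<bar> \<le> Hmhalf_norm M (pairing M f) * Hhalf_norm M w"
proof -
  have L2: "u \<in> L2 M" if "u \<in> Hhalf M" for u using that by (simp add: Hhalf_def)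
  have le: "(\<integral>x. (u x)\<^sup>2 \<partial>M) \<le> (Hhalf_norm M u)\<^sup>2" for u
    unfolding Hhalf_norm_def by (subst real_sqrt_pow2) (auto intro!: add_nonneg_nonneg)
  have bound: "\<bar>pairing M f u\<bar> \<le> sqrt (\<integral>x. (f x)\<^sup>2 \<partial>M) * Hhalf_norm M u" if "u \<in> Hhalf M" for u
  proof (rule power2_le_imp_le)
    have "(\<integral>x. f x * u x \<partial>M)\<^sup>2 \<le> (\<integral>x. (f x)\<^sup>2 \<partial>M) * (\<integral>x. (u x)\<^sup>2 \<partial>M)"
      by (rule L2_Cauchy_Schwarz[OF f L2[OF that]])
    also have "\<dots> \<le> (\<integral>x. (f x)\<^sup>2 \<partial>M) * (Hhalf_norm M u)\<^sup>2"
      by (intro mult_left_mono le) simp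
    finally show "\<bar>pairing M f u\<bar>\<^sup>2 \<le> (sqrt (\<integral>x. (f x)\<^sup>2 \<partial>M) * Hhalf_norm M u)\<^sup>2"
      by (simp add: pairing_def power_mult_distrib)
  qed (simp add: Hhalf_norm_nonneg)
  show ?thesis
  proof (cases "Hhalf_norm M w = 0")
    case True
    then show ?thesis using bound[OF w] by simp
  next
    case False
    then have pos: "0 < Hhalf_norm M w" using Hhalf_norm_nonneg[of M w] by simp
    have "\<bar>pairing M f w\<bar> / Hhalf_norm M w \<le> Hmhalf_norm M (pairing M f)"
      unfolding Hmhalf_norm_def
    proof (rule cSUP_upper)
      show "bdd_above ((\<lambda>w. \<bar>pairing M f w\<bar> / Hhalf_norm M w) ` {w \<in> Hhalf M. Hhalf_norm M w \<noteq> 0})"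
      proof (rule bdd_aboveI2)
        fix u assume "u \<in> {w \<in> Hhalf M. Hhalf_norm M w \<noteq> 0}"
        then have "u \<in> Hhalf M" "0 < Hhalf_norm M u" using Hhalf_norm_nonneg[of M u] by auto
        then show "\<bar>pairing M f u\<bar> / Hhalf_norm M u \<le> sqrt (\<integral>x. (f x)\<^sup>2 \<partial>M)"
          using bound by (simp add: pos_divide_le_eq)
      qed
    qed (use w False in auto)
    then show ?thesis using pos by (simp add: pos_divide_le_eq)
  qed
qed

text \<open>Traces are determined only almost everywhere, while the bounds on the projection are
  applied to a selected trace; this carries membership and norm over to it.\<close>

lemma Hhalf_cong_AE:
  assumes "w \<in> Hhalf M" "w' \<in> borel_measurable M" and ae: "AE x in M. w' x = w x"
  shows "w' \<in> Hhalf M" "Hhalf_norm M w' = Hhalf_norm M w"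
proof -
  have w: "w \<in> L2 M" "slobodeckij M w < \<infinity>" using assms(1) by (auto simp: Hhalf_def)
  then have wm: "w \<in> borel_measurable M" by (simp add: L2_def)
  have s: "slobodeckij M w' = slobodeckij M w"
    unfolding slobodeckij_def
  proof (intro nn_integral_cong_AE)
    show "AE x in M. (\<integral>\<^sup>+y. ennreal ((w' x - w' y)\<^sup>2 / (dist x y)\<^sup>2) \<partial>M) = (\<integral>\<^sup>+y. ennreal ((w x - w y)\<^sup>2 / (dist x y)\<^sup>2) \<partial>M)"
      using ae
    proof eventually_elim
      case (elim x)
      show ?case
        using ae by (intro nn_integral_cong_AE) (auto simp: elim elim!: eventually_mono)
    qed
  qed
  have "integrable M (\<lambda>x. (w' x)\<^sup>2) \<longleftrightarrow> integrable M (\<lambda>x. (w x)\<^sup>2)"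
    using ae wm assms(2) by (intro integrable_cong_AE) (auto elim!: eventually_mono)
  then have "w' \<in> L2 M" using w assms(2) by (simp add: L2_def)
  then show "w' \<in> Hhalf M" using w s by (simp add: Hhalf_def)
  have "(\<integral>x. (w' x)\<^sup>2 \<partial>M) = (\<integral>x. (w x)\<^sup>2 \<partial>M)"
    using ae wm assms(2) by (intro integral_cong_AE) (auto elim!: eventually_mono)
  then show "Hhalf_norm M w' = Hhalf_norm M w" by (simp add: Hhalf_norm_def s)
qed

context machine_bounds
begin

text \<open>A multiplier is known only through its values along \<open>\<gamma>\<close>, so its
  sublevel sets on \<Gamma> are exhibited as images of compact parameter sets. The closed interval
  \<open>{-1..1}\<close> provides the compactness; its two ends give the same point.\<close>

lemma multiplier_measurable:
  fixes \<mu> :: "plane \<Rightarrow> real"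
  assumes "continuous_on UNIV (\<lambda>t. \<mu> (\<gamma> t))"
  shows "\<mu> \<in> borel_measurable M"
proof (rule borel_measurableI_le)
  fix y :: real
  have "{t \<in> {-1..1}. \<mu> (\<gamma> t) \<le> y} = {-1..1} \<inter> {t. \<mu> (\<gamma> t) \<le> y}" by auto
  moreover have "closed ({-1..1} \<inter> {t. \<mu> (\<gamma> t) \<le> y})"
    by (intro closed_Int closed_atLeastAtMost closed_Collect_le assms continuous_on_const)
  ultimately have "closed {t \<in> {-1..1}. \<mu> (\<gamma> t) \<le> y}" by simp
  moreover have "bounded {t \<in> {-1..1}. \<mu> (\<gamma> t) \<le> y}"
    by (rule bounded_subset[of "{-1..1}"]) auto
  ultimately have "compact (\<gamma> ` {t \<in> {-1..1}. \<mu> (\<gamma> t) \<le> y})"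
    by (intro compact_continuous_image \<gamma>_cont) (simp add: compact_eq_bounded_closed)
  then have B: "\<gamma> ` {t \<in> {-1..1}. \<mu> (\<gamma> t) \<le> y} \<in> sets borel" by (rule borel_compact)
  have "{x \<in> space M. \<mu> x \<le> y} = \<Gamma> \<inter> \<gamma> ` {t \<in> {-1..1}. \<mu> (\<gamma> t) \<le> y}"
    unfolding space_M using \<gamma>_in_\<Gamma> by (auto simp: \<Gamma>_eq)
  then show "{x \<in> space M. \<mu> x \<le> y} \<in> sets M"
    using B by (auto simp: sets_M sets_restrict_space)
qed

text \<open>Excludes the empty supremum, so that \<open>cSUP_least\<close> applies to
  \<open>Hmhalf_norm\<close>. The constant 1 is a trigonometric polynomial of degree 0.\<close>

lemma Hhalf_test_nonempty: "{w \<in> Hhalf M. Hhalf_norm M w \<noteq> 0} \<noteq> {}"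
proof -
  let ?r = "\<lambda>_::nat. 0 :: real" and ?s = "\<lambda>_::nat. 1 :: real"
  interpret e: fourier_family "tcomp ?r ?s" by (rule fourier_family_tcomp)
  have w: "(\<lambda>_::plane. 1 :: real) \<in> Hhalf M"
  proof (rule trig_Hhalf(1)[OF fourier_family_tcomp[of ?r ?s], where K = "\<lambda>_. 1" and N = 0 and \<alpha> = "\<lambda>_. 1"])
    show "1 = 1 * e.trig (\<lambda>_. 1) 0 t" for t by (simp add: e.trig_def tcomp_def)
  qed (use C_ge_1 in auto)
  have "0 < (\<integral>x. (1::real)\<^sup>2 \<partial>M)"
  proof -
    have "(\<integral>x. (1::real)\<^sup>2 \<partial>M) = (\<integral>t. J t \<partial>per)" by (subst M_per(3)) auto
    moreover have "(\<integral>t. 1 \<partial>per) \<le> (\<integral>t. C * J t \<partial>per)"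
      by (intro integral_mono continuous_per(1) continuous_intros J_cont J_ge)
    moreover have "(\<integral>t. 1 \<partial>per) = (2 :: real)" by (subst continuous_per(2)) auto
    ultimately have "0 < C * (\<integral>x. (1::real)\<^sup>2 \<partial>M)" by simp
    then show ?thesis using C_pos by (simp add: zero_less_mult_iff)
  qed
  then have "0 < (Hhalf_norm M (\<lambda>_. 1))\<^sup>2"
    unfolding Hhalf_norm_power2[OF w] by (intro add_pos_nonneg) auto
  then have "Hhalf_norm M (\<lambda>_. 1) \<noteq> 0" by auto
  then show ?thesis using w by blast
qed

text \<open>\<open>tcomp r s n\<close> plays the role of \<open>m\<^sub>n\<close>, so this is the
  energy \<open>A\<close>.\<close>

definition dual_energy :: "(nat \<Rightarrow> real) \<Rightarrow> (nat \<Rightarrow> real) \<Rightarrow> nat \<Rightarrow> real" where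
  "dual_energy r s N = (\<Sum>n\<le>N. fourier_family.E (tcomp r s) n / (1 + real n))"

lemma dual_energy_nonneg: "0 \<le> dual_energy r s N"
  unfolding dual_energy_def by (intro sum_nonneg divide_nonneg_nonneg fourier_family.E_nonneg fourier_family_tcomp) auto

lemma Hmhalf_norm_multiplier_le:
  assumes "\<mu> \<in> borel_measurable M" "\<And>t. \<mu> (\<gamma> t) = fourier_family.trig (tcomp r s) (\<lambda>_. 1) N t"
  shows "Hmhalf_norm M (pairing M \<mu>) \<le> sqrt (8 * C ^ 6 * dual_energy r s N)"
  unfolding Hmhalf_norm_def
proof (rule cSUP_least[OF Hhalf_test_nonempty])
  fix w assume "w \<in> {w \<in> Hhalf M. Hhalf_norm M w \<noteq> 0}"
  then have w: "w \<in> Hhalf M" "0 < Hhalf_norm M w" using Hhalf_norm_nonneg[of M w] by auto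
  have "(pairing M \<mu> w)\<^sup>2 \<le> 8 * C ^ 6 * dual_energy r s N * (Hhalf_norm M w)\<^sup>2"
    using trig_pairing_le[OF fourier_family_tcomp w(1) assms] by (simp add: dual_energy_def)
  then have "sqrt ((pairing M \<mu> w)\<^sup>2) \<le> sqrt (8 * C ^ 6 * dual_energy r s N * (Hhalf_norm M w)\<^sup>2)"
    by (rule real_sqrt_le_mono)
  then have "\<bar>pairing M \<mu> w\<bar> \<le> sqrt (8 * C ^ 6 * dual_energy r s N) * Hhalf_norm M w"
    using w(2) by (simp add: real_sqrt_mult)
  then show "\<bar>pairing M \<mu> w\<bar> / Hhalf_norm M w \<le> sqrt (8 * C ^ 6 * dual_energy r s N)"
    using w(2) by (simp add: pos_divide_le_eq)
qed

lemma space_curve_measure: "space (curve_measure F \<rho>) = (\<lambda>\<xi>. F (\<xi>, \<rho>)) ` {-1..<1}"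
  by (simp add: curve_measure_def arc_measure_def space_restrict_space)

lemma \<Omega>_disjoint: "\<Omega>1 \<inter> \<Omega>2 = {}"
proof (rule ccontr)
  assume "\<Omega>1 \<inter> \<Omega>2 \<noteq> {}"
  then obtain x where "x \<in> \<Omega>1" "x \<in> \<Omega>2" by blast
  from this(1) obtain \<xi> \<rho> where 1: "x = F (\<xi>, \<rho>)" "\<rho> \<in> {c<..<b}" unfolding \<Omega>_props by auto
  from \<open>x \<in> \<Omega>2\<close> obtain \<xi>' \<rho>' where 2: "x = F (\<xi>', \<rho>')" "\<rho>' \<in> {a<..<c}" unfolding \<Omega>_props by auto
  from 1 2 have "F (\<xi>, \<rho>) = F (\<xi>', \<rho>')" "\<rho> \<in> {c<..<b}" "\<rho>' \<in> {a<..<c}" by simp_all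
  moreover from this have "\<rho> \<in> {a..b}" "\<rho>' \<in> {a..b}" using ac cb by auto
  ultimately show False using F_eq_D[of \<xi> \<rho> \<xi>' \<rho>'] by (metis greaterThanLessThan_iff less_asym)
qed

text \<open>The constant sequence 0 is admissible as an approximation of \<open>v\<close>. Applied
  on \<Omega>2 to a function that vanishes there, and on \<Omega>1 to exclude a discrete test
  function of norm 0.\<close>

lemma zero_trace:
  assumes "\<Omega> = \<Omega>1 \<or> \<Omega> = \<Omega>2" "v \<in> H1 \<Omega>" "H1_norm \<Omega> v = 0"
  shows "has_trace \<Omega> M v (\<lambda>_. 0)"
proof -
  have o: "open \<Omega>" using assms(1) \<Omega>_props by auto
  have z: "(\<lambda>_. 0) \<in> H1 \<Omega>" using assms(1) \<Omega>_props by (auto intro!: C1_H1(1) Ck_const simp del: Ck.simps One_nat_def)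
  have "(H1_norm \<Omega> (\<lambda>x. 0 - v x))\<^sup>2 \<le> 0"
    using H1_diff(2)[OF o z assms(2)] assms(3) H1_norm_zero[OF o] by simp
  then have "H1_norm \<Omega> (\<lambda>x. 0 - v x) = 0" by simp
  then have "(\<lambda>n::nat. H1_norm \<Omega> (\<lambda>x. 0 - v x)) \<longlonglongrightarrow> 0" by simp
  then show ?thesis
    unfolding has_trace_def using assms(2) L2_zero Ck_const[of 1 0]
    by (intro conjI exI[of _ "\<lambda>_ _. 0"]) (simp_all del: Ck.simps One_nat_def)
qed

text \<open>Dividing the two estimates gives the inf-sup quotient; \<open>\<eta>\<close> stands for
  \<open>h / k\<close>. A non-zero norm is part of the conclusion because the supremum ranges over
  such functions, and measurability of the jump serves the case of a vanishing multiplier.\<close>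

lemma discrete_test_function:
  fixes Vh :: "(plane \<Rightarrow> real) set" and \<pi>h \<Pi>h :: "(plane \<Rightarrow> real) \<Rightarrow> plane \<Rightarrow> real"
  defines "V \<equiv> V_space \<Omega>1 \<Omega>2 (curve_measure F b) (curve_measure F a)"
  assumes N: "1 \<le> N"
    and Vh: "\<And>v. v \<in> Vh \<Longrightarrow> restr \<Omega>1 v \<in> Vh" "Vh \<subseteq> V"
    and \<Pi>h: "lin_operator (restr \<Omega>1 ` V) (restr \<Omega>1 ` Vh) \<Pi>h"
    and stable: "\<And>v1. v1 \<in> restr \<Omega>1 ` V \<Longrightarrow> H1_norm \<Omega>1 (\<Pi>h v1) \<le> c3 * H1_norm \<Omega>1 v1"
    and commute: "\<And>v1. v1 \<in> restr \<Omega>1 ` V \<Longrightarrow> has_trace \<Omega>1 M (\<Pi>h v1) (\<pi>h (bd_trace \<Omega>1 M v1))"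
    and approx: "\<And>v. v \<in> Hhalf M \<Longrightarrow> Hmhalf_norm M (pairing M (\<lambda>x. v x - \<pi>h v x)) \<le> c4 * \<eta> * Hhalf_norm M v"
    and c: "0 < c3" "0 < c4" and small: "c4 * (real N * \<eta>) \<le> 1 / (1600 * C ^ 6)"
    and A: "0 < dual_energy r s N"
    and \<mu>: "\<And>t. \<mu> (\<gamma> t) = fourier_family.trig (tcomp r s) (\<lambda>_. 1) N t"
  obtains vh where "vh \<in> Vh" "H1_pw_norm \<Omega>1 \<Omega>2 vh \<noteq> 0" "jump \<Omega>1 \<Omega>2 M vh \<in> borel_measurable M"
    "dual_energy r s N / 2 \<le> pairing M \<mu> (jump \<Omega>1 \<Omega>2 M vh)"
    "H1_pw_norm \<Omega>1 \<Omega>2 vh \<le> c3 * sqrt (lift_const * dual_energy r s N)"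
proof -
  interpret e: fourier_family "tcomp r s" by (rule fourier_family_tcomp)
  let ?A = "dual_energy r s N"
  \<comment> \<open>These weights make the pairing with \<open>\<mu>\<close> equal to the dual
    energy, and by \<open>sum_A\<close> the H^{1/2} energy of the weighted polynomial is the same
    number.\<close>
  define \<alpha> where "\<alpha> n = 1 / (1 + real n)" for n :: nat
  have sum_A: "(\<Sum>n\<le>N. (1 + real n) * ((\<alpha> n)\<^sup>2 * e.E n)) = ?A"
    unfolding dual_energy_def
  proof (intro sum.cong refl)
    fix n
    have "m * ((1 / m)\<^sup>2 * x) = x / m" if "0 < m" for m x :: real
      using that by (simp add: power2_eq_square field_simps)
    from this[of "1 + real n" "e.E n"] show "(1 + real n) * ((\<alpha> n)\<^sup>2 * e.E n) = e.E n / (1 + real n)"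
      by (simp add: \<alpha>_def)
  qed
  obtain v where v: "Ck 1 UNIV v" "\<And>t. v (\<gamma> t) = 1 / J t * e.trig \<alpha> N t"
    "\<And>\<xi>. v (F (\<xi>, a)) = 0" "\<And>\<xi>. v (F (\<xi>, b)) = 0" "(H1_norm \<Omega>1 v)\<^sup>2 \<le> lift_const * ?A"
    using trig_lift[of r s \<alpha> N thesis] unfolding sum_A by blast
  have vc: "continuous_on UNIV v" by (rule C1_D(2)[OF v(1)])
  have vL2: "v \<in> L2 M" by (rule continuous_L2_M[OF vc])
  have vm: "v \<in> borel_measurable M" using vL2 by (simp add: L2_def)
  have Jne: "J x \<noteq> 0" for x using J_pos[of x] by simp
  have \<mu>c: "continuous_on UNIV (\<lambda>t. \<mu> (\<gamma> t))" unfolding \<mu> by (rule e.trig_cont)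
  have \<mu>m: "\<mu> \<in> borel_measurable M" by (rule multiplier_measurable[OF \<mu>c])
  have \<mu>L2: "\<mu> \<in> L2 M" by (rule M_continuous_L2[OF \<mu>m \<mu>c])
  have cK: "continuous_on UNIV (\<lambda>t. 1 / J t)" by (intro continuous_intros J_cont) (simp add: Jne)
  have vH: "v \<in> Hhalf M" "(Hhalf_norm M v)\<^sup>2 \<le> 400 * C ^ 6 * ?A"
    using trig_Hhalf[OF fourier_family_tcomp vm cK inverse_J_le inverse_J_lip v(2)] unfolding sum_A by simp_all
  have \<mu>H: "\<mu> \<in> Hhalf M" "(Hhalf_norm M \<mu>)\<^sup>2 \<le> 400 * C ^ 6 * (\<Sum>n\<le>N. (1 + real n) * (1\<^sup>2 * e.E n))"
    using trig_Hhalf[OF fourier_family_tcomp \<mu>m, of "\<lambda>t. 1" r s "\<lambda>_. 1" N] \<mu> C_ge_1 by auto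
  \<comment> \<open>An inverse estimate: \<open>1 + n \<le> 2 * N\<close> trades the H^{1/2} weight
    \<open>1 + n\<close> for the dual weight \<open>1 / (1 + n)\<close> at the cost of
    \<open>(2 * N)\<^sup>2\<close>. This is where \<open>1 \<le> N\<close> enters.\<close>
  have "(\<Sum>n\<le>N. (1 + real n) * (1\<^sup>2 * e.E n)) \<le> (\<Sum>n\<le>N. (2 * real N)\<^sup>2 * (e.E n / (1 + real n)))"
  proof (rule sum_mono)
    fix n assume "n \<in> {..N}"
    then have "(1 + real n) \<le> 2 * real N" using N by auto
    then have "(1 + real n)\<^sup>2 \<le> (2 * real N)\<^sup>2" by (intro power_mono) auto
    then have "(1 + real n)\<^sup>2 * (e.E n / (1 + real n)) \<le> (2 * real N)\<^sup>2 * (e.E n / (1 + real n))"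
      by (intro mult_right_mono divide_nonneg_nonneg e.E_nonneg) auto
    moreover have "m\<^sup>2 * (x / m) = m * x" if "0 < m" for m x :: real
      using that by (simp add: power2_eq_square)
    from this[of "1 + real n" "e.E n"] have "(1 + real n)\<^sup>2 * (e.E n / (1 + real n)) = (1 + real n) * (1\<^sup>2 * e.E n)"
      by simp
    ultimately show "(1 + real n) * (1\<^sup>2 * e.E n) \<le> (2 * real N)\<^sup>2 * (e.E n / (1 + real n))" by simp
  qed
  also have "\<dots> = (2 * real N)\<^sup>2 * ?A" by (simp add: dual_energy_def sum_distrib_left)
  finally have "400 * C ^ 6 * (\<Sum>n\<le>N. (1 + real n) * (1\<^sup>2 * e.E n)) \<le> 400 * C ^ 6 * ((2 * real N)\<^sup>2 * ?A)"
    using C_pos by (intro mult_left_mono) auto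
  with \<mu>H(2) have \<mu>H2: "(Hhalf_norm M \<mu>)\<^sup>2 \<le> 400 * C ^ 6 * ((2 * real N)\<^sup>2 * ?A)" by linarith
  have prod: "Hhalf_norm M v * Hhalf_norm M \<mu> \<le> 400 * C ^ 6 * ?A * (2 * real N)"
  proof (rule power2_le_imp_le)
    have "(Hhalf_norm M v)\<^sup>2 * (Hhalf_norm M \<mu>)\<^sup>2 \<le> (400 * C ^ 6 * ?A) * (400 * C ^ 6 * ((2 * real N)\<^sup>2 * ?A))"
      using vH(2) \<mu>H2 A C_pos by (intro mult_mono) auto
    then show "(Hhalf_norm M v * Hhalf_norm M \<mu>)\<^sup>2 \<le> (400 * C ^ 6 * ?A * (2 * real N))\<^sup>2"
      by (simp add: power_mult_distrib power2_eq_square mult_ac)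
    show "0 \<le> 400 * C ^ 6 * ?A * (2 * real N)" using A C_pos by auto
  qed
  note ob = \<Omega>_props(3-6)
  have "v \<in> V"
    unfolding V_def V_space_def using v(3,4)
    by (auto intro!: C1_H1(1) C1_has_trace v(1) ob L2_zero simp: space_curve_measure simp del: Ck.simps One_nat_def)
  define v1 where "v1 = restr \<Omega>1 v"
  have v1: "v1 \<in> restr \<Omega>1 ` V" unfolding v1_def using \<open>v \<in> V\<close> by blast
  have v1v: "v1 x = v x" if "x \<in> \<Omega>1" for x using that by (simp add: v1_def restr_def)
  have "has_trace \<Omega>1 M v v" by (rule C1_has_trace[OF v(1) ob(1,2) vL2]) simp
  then have tr_v1: "has_trace \<Omega>1 M v1 v" using has_trace_cong[of \<Omega>1 v1 v M v] v1v by blast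
  \<comment> \<open>The commuting property of \<open>\<Pi>h\<close> speaks about the selected trace
    of \<open>v1\<close>, which agrees with the continuous \<open>v\<close> almost everywhere on the
    interface.\<close>
  define w where "w = bd_trace \<Omega>1 M v1"
  note w = bd_trace_AE[OF disjI1[OF refl] tr_v1, folded w_def]
  have wL2: "w \<in> L2 M" using w(1) by (simp add: has_trace_def)
  then have wm: "w \<in> borel_measurable M" by (simp add: L2_def)
  note wH = Hhalf_cong_AE[OF vH(1) wm w(2)]
  define vh where "vh = \<Pi>h v1"
  define g where "g = \<pi>h w"
  have tr_vh: "has_trace \<Omega>1 M vh g" unfolding vh_def g_def w_def by (rule commute[OF v1])
  then have gL2: "g \<in> L2 M" by (simp add: has_trace_def)
  have "vh \<in> restr \<Omega>1 ` Vh" using \<Pi>h v1 unfolding lin_operator_def vh_def by blast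
  then obtain u where u: "u \<in> Vh" "vh = restr \<Omega>1 u" by blast
  then have vhVh: "vh \<in> Vh" using Vh(1) by simp
  have vh0: "vh x = 0" if "x \<in> \<Omega>2" for x using that \<Omega>_disjoint by (auto simp: u(2) restr_def)
  have H1vh: "vh \<in> H1 \<Omega>1" "vh \<in> H1 \<Omega>2" using vhVh Vh(2) by (auto simp: V_def V_space_def)
  have n2: "H1_norm \<Omega>2 vh = 0"
    using H1_cong(2)[of \<Omega>2 vh "\<lambda>_. 0"] vh0 H1_norm_zero[OF ob(3)] by simp
  \<comment> \<open>On \<Omega>2 the test function is zero, so the jump reduces to the trace from
    \<Omega>1.\<close>
  have tr2: "has_trace \<Omega>2 M vh (\<lambda>_. 0)" by (rule zero_trace[OF disjI2[OF refl] H1vh(2) n2])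
  note b1 = bd_trace_AE[OF disjI1[OF refl] tr_vh] and b2 = bd_trace_AE[OF disjI2[OF refl] tr2]
  have bm: "bd_trace \<Omega>1 M vh \<in> borel_measurable M" "bd_trace \<Omega>2 M vh \<in> borel_measurable M"
    using b1(1) b2(1) by (auto simp: has_trace_def L2_def)
  have jm: "jump \<Omega>1 \<Omega>2 M vh \<in> borel_measurable M"
    unfolding jump_def using bm by measurable
  have gm: "g \<in> borel_measurable M" using gL2 by (simp add: L2_def)
  have "pairing M \<mu> (jump \<Omega>1 \<Omega>2 M vh) = (\<integral>x. \<mu> x * g x \<partial>M)"
    unfolding pairing_def
  proof (rule integral_cong_AE)
    show "AE x in M. \<mu> x * jump \<Omega>1 \<Omega>2 M vh x = \<mu> x * g x"
      using b1(2) b2(2) by eventually_elim (simp add: jump_def)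
  qed (use jm \<mu>m gm in measurable)
  also have "\<dots> = (\<integral>x. \<mu> x * w x \<partial>M) - (\<integral>x. (w x - g x) * \<mu> x \<partial>M)"
  proof -
    have "(\<lambda>x. (w x - g x) * \<mu> x) = (\<lambda>x. \<mu> x * w x - \<mu> x * g x)" by (simp add: algebra_simps)
    then show ?thesis
      using L2_mult_integrable[OF \<mu>L2 wL2] L2_mult_integrable[OF \<mu>L2 gL2] by simp
  qed
  also have "(\<integral>x. \<mu> x * w x \<partial>M) = (\<integral>x. \<mu> x * v x \<partial>M)"
    using w(2) by (intro integral_cong_AE) (use \<mu>m wm vm in \<open>auto elim!: eventually_mono\<close>)
  also have "\<dots> = (\<integral>t. J t * (\<mu> (\<gamma> t) * v (\<gamma> t)) \<partial>per)"
    by (rule M_per(3)) (use \<mu>m vm in measurable)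
  also have "\<dots> = (\<integral>t. e.trig (\<lambda>_. 1) N t * e.trig \<alpha> N t \<partial>per)"
    by (simp add: \<mu> v(2) Jne)
  also have "\<dots> = ?A" unfolding e.integral_trig_trig dual_energy_def by (simp add: \<alpha>_def)
  finally have pair: "pairing M \<mu> (jump \<Omega>1 \<Omega>2 M vh) = ?A - pairing M (\<lambda>x. w x - g x) \<mu>"
    by (simp add: pairing_def)
  have "\<bar>pairing M (\<lambda>x. w x - g x) \<mu>\<bar> \<le> Hmhalf_norm M (pairing M (\<lambda>x. w x - g x)) * Hhalf_norm M \<mu>"
    by (rule pairing_le_Hmhalf_norm[OF L2_diff[OF wL2 gL2] \<mu>H(1)])
  also have "\<dots> \<le> (c4 * \<eta> * Hhalf_norm M v) * Hhalf_norm M \<mu>"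
    using approx[OF wH(1)] unfolding wH(2) g_def by (intro mult_right_mono) (auto simp: Hhalf_norm_nonneg)
  also have "\<dots> \<le> ?A / 2"
  \<comment> \<open>For non-negative \<open>\<eta>\<close> the product of the two norms is at most
    \<open>800 * C ^ 6 * N\<close> times the energy, and 1600 in \<open>small\<close> turns this
    into one half; for negative \<open>\<eta>\<close> the bound on the error is at most 0.\<close>
  proof (cases "0 \<le> \<eta>")
    case True
    have "(c4 * \<eta>) * (Hhalf_norm M v * Hhalf_norm M \<mu>) \<le> (c4 * \<eta>) * (400 * C ^ 6 * ?A * (2 * real N))"
      using prod True c by (intro mult_left_mono) auto
    also have "\<dots> = (c4 * (real N * \<eta>)) * (800 * C ^ 6 * ?A)" by (simp add: mult_ac)
    also have "\<dots> \<le> 1 / (1600 * C ^ 6) * (800 * C ^ 6 * ?A)"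
      using small A C_pos by (intro mult_right_mono) auto
    also have "\<dots> = ?A / 2" using C_pos by simp
    finally show ?thesis by (simp add: mult.assoc)
  next
    case False
    then have "c4 * \<eta> \<le> 0" using c by (simp add: mult_nonneg_nonpos)
    then have "(c4 * \<eta>) * (Hhalf_norm M v * Hhalf_norm M \<mu>) \<le> 0"
      by (rule mult_nonpos_nonneg[OF _ mult_nonneg_nonneg[OF Hhalf_norm_nonneg Hhalf_norm_nonneg]])
    then show ?thesis using A by (simp add: mult.assoc)
  qed
  finally have lower: "?A / 2 \<le> pairing M \<mu> (jump \<Omega>1 \<Omega>2 M vh)" unfolding pair by linarith
  have pw: "H1_pw_norm \<Omega>1 \<Omega>2 vh = H1_norm \<Omega>1 vh"
    unfolding H1_pw_norm_def n2 by (simp add: H1_norm_nonneg)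
  have "H1_norm \<Omega>1 v1 = H1_norm \<Omega>1 v" by (rule H1_cong(2)[OF v1v])
  also have "\<dots> = sqrt ((H1_norm \<Omega>1 v)\<^sup>2)" by (simp add: H1_norm_nonneg)
  also have "\<dots> \<le> sqrt (lift_const * ?A)" by (rule real_sqrt_le_mono[OF v(5)])
  finally have "c3 * H1_norm \<Omega>1 v1 \<le> c3 * sqrt (lift_const * ?A)" using c by simp
  then have upper: "H1_pw_norm \<Omega>1 \<Omega>2 vh \<le> c3 * sqrt (lift_const * ?A)"
    using stable[OF v1] unfolding pw by (simp add: vh_def)
  \<comment> \<open>Norm 0 would force the trace, hence the jump and the pairing, to vanish, against
    the lower bound by a positive energy.\<close>
  have "H1_norm \<Omega>1 vh \<noteq> 0"
  proof
    assume "H1_norm \<Omega>1 vh = 0"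
    then have "has_trace \<Omega>1 M vh (\<lambda>_. 0)" by (rule zero_trace[OF disjI1[OF refl] H1vh(1)])
    note b0 = bd_trace_AE(2)[OF disjI1[OF refl] this]
    have "AE x in M. \<mu> x * jump \<Omega>1 \<Omega>2 M vh x = 0"
      using b0 b2(2) by eventually_elim (simp add: jump_def)
    then have "pairing M \<mu> (jump \<Omega>1 \<Omega>2 M vh) = 0"
      unfolding pairing_def by (rule integral_eq_zero_AE)
    then show False using lower A by simp
  qed
  then show ?thesis using that[OF vhVh _ jm lower upper] pw by simp
qed

text \<open>In the constant, 2 comes from the half of the energy kept by the pairing,
  \<open>sqrt lift_const\<close> from the norm of the lifting and \<open>sqrt (8 * C ^ 6)\<close>
  from the dual norm of \<open>\<mu>\<close>. The stability constant is absorbed by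
  \<open>\<theta> \<le> 1 / c3\<close>, which keeps the factor in front of \<open>\<theta>\<close>
  dependent on the geometry alone.\<close>

lemma inf_sup_bound:
  fixes Vh :: "(plane \<Rightarrow> real) set" and \<pi>h \<Pi>h :: "(plane \<Rightarrow> real) \<Rightarrow> plane \<Rightarrow> real"
  defines "V \<equiv> V_space \<Omega>1 \<Omega>2 (curve_measure F b) (curve_measure F a)"
  assumes N: "1 \<le> N"
    and Vh: "\<And>v. v \<in> Vh \<Longrightarrow> restr \<Omega>1 v \<in> Vh" "Vh \<subseteq> V"
    and \<Pi>h: "lin_operator (restr \<Omega>1 ` V) (restr \<Omega>1 ` Vh) \<Pi>h"
    and stable: "\<And>v1. v1 \<in> restr \<Omega>1 ` V \<Longrightarrow> H1_norm \<Omega>1 (\<Pi>h v1) \<le> c3 * H1_norm \<Omega>1 v1"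
    and commute: "\<And>v1. v1 \<in> restr \<Omega>1 ` V \<Longrightarrow> has_trace \<Omega>1 M (\<Pi>h v1) (\<pi>h (bd_trace \<Omega>1 M v1))"
    and approx: "\<And>v. v \<in> Hhalf M \<Longrightarrow> Hmhalf_norm M (pairing M (\<lambda>x. v x - \<pi>h v x)) \<le> c4 * \<eta> * Hhalf_norm M v"
    and c: "0 < c3" "0 < c4" and small: "c4 * (real N * \<eta>) \<le> 1 / (1600 * C ^ 6)"
    and \<theta>: "0 \<le> \<theta>" "\<theta> \<le> 1 / c3"
    and \<mu>: "\<mu> \<in> multiplier_space F c N"
  shows "ereal (1 / (2 * sqrt lift_const * sqrt (8 * C ^ 6)) * \<theta> * Hmhalf_norm M (pairing M \<mu>))
    \<le> (SUP vh \<in> {vh \<in> Vh. H1_pw_norm \<Omega>1 \<Omega>2 vh \<noteq> 0}.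
        ereal (pairing M \<mu> (jump \<Omega>1 \<Omega>2 M vh) / H1_pw_norm \<Omega>1 \<Omega>2 vh))"
proof -
  let ?\<kappa> = "1 / (2 * sqrt lift_const * sqrt (8 * C ^ 6))"
  note test = discrete_test_function[OF N Vh(1) Vh(2)[unfolded V_def] \<Pi>h[unfolded V_def] stable[unfolded V_def]
      commute[unfolded V_def] approx c small]
  obtain r s where rs: "\<forall>\<xi>. \<mu> (F (\<xi>, c)) = (\<Sum>n\<le>N. r n * sin (real n * pi * \<xi>) + s n * cos (real n * pi * \<xi>))"
    using \<mu> unfolding multiplier_space_def trig_poly_def by auto
  interpret e: fourier_family "tcomp r s" by (rule fourier_family_tcomp)
  have \<mu>_eq: "\<mu> (\<gamma> t) = e.trig (\<lambda>_. 1) N t" for t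
    using rs by (simp add: \<gamma>_def e.trig_def tcomp_def)
  have \<mu>m: "\<mu> \<in> borel_measurable M"
    by (rule multiplier_measurable) (simp add: \<mu>_eq e.trig_cont)
  let ?A = "dual_energy r s N" and ?m = "Hmhalf_norm M (pairing M \<mu>)"
  have A0: "0 \<le> ?A" by (rule dual_energy_nonneg)
  have pos: "0 < sqrt lift_const" "0 < sqrt (8 * C ^ 6)" using lift_const_pos C_pos by auto
  have m: "?m \<le> sqrt (8 * C ^ 6) * sqrt ?A"
    using Hmhalf_norm_multiplier_le[OF \<mu>m \<mu>_eq] by (simp only: real_sqrt_mult)
  have \<kappa>: "?\<kappa> * \<theta> * ?m \<le> 1 / (2 * sqrt lift_const * c3) * sqrt ?A"
  proof -
    have "?\<kappa> * \<theta> * ?m \<le> ?\<kappa> * \<theta> * (sqrt (8 * C ^ 6) * sqrt ?A)"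
      using m \<theta> pos by (intro mult_left_mono) auto
    also have "\<dots> = \<theta> * (1 / (2 * sqrt lift_const) * sqrt ?A)" using pos by simp
    also have "\<dots> \<le> 1 / c3 * (1 / (2 * sqrt lift_const) * sqrt ?A)"
      using \<theta> pos A0 by (intro mult_right_mono) auto
    finally show ?thesis by (simp add: mult_ac)
  qed
  show ?thesis
  proof (cases "?A = 0")
    case False
    then have A: "0 < ?A" using A0 by simp
    obtain vh where vh: "vh \<in> Vh" "H1_pw_norm \<Omega>1 \<Omega>2 vh \<noteq> 0" "?A / 2 \<le> pairing M \<mu> (jump \<Omega>1 \<Omega>2 M vh)"
      "H1_pw_norm \<Omega>1 \<Omega>2 vh \<le> c3 * sqrt (lift_const * ?A)"
      by (rule test[OF _ _ _ _ A \<mu>_eq]) blast+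
    have n: "0 < H1_pw_norm \<Omega>1 \<Omega>2 vh" using vh(2) by (simp add: H1_pw_norm_def order_less_le)
    have "?\<kappa> * \<theta> * ?m * H1_pw_norm \<Omega>1 \<Omega>2 vh \<le> 1 / (2 * sqrt lift_const * c3) * sqrt ?A * H1_pw_norm \<Omega>1 \<Omega>2 vh"
      using \<kappa> n by (intro mult_right_mono) auto
    also have "\<dots> \<le> 1 / (2 * sqrt lift_const * c3) * sqrt ?A * (c3 * sqrt (lift_const * ?A))"
      using vh(4) pos c A0 by (intro mult_left_mono) auto
    also have "\<dots> = ?A / 2" using pos c A0 by (simp add: real_sqrt_mult field_simps)
    also have "\<dots> \<le> pairing M \<mu> (jump \<Omega>1 \<Omega>2 M vh)" by (rule vh(3))
    finally have "?\<kappa> * \<theta> * ?m \<le> pairing M \<mu> (jump \<Omega>1 \<Omega>2 M vh) / H1_pw_norm \<Omega>1 \<Omega>2 vh"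
      using n by (simp add: pos_le_divide_eq)
    then have "ereal (?\<kappa> * \<theta> * ?m) \<le> ereal (pairing M \<mu> (jump \<Omega>1 \<Omega>2 M vh) / H1_pw_norm \<Omega>1 \<Omega>2 vh)"
      by simp
    also have "\<dots> \<le> (SUP vh \<in> {vh \<in> Vh. H1_pw_norm \<Omega>1 \<Omega>2 vh \<noteq> 0}.
        ereal (pairing M \<mu> (jump \<Omega>1 \<Omega>2 M vh) / H1_pw_norm \<Omega>1 \<Omega>2 vh))"
      by (rule SUP_upper) (use vh in simp)
    finally show ?thesis .
  next
    case True
    \<comment> \<open>The supremum over the empty set is \<open>-\<infinity>\<close>, so even for a vanishing multiplier some function
      of nonzero norm is needed; the constant multiplier provides one.\<close>
    let ?r = "\<lambda>_::nat. 0 :: real" and ?s = "\<lambda>n::nat. if n = 0 then 1 else 0 :: real"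
    interpret e0: fourier_family "tcomp ?r ?s" by (rule fourier_family_tcomp)
    have one: "1 = e0.trig (\<lambda>_. 1) N t" for t
      by (simp add: e0.trig_def tcomp_def if_distrib[of "\<lambda>x. x * _"] sum.delta cong: if_cong)
    have "e0.E 0 = 2" unfolding e0.E_def by (subst continuous_per(2)) (auto simp: tcomp_def)
    moreover have "e0.E 0 / (1 + real 0) \<le> dual_energy ?r ?s N"
      unfolding dual_energy_def by (rule member_le_sum) (auto intro!: divide_nonneg_nonneg e0.E_nonneg)
    ultimately have pos0: "0 < dual_energy ?r ?s N" by simp
    obtain vh where vh: "vh \<in> Vh" "H1_pw_norm \<Omega>1 \<Omega>2 vh \<noteq> 0" "jump \<Omega>1 \<Omega>2 M vh \<in> borel_measurable M"
      by (rule test[where \<mu> = "\<lambda>_. 1", OF _ _ _ _ pos0 one]) blast+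
    \<comment> \<open>Zero energy means that every component of \<open>\<mu>\<close> has norm zero,
      so \<open>\<mu>\<close> vanishes almost everywhere along the interface and the quotient is 0;
      the left-hand side is then at most 0 by \<open>\<kappa>\<close>.\<close>
    have "(\<integral>t. (e.trig (\<lambda>_. 1) N t)\<^sup>2 \<partial>per) = 0"
    proof -
      have "e.E n / (1 + real n) = 0" if "n \<in> {..N}" for n
        using sum_nonneg_eq_0_iff[of "{..N}" "\<lambda>n. e.E n / (1 + real n)"] True that
        by (simp add: dual_energy_def e.E_nonneg)
      then have "e.E n = 0" if "n \<in> {..N}" for n using that by fastforce
      then show ?thesis unfolding e.integral_trig_power2 by simp
    qed
    then have "AE t in per. (e.trig (\<lambda>_. 1) N t)\<^sup>2 = 0"
      using integral_nonneg_eq_0_iff_AE[OF L2_D(2)[OF e.trig_L2]] by simp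
    then have "AE t in per. J t * (\<mu> (\<gamma> t) * jump \<Omega>1 \<Omega>2 M vh (\<gamma> t)) = 0"
      by eventually_elim (simp add: \<mu>_eq)
    moreover have "pairing M \<mu> (jump \<Omega>1 \<Omega>2 M vh) = (\<integral>t. J t * (\<mu> (\<gamma> t) * jump \<Omega>1 \<Omega>2 M vh (\<gamma> t)) \<partial>per)"
      unfolding pairing_def by (rule M_per(3)) (use \<mu>m vh(3) in measurable)
    ultimately have "pairing M \<mu> (jump \<Omega>1 \<Omega>2 M vh) = 0" by (simp add: integral_eq_zero_AE)
    then have "ereal (?\<kappa> * \<theta> * ?m) \<le> ereal (pairing M \<mu> (jump \<Omega>1 \<Omega>2 M vh) / H1_pw_norm \<Omega>1 \<Omega>2 vh)"
      using \<kappa> True by simp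
    also have "\<dots> \<le> (SUP vh \<in> {vh \<in> Vh. H1_pw_norm \<Omega>1 \<Omega>2 vh \<noteq> 0}.
        ereal (pairing M \<mu> (jump \<Omega>1 \<Omega>2 M vh) / H1_pw_norm \<Omega>1 \<Omega>2 vh))"
      by (rule SUP_upper) (use vh in simp)
    finally show ?thesis .
  qed
qed

end

theorem theorem1:
  fixes F :: "plane \<Rightarrow> plane" and a c b :: real
    and \<Omega>1 \<Omega>2 \<Gamma> \<Sigma>1 \<Sigma>2 :: "plane set"
    and M :: "plane measure" and V :: "(plane \<Rightarrow> real) set"
  assumes geometry: "machine_geometry F a c b \<Omega>1 \<Omega>2 \<Gamma> \<Sigma>1 \<Sigma>2"
    and M: "M = curve_measure F c"
    and V: "V = V_space \<Omega>1 \<Omega>2 (curve_measure F b) (curve_measure F a)"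
  shows "\<exists>\<beta>' :: real \<Rightarrow> real. (\<forall>\<epsilon>. 0 < \<epsilon> \<and> \<epsilon> < 1 \<longrightarrow> 0 < \<beta>' \<epsilon>) \<and>
    (\<forall>c3>0. \<forall>c4>0. \<exists>\<epsilon>. 0 < \<epsilon> \<and> \<epsilon> < 1 \<and>
      (\<forall>(\<sigma> :: real) (h :: real) (k :: nat) (N :: nat) (T :: plane set set)
         (Vh :: (plane \<Rightarrow> real) set) (\<pi>h :: (plane \<Rightarrow> real) \<Rightarrow> plane \<Rightarrow> real)
         (\<Pi>h :: (plane \<Rightarrow> real) \<Rightarrow> plane \<Rightarrow> real).
         1 \<le> k \<and> 1 \<le> N \<and>
         is_mesh a c b T \<and> shape_regular \<sigma> T \<and> h = mesh_size T \<and>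
         discrete_space F \<Omega>1 \<Omega>2 V T k Vh \<and>
         \<pi>h = L2_proj M (trace_space \<Omega>1 M (restr \<Omega>1 ` Vh)) \<and>
         lin_operator (restr \<Omega>1 ` V) (restr \<Omega>1 ` Vh) \<Pi>h \<and>
         (\<forall>v1 \<in> restr \<Omega>1 ` V. H1_norm \<Omega>1 (\<Pi>h v1) \<le> c3 * H1_norm \<Omega>1 v1) \<and>
         (\<forall>v1 \<in> restr \<Omega>1 ` V. has_trace \<Omega>1 M (\<Pi>h v1) (\<pi>h (bd_trace \<Omega>1 M v1))) \<and>
         (\<forall>v \<in> Hhalf M.
            Hmhalf_norm M (pairing M (\<lambda>x. v x - \<pi>h v x)) \<le> c4 * (h / real k) * Hhalf_norm M v) \<and>
         real N * h / real k \<le> 1 - \<epsilon>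
         \<longrightarrow>
         (\<forall>\<mu> \<in> multiplier_space F c N.
            (SUP vh \<in> {vh \<in> Vh. H1_pw_norm \<Omega>1 \<Omega>2 vh \<noteq> 0}.
               ereal (pairing M \<mu> (jump \<Omega>1 \<Omega>2 M vh) / H1_pw_norm \<Omega>1 \<Omega>2 vh))
            \<ge> ereal (\<beta>' \<epsilon> * Hmhalf_norm M (pairing M \<mu>)))))"
proof -
  interpret machine F a c b \<Omega>1 \<Omega>2 \<Gamma> \<Sigma>1 \<Sigma>2 by unfold_locales (rule geometry)
  obtain C where "machine_bounds F a c b \<Omega>1 \<Omega>2 \<Gamma> \<Sigma>1 \<Sigma>2 C" by (rule machine_bounds_exist)
  then interpret machine_bounds F a c b \<Omega>1 \<Omega>2 \<Gamma> \<Sigma>1 \<Sigma>2 C .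
  have M': "machine.M F c = M" by (simp add: M M_def)
  \<comment> \<open>\<open>\<kappa>\<close> depends on the geometry only, as \<open>\<beta>'\<close>
    has to be named before \<open>c3\<close> and \<open>c4\<close>.\<close>
  define \<kappa> where "\<kappa> = 1 / (2 * sqrt lift_const * sqrt (8 * C ^ 6))"
  have \<kappa>: "0 < \<kappa>" using lift_const_pos C_pos by (simp add: \<kappa>_def)
  note bound = inf_sup_bound[folded \<kappa>_def V, unfolded M']
  show ?thesis
  proof (rule exI[of _ "\<lambda>\<epsilon>. \<kappa> * (1 - \<epsilon>)"], intro conjI allI impI)
    show "0 < \<kappa> * (1 - \<epsilon>)" if "0 < \<epsilon> \<and> \<epsilon> < 1" for \<epsilon> using that \<kappa> by simp
  next
    fix c3 c4 :: real assume c: "0 < c3" "0 < c4"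
    \<comment> \<open>\<open>\<theta>\<close> becomes \<open>1 - \<epsilon>\<close>. The entry 1/2
      keeps \<open>\<epsilon>\<close> positive, \<open>1 / c3\<close> absorbs the stability
      constant, and the last entry makes the projection error at most half of the energy.\<close>
    define \<theta> where "\<theta> = min (1 / 2) (min (1 / c3) (1 / (1600 * C ^ 6) / c4))"
    have \<theta>: "0 < \<theta>" "\<theta> \<le> 1 / 2" "\<theta> \<le> 1 / c3" "\<theta> \<le> 1 / (1600 * C ^ 6) / c4"
      using c C_pos by (auto simp: \<theta>_def)
    have c4\<theta>: "c4 * \<theta> \<le> 1 / (1600 * C ^ 6)" using mult_left_mono[OF \<theta>(4), of c4] c by simp
    show "\<exists>\<epsilon>. 0 < \<epsilon> \<and> \<epsilon> < 1 \<and>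
      (\<forall>(\<sigma> :: real) (h :: real) (k :: nat) (N :: nat) (T :: plane set set)
         (Vh :: (plane \<Rightarrow> real) set) (\<pi>h :: (plane \<Rightarrow> real) \<Rightarrow> plane \<Rightarrow> real)
         (\<Pi>h :: (plane \<Rightarrow> real) \<Rightarrow> plane \<Rightarrow> real).
         1 \<le> k \<and> 1 \<le> N \<and>
         is_mesh a c b T \<and> shape_regular \<sigma> T \<and> h = mesh_size T \<and>
         discrete_space F \<Omega>1 \<Omega>2 V T k Vh \<and>
         \<pi>h = L2_proj M (trace_space \<Omega>1 M (restr \<Omega>1 ` Vh)) \<and>
         lin_operator (restr \<Omega>1 ` V) (restr \<Omega>1 ` Vh) \<Pi>h \<and>
         (\<forall>v1 \<in> restr \<Omega>1 ` V. H1_norm \<Omega>1 (\<Pi>h v1) \<le> c3 * H1_norm \<Omega>1 v1) \<and>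
         (\<forall>v1 \<in> restr \<Omega>1 ` V. has_trace \<Omega>1 M (\<Pi>h v1) (\<pi>h (bd_trace \<Omega>1 M v1))) \<and>
         (\<forall>v \<in> Hhalf M.
            Hmhalf_norm M (pairing M (\<lambda>x. v x - \<pi>h v x)) \<le> c4 * (h / real k) * Hhalf_norm M v) \<and>
         real N * h / real k \<le> 1 - \<epsilon>
         \<longrightarrow>
         (\<forall>\<mu> \<in> multiplier_space F c N.
            (SUP vh \<in> {vh \<in> Vh. H1_pw_norm \<Omega>1 \<Omega>2 vh \<noteq> 0}.
               ereal (pairing M \<mu> (jump \<Omega>1 \<Omega>2 M vh) / H1_pw_norm \<Omega>1 \<Omega>2 vh))
            \<ge> ereal (\<kappa> * (1 - \<epsilon>) * Hmhalf_norm M (pairing M \<mu>))))"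
    proof (rule exI[of _ "1 - \<theta>"], intro conjI allI impI ballI; (elim conjE)?)
      show "0 < 1 - \<theta>" "1 - \<theta> < 1" using \<theta> by auto
    next
      fix h :: real and k N :: nat and Vh :: "(plane \<Rightarrow> real) set" and T :: "plane set set"
        and \<pi>h \<Pi>h :: "(plane \<Rightarrow> real) \<Rightarrow> plane \<Rightarrow> real" and \<mu> :: "plane \<Rightarrow> real"
      assume N: "1 \<le> N" and Vh: "discrete_space F \<Omega>1 \<Omega>2 V T k Vh"
        and \<Pi>h: "lin_operator (restr \<Omega>1 ` V) (restr \<Omega>1 ` Vh) \<Pi>h"
        and stable: "\<forall>v1 \<in> restr \<Omega>1 ` V. H1_norm \<Omega>1 (\<Pi>h v1) \<le> c3 * H1_norm \<Omega>1 v1"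
        and commute: "\<forall>v1 \<in> restr \<Omega>1 ` V. has_trace \<Omega>1 M (\<Pi>h v1) (\<pi>h (bd_trace \<Omega>1 M v1))"
        and approx: "\<forall>v \<in> Hhalf M.
            Hmhalf_norm M (pairing M (\<lambda>x. v x - \<pi>h v x)) \<le> c4 * (h / real k) * Hhalf_norm M v"
        and Nh: "real N * h / real k \<le> 1 - (1 - \<theta>)"
        and \<mu>: "\<mu> \<in> multiplier_space F c N"
      have Vh': "\<And>v. v \<in> Vh \<Longrightarrow> restr \<Omega>1 v \<in> Vh" "Vh \<subseteq> V" using Vh by (auto simp: discrete_space_def)
      have "c4 * (real N * (h / real k)) \<le> c4 * \<theta>" using Nh c by (intro mult_left_mono) auto
      then have small: "c4 * (real N * (h / real k)) \<le> 1 / (1600 * C ^ 6)" using c4\<theta> by linarith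
      have "ereal (\<kappa> * \<theta> * Hmhalf_norm M (pairing M \<mu>))
        \<le> (SUP vh \<in> {vh \<in> Vh. H1_pw_norm \<Omega>1 \<Omega>2 vh \<noteq> 0}.
            ereal (pairing M \<mu> (jump \<Omega>1 \<Omega>2 M vh) / H1_pw_norm \<Omega>1 \<Omega>2 vh))"
        by (rule bound[OF N Vh' \<Pi>h stable[rule_format] commute[rule_format] approx[rule_format] c small
              less_imp_le[OF \<theta>(1)] \<theta>(3) \<mu>])
      then show "ereal (\<kappa> * (1 - (1 - \<theta>)) * Hmhalf_norm M (pairing M \<mu>))
        \<le> (SUP vh \<in> {vh \<in> Vh. H1_pw_norm \<Omega>1 \<Omega>2 vh \<noteq> 0}.
            ereal (pairing M \<mu> (jump \<Omega>1 \<Omega>2 M vh) / H1_pw_norm \<Omega>1 \<Omega>2 vh))"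
        by simp
    qed
  qed
qed

end
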